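(* Let $G$ be a simple graph of order $12$ with minimum degree $\delta(G)\ge 6$. Then $G$ contains a $K_6$ minor.
   Context: All graphs are finite, simple and undirected. A minor of $G$ is any graph obtainable from $G$ by a sequence of vertex deletions, edge deletions and edge contractions (an edge contraction identifies the endpoints of the edge, deletes the edge, and deletes any resulting multiple edges). $K_6$ is the complete graph on $6$ vertices. *)

theory Defs
  imports "Graph_Theory.Kuratowski"
begin

text \<open>
  Finite simple undirected graphs are the members of \<^locale>\<open>pair_graph\<close>: an undirected edge
  \<open>uv\<close> is the pair of opposite arcs \<open>(u, v)\<close> and \<open>(v, u)\<close>. Hence the degree of a vertex is its
  out-degree, and deleting an edge removes both arcs.
\<close>

text \<open>Only meaningful for a finite graph with at least one vertex.\<close>

definition min_degree :: "'a pair_pre_digraph \<Rightarrow> nat" where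
  "min_degree G = Min (out_degree (with_proj G) ` pverts G)"

definition delete_vertex :: "'a pair_pre_digraph \<Rightarrow> 'a \<Rightarrow> 'a pair_pre_digraph" where
  "delete_vertex G v =
     \<lparr> pverts = pverts G - {v}, parcs = {e \<in> parcs G. fst e \<noteq> v \<and> snd e \<noteq> v} \<rparr>"

definition delete_edge :: "'a pair_pre_digraph \<Rightarrow> 'a \<Rightarrow> 'a \<Rightarrow> 'a pair_pre_digraph" where
  "delete_edge G u v = \<lparr> pverts = pverts G, parcs = parcs G - {(u, v), (v, u)} \<rparr>"

text \<open>
  The vertex obtained by identifying the endpoints \<open>u\<close> and \<open>v\<close> is again called \<open>u\<close>. Multiple
  edges collapse because the arcs form a set of pairs.
\<close>

definition contract_edge :: "'a pair_pre_digraph \<Rightarrow> 'a \<Rightarrow> 'a \<Rightarrow> 'a pair_pre_digraph" where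
  "contract_edge G u v =
     (let f = id(v := u)
      in \<lparr> pverts = f ` pverts G, parcs = map_prod f f ` (parcs G - {(u, v), (v, u)}) \<rparr>)"

inductive minor_step :: "'a pair_pre_digraph \<Rightarrow> 'a pair_pre_digraph \<Rightarrow> bool" where
  delete_vertex: "v \<in> pverts G \<Longrightarrow> minor_step G (delete_vertex G v)"
| delete_edge: "(u, v) \<in> parcs G \<Longrightarrow> minor_step G (delete_edge G u v)"
| contract_edge: "(u, v) \<in> parcs G \<Longrightarrow> minor_step G (contract_edge G u v)"

definition minor :: "'a pair_pre_digraph \<Rightarrow> 'a pair_pre_digraph \<Rightarrow> bool" where
  "minor H G \<longleftrightarrow> minor_step\<^sup>*\<^sup>* G H"

text \<open>
  \<^const>\<open>complete_digraph\<close> describes complete graphs up to isomorphism, so the names given to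
  contracted vertices are irrelevant here.
\<close>

definition has_complete_minor :: "'a pair_pre_digraph \<Rightarrow> nat \<Rightarrow> bool" where
  "has_complete_minor G n \<longleftrightarrow> (\<exists>H. minor H G \<and> K\<^bsub>n\<^esub> (with_proj H))"

lemma pair_graph_iff:
  "pair_graph G \<longleftrightarrow> finite (pverts G) \<and> finite (parcs G) \<and> sym (parcs G) \<and>
     parcs G \<subseteq> pverts G \<times> pverts G \<and> (\<forall>v. (v, v) \<notin> parcs G)"
proof
  assume "pair_graph G"
  then interpret pair_graph G .
  show "finite (pverts G) \<and> finite (parcs G) \<and> sym (parcs G) \<and>
     parcs G \<subseteq> pverts G \<times> pverts G \<and> (\<forall>v. (v, v) \<notin> parcs G)"
    using pair_sym_arcs pair_no_loops pair_finite_verts pair_finite_arcs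
    by (fastforce simp: symmetric_def dest: in_arcsD1 in_arcsD2)
next
  assume "finite (pverts G) \<and> finite (parcs G) \<and> sym (parcs G) \<and>
     parcs G \<subseteq> pverts G \<times> pverts G \<and> (\<forall>v. (v, v) \<notin> parcs G)"
  then show "pair_graph G"
    by unfold_locales (auto simp: symmetric_def)
qed

lemma minor_step_pair_graph:
  assumes "minor_step G H" "pair_graph G"
  shows "pair_graph H"
  using assms
proof (cases rule: minor_step.cases)
  case (delete_vertex v)
  then show ?thesis using assms(2)
    by (auto simp: pair_graph_iff delete_vertex_def sym_def)
next
  case (delete_edge u v)
  then show ?thesis using assms(2)
    by (auto simp: pair_graph_iff delete_edge_def sym_def)
next
  case (contract_edge u v)
  have G: "finite (pverts G)" "finite (parcs G)" "sym (parcs G)"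
    "parcs G \<subseteq> pverts G \<times> pverts G" "\<And>w. (w, w) \<notin> parcs G"
    using assms(2) by (auto simp: pair_graph_iff)
  define f where "f = id(v := u)"
  define A where "A = parcs G - {(u, v), (v, u)}"
  have H: "pverts H = f ` pverts G" "parcs H = map_prod f f ` A"
    by (simp_all only: contract_edge(1) contract_edge_def Let_def f_def A_def pair_pre_digraph.simps)
  have "sym A" using G(3) by (auto simp: A_def sym_def)
  then have "sym (map_prod f f ` A)" by (fastforce simp: sym_def)
  moreover have "(w, w) \<notin> map_prod f f ` A" for w
    using G(5) by (auto simp: A_def f_def split: if_splits)
  moreover have "map_prod f f ` A \<subseteq> f ` pverts G \<times> f ` pverts G"
    using G(4) by (auto simp: A_def)
  moreover have "finite A" using G(2) by (simp add: A_def)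
  ultimately show ?thesis using G(1) by (simp add: pair_graph_iff H)
qed

lemma minor_pair_graph:
  assumes "minor H G" "pair_graph G"
  shows "pair_graph H"
  using assms(1) unfolding minor_def
  by (induction rule: rtranclp_induct) (auto intro: assms(2) minor_step_pair_graph)

end

theory Submission
  imports Defs
begin

text \<open>
  Delete edges between vertices of degree at least 7 until every edge has an end of degree 6, and
  suppose that there is no \<open>K\<^sub>6\<close> minor. Mader's bound \<open>4n - 9\<close> on the number of edges, for
  \<open>6 \<le> n \<le> 12\<close>, leaves a total degree excess over 6 of 0, 2 or 4. Contracting an edge whose ends
  have few common neighbours leaves a graph that meets or nearly meets this bound; hence every
  edge has many common neighbours, and a vertex that the contraction reduces to degree 5 has a
  dense neighbourhood. Conversely, the five non-neighbours of a vertex of degree 6 span at most 8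
  edges, as \<open>K\<^sub>5\<close> minus an edge there would complete to a \<open>K\<^sub>6\<close> minor; counting edges at the vertex
  bounds the edges among its neighbours from above. The two bounds contradict each other at once
  if the excess is 4. If it is 2, they force a vertex of degree 6 that is one of exactly two common
  neighbours of an edge to be adjacent to all vertices of degree above 6. If it is 0, several edges
  with two common neighbours can be contracted simultaneously unless they form induced squares,
  which leaves only a few configurations around the two vertices adjacent to neither end of such
  an edge.
\<close>

section \<open>Clique minors by branch sets\<close>

text \<open>Minimum degree 6 guarantees 36 edges, whereas Mader's bound on 12 vertices asks for 39.
  Contracting an edge with c common neighbours costs c + 1 edges while the bound drops by 4, so c =
  2 regains exactly one edge: with all degrees equal to 6, three suitable contractions would close
  the gap. Any excess narrows the gap and so raises the lower bound on c. The numbers 12 and 6 fit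
  together through the split 1 + 6 + 5 around a vertex of degree 6: up to excesses, its neighbours
  and its non-neighbours each send 30 minus their inner degree sum across, so a bound on the degree
  sum of the five carries over unchanged to the six. The deletion of edges serves to make the
  vertices of degree above 6 independent, which limits how they can occur as common neighbours.
  Counts are kept as degree sums, twice the numbers of edges; their parity often supplies the last
  unit.\<close>

definition sgraph :: "'a set \<Rightarrow> ('a \<Rightarrow> 'a \<Rightarrow> bool) \<Rightarrow> bool" where
  "sgraph V E \<longleftrightarrow> finite V \<and> (\<forall>x y. E x y \<longrightarrow> x \<in> V \<and> y \<in> V \<and> E y x \<and> x \<noteq> y)"

definition deg_in :: "('a \<Rightarrow> 'a \<Rightarrow> bool) \<Rightarrow> 'a set \<Rightarrow> 'a \<Rightarrow> nat" where
  "deg_in E S x = card {y \<in> S. E x y}"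

definition degsum :: "('a \<Rightarrow> 'a \<Rightarrow> bool) \<Rightarrow> 'a set \<Rightarrow> nat" where
  "degsum E S = (\<Sum>x\<in>S. deg_in E S x)"

text \<open>Cuts instead of paths: a cut of a contracted branch set pulls back to a cut of the
  original one, and conversely.\<close>

definition conn :: "('a \<Rightarrow> 'a \<Rightarrow> bool) \<Rightarrow> 'a set \<Rightarrow> bool" where
  "conn E S \<longleftrightarrow> S \<noteq> {} \<and> (\<forall>A. A \<subseteq> S \<longrightarrow> A \<noteq> {} \<longrightarrow> A \<noteq> S \<longrightarrow> (\<exists>a\<in>A. \<exists>b\<in>S - A. E a b))"

definition touch :: "('a \<Rightarrow> 'a \<Rightarrow> bool) \<Rightarrow> 'a set \<Rightarrow> 'a set \<Rightarrow> bool" where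
  "touch E S T \<longleftrightarrow> (\<exists>a\<in>S. \<exists>b\<in>T. E a b)"

definition clique_minor :: "'a set \<Rightarrow> ('a \<Rightarrow> 'a \<Rightarrow> bool) \<Rightarrow> nat \<Rightarrow> bool" where
  "clique_minor V E n \<longleftrightarrow> (\<exists>B :: nat \<Rightarrow> 'a set. (\<forall>i<n. B i \<subseteq> V \<and> conn E (B i)) \<and>
     (\<forall>i<n. \<forall>j<i. B j \<inter> B i = {} \<and> touch E (B j) (B i)))"

definition contr :: "('a \<Rightarrow> 'a \<Rightarrow> bool) \<Rightarrow> 'a \<Rightarrow> 'a \<Rightarrow> 'a \<Rightarrow> 'a \<Rightarrow> bool" where
  "contr E u v x y \<longleftrightarrow> x \<noteq> y \<and> x \<noteq> v \<and> y \<noteq> v \<and> (E x y \<or> (x = u \<and> E v y) \<or> (y = u \<and> E x v))"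

lemma sgraphD:
  assumes "sgraph V E"
  shows "finite V" "E x y \<Longrightarrow> x \<in> V" "E x y \<Longrightarrow> y \<in> V" "E x y \<Longrightarrow> E y x" "\<not> E x x"
  using assms unfolding sgraph_def by blast+

lemma sgraph_sym: "sgraph V E \<Longrightarrow> E x y \<longleftrightarrow> E y x"
  unfolding sgraph_def by blast

lemma conn_singleton: "conn E {a}"
  unfolding conn_def by auto

lemma conn_insert:
  assumes S: "conn E S" and b: "b \<in> S" "E a b" "E b a"
  shows "conn E (insert a S)"
proof (cases "a \<in> S")
  case True
  then show ?thesis using S by (simp add: insert_absorb)
next
  case False
  show ?thesis unfolding conn_def
  proof (intro conjI allI impI)
    fix A assume A: "A \<subseteq> insert a S" "A \<noteq> {}" "A \<noteq> insert a S"
    consider "A = {a}" | "A = S" | "a \<notin> A" "A \<noteq> S" | "a \<in> A" "A \<noteq> {a}" by blast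
    then show "\<exists>x\<in>A. \<exists>y\<in>insert a S - A. E x y"
    proof cases
      case 1 then show ?thesis using b False by auto
    next
      case 2 then show ?thesis using b False by auto
    next
      case 3
      then have "A \<subseteq> S" using A by auto
      then show ?thesis using S A 3 unfolding conn_def by blast
    next
      case 4
      have "A - {a} \<subseteq> S" "A - {a} \<noteq> {}" "A - {a} \<noteq> S" using A 4 by auto
      then obtain x y where "x \<in> A - {a}" "y \<in> S - (A - {a})" "E x y"
        using S unfolding conn_def by blast
      then show ?thesis using False by auto
    qed
  qed auto
qed

text \<open>For six explicit branch sets given as a list, \<open>sorted_wrt\<close> unfolds into the
  fifteen pairwise conditions.\<close>

lemma clique_minorI:
  assumes "\<forall>S\<in>set Bs. S \<subseteq> V \<and> conn E S"
    and "sorted_wrt (\<lambda>S T. S \<inter> T = {} \<and> touch E S T) Bs" and "length Bs = n"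
  shows "clique_minor V E n"
  unfolding clique_minor_def
  using assms by (intro exI[of _ "\<lambda>i. Bs ! i"]) (auto simp: sorted_wrt_iff_nth_less)

lemma clique_minor_mono:
  assumes "clique_minor V E n" "V \<subseteq> V'" "\<And>x y. E x y \<Longrightarrow> E' x y"
  shows "clique_minor V' E' n"
proof -
  have "conn E' S" if S: "conn E S" for S
    unfolding conn_def
  proof (intro conjI allI impI)
    show "S \<noteq> {}" using S unfolding conn_def by blast
    fix A assume "A \<subseteq> S" "A \<noteq> {}" "A \<noteq> S"
    then obtain a b where "a \<in> A" "b \<in> S - A" "E a b" using S unfolding conn_def by blast
    then show "\<exists>a\<in>A. \<exists>b\<in>S - A. E' a b" using assms(3) by blast
  qed
  moreover have "touch E' S T" if "touch E S T" for S T
    using that assms(3) unfolding touch_def by blast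
  moreover obtain B where "\<forall>i<n. B i \<subseteq> V \<and> conn E (B i)"
     "\<forall>i<n. \<forall>j<i. B j \<inter> B i = {} \<and> touch E (B j) (B i)"
    using assms(1) unfolding clique_minor_def by blast
  ultimately show ?thesis
    using assms(2) unfolding clique_minor_def by (intro exI[of _ B]) (meson order_trans)
qed

lemma sgraph_contr:
  assumes "sgraph V E" "E u v"
  shows "sgraph (V - {v}) (contr E u v)"
proof -
  note D = sgraphD[OF assms(1)]
  have "x \<in> V - {v} \<and> y \<in> V - {v} \<and> contr E u v y x \<and> x \<noteq> y" if "contr E u v x y" for x y
    using that D(2,3)[of x y] D(2,3)[of v y] D(2,3)[of x v] D(2)[OF assms(2)] D(4)
    unfolding contr_def by blast
  then show ?thesis using D(1) unfolding sgraph_def by blast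
qed

text \<open>\<open>g\<close> puts \<open>v\<close> back into the branch set that contains
  \<open>u\<close>; every edge of the contracted graph then lifts to an edge between the enlarged
  sets.\<close>

lemma clique_minor_contr:
  assumes G: "sgraph V E" and uv: "E u v" and m: "clique_minor (V - {v}) (contr E u v) n"
  shows "clique_minor V E n"
proof -
  define g where "g = (\<lambda>S. if u \<in> S then insert v S else S)"
  obtain B where B0: "\<forall>i<n. B i \<subseteq> V - {v} \<and> conn (contr E u v) (B i)"
    "\<forall>i<n. \<forall>j<i. B j \<inter> B i = {} \<and> touch (contr E u v) (B j) (B i)"
    using m unfolding clique_minor_def by (elim exE conjE)
  have B: "B i \<subseteq> V - {v} \<and> conn (contr E u v) (B i)" if "i < n" for i
    using B0(1) that by simp
  have B2: "B j \<inter> B i = {} \<and> touch (contr E u v) (B j) (B i)" if "i < n" "j < i" for i j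
    using B0(2) that by simp
  note sym = sgraphD(4)[OF G] and irr = sgraphD(5)[OF G]
  have uv': "u \<in> V" "v \<in> V" "u \<noteq> v" using sgraphD(2,3)[OF G uv] uv irr[of u] by auto
  have edge: "\<exists>a'\<in>g {a}. \<exists>b'\<in>g {b}. E a' b'" if "contr E u v a b" for a b
    using that sym unfolding contr_def g_def by auto
  have gsub: "g {a} \<subseteq> g S" if "a \<in> S" for a S using that by (auto simp: g_def)
  have conng: "conn E (g S)" if S: "conn (contr E u v) S" "v \<notin> S" for S
    unfolding conn_def
  proof (intro conjI allI impI)
    show "g S \<noteq> {}" using S unfolding conn_def g_def by auto
    fix A assume A: "A \<subseteq> g S" "A \<noteq> {}" "A \<noteq> g S"
    show "\<exists>a\<in>A. \<exists>b\<in>g S - A. E a b"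
    \<comment> \<open>A cut that separates \<open>u\<close> from \<open>v\<close> is crossed by the
      edge \<open>uv\<close> itself; every other cut comes from a cut of the contracted set.\<close>
    proof (cases "u \<in> S \<and> (u \<in> A) \<noteq> (v \<in> A)")
      case True
      then have "u \<in> g S" "v \<in> g S" by (auto simp: g_def)
      then show ?thesis using True uv sym by blast
    next
      case False
      define A' where "A' = A - {v}"
      have gA: "g A' = A" using False A S(2) by (auto simp: g_def A'_def split: if_splits)
      have "A' \<subseteq> S" using A by (auto simp: A'_def g_def split: if_splits)
      moreover have "A' \<noteq> {}" using gA A(2) by (auto simp: g_def)
      moreover have "A' \<noteq> S" using gA A(3) by auto
      ultimately obtain a b where ab: "a \<in> A'" "b \<in> S - A'" "contr E u v a b"
        using S(1) unfolding conn_def by blast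
      obtain a' b' where ab': "a' \<in> g {a}" "b' \<in> g {b}" "E a' b'" using edge[OF ab(3)] by blast
      have "a' \<in> A" using ab' gsub[OF ab(1)] gA by auto
      moreover have "b' \<in> g S" using ab' gsub[of b S] ab(2) by auto
      moreover have "b' \<notin> A"
        using ab'(2) ab(2) S(2) False A by (auto simp: g_def A'_def split: if_splits)
      ultimately show ?thesis using ab'(3) by blast
    qed
  qed
  show ?thesis unfolding clique_minor_def
  proof (intro exI[of _ "\<lambda>i. g (B i)"] conjI allI impI)
    fix i assume i: "i < n"
    show "g (B i) \<subseteq> V" using B[OF i] uv' by (auto simp: g_def)
    show "conn E (g (B i))" using conng B[OF i] by auto
    fix j assume j: "j < i"
    have "v \<notin> B i" "v \<notin> B j" using B[OF i] B[of j] i j by auto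
    then show "g (B j) \<inter> g (B i) = {}" using B2[OF i j] by (auto simp: g_def split: if_splits)
    obtain a b where "a \<in> B j" "b \<in> B i" "contr E u v a b"
      using B2[OF i j] unfolding touch_def by blast
    then show "touch E (g (B j)) (g (B i))" using edge[of a b] gsub unfolding touch_def by blast
  qed
qed

section \<open>Degree sums under removal of a vertex, contraction and deletion of an edge\<close>

lemma degsum_insert:
  assumes G: "sgraph V E" and S: "finite S" "x \<notin> S"
  shows "degsum E (insert x S) = degsum E S + 2 * deg_in E S x"
proof -
  have 1: "deg_in E (insert x S) y = deg_in E S y + (if E x y then 1 else 0)" if "y \<in> S" for y
  proof -
    have "{z \<in> insert x S. E y z} = (if E x y then insert x {z \<in> S. E y z} else {z \<in> S. E y z})"
      using sgraph_sym[OF G] by auto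
    then show ?thesis using S by (simp add: deg_in_def)
  qed
  have 2: "deg_in E (insert x S) x = deg_in E S x"
    using sgraphD(5)[OF G] unfolding deg_in_def by (intro arg_cong[where f = card]) auto
  have "(\<Sum>y\<in>S. if E x y then 1 else 0 :: nat) = deg_in E S x"
    using S by (simp add: deg_in_def sum.If_cases Int_def)
  then show ?thesis using S by (simp add: degsum_def 1 2 sum.distrib)
qed

lemma degsum_remove:
  assumes G: "sgraph V E" and S: "finite S" "x \<in> S"
  shows "degsum E S = degsum E (S - {x}) + 2 * deg_in E S x"
proof -
  have "deg_in E S x = deg_in E (S - {x}) x"
    using sgraphD(5)[OF G] unfolding deg_in_def by (intro arg_cong[where f = card]) auto
  then show ?thesis using degsum_insert[OF G, of "S - {x}" x] S by (simp add: insert_absorb)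
qed

lemma even_degsum:
  assumes "sgraph V E" "finite S"
  shows "even (degsum E S)"
  using assms(2)
proof (induction S)
  case empty
  then show ?case by (simp add: degsum_def)
next
  case (insert x S)
  then show ?case using degsum_insert[OF assms(1) insert.hyps] by simp
qed

text \<open>Besides \<open>uv\<close> itself, each common neighbour costs one edge, since its edges
  to \<open>u\<close> and \<open>v\<close> become one.\<close>

lemma degsum_contr:
  assumes G: "sgraph V E" and S: "finite S" "u \<in> S" "v \<in> S" and uv: "E u v"
  shows "degsum (contr E u v) (S - {v}) + 2 + 2 * card {x \<in> S. E u x \<and> E v x} = degsum E S"
proof -
  note sym = sgraph_sym[OF G] and irr = sgraphD(5)[OF G]
  define R where "R = S - {u, v}"
  define c where "c = card {x \<in> S. E u x \<and> E v x}"
  have uv': "u \<noteq> v" using uv irr by metis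
  have R: "finite R" "u \<notin> R" "v \<notin> R" "S = insert v (insert u R)" "S - {v} = insert u R"
    using S uv' by (auto simp: R_def)
  have G': "sgraph (V - {v}) (contr E u v)" by (rule sgraph_contr[OF G uv])
  have agree: "degsum (contr E u v) R = degsum E R"
    unfolding degsum_def deg_in_def
    by (intro sum.cong refl arg_cong[where f = card]) (auto simp: contr_def R_def irr)
  have du: "deg_in (contr E u v) R u + c = deg_in E R u + deg_in E R v"
  proof -
    have "{y \<in> R. contr E u v u y} = {y \<in> R. E u y} \<union> {y \<in> R. E v y}"
      using R(2,3) uv' by (auto simp: contr_def)
    moreover have "{x \<in> S. E u x \<and> E v x} = {y \<in> R. E u y} \<inter> {y \<in> R. E v y}"
      using irr by (auto simp: R_def)
    ultimately show ?thesis
      using card_Un_Int[of "{y \<in> R. E u y}" "{y \<in> R. E v y}"] R(1) by (simp add: deg_in_def c_def)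
  qed
  have dv: "deg_in E (insert u R) v = Suc (deg_in E R v)"
  proof -
    have "{y \<in> insert u R. E v y} = insert u {y \<in> R. E v y}" using uv sym by auto
    then show ?thesis using R by (simp add: deg_in_def)
  qed
  have "degsum E S = degsum E R + 2 * deg_in E R u + 2 * Suc (deg_in E R v)"
    unfolding R(4) using R(1-3) uv' by (simp add: degsum_insert[OF G] dv)
  moreover have "degsum (contr E u v) (S - {v}) = degsum E R + 2 * deg_in (contr E u v) R u"
    unfolding R(5) using R(1,2) by (simp add: degsum_insert[OF G'] agree)
  ultimately show ?thesis using du by (simp add: c_def[symmetric])
qed

lemma degsum_delete_edge:
  assumes G: "sgraph V E" and ab: "E a b"
  defines "E' \<equiv> \<lambda>x y. E x y \<and> {x, y} \<noteq> {a, b}"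
  shows "sgraph V E'" "degsum E' V + 2 = degsum E V"
    "deg_in E' V a + 1 = deg_in E V a" "deg_in E' V b + 1 = deg_in E V b"
    "\<And>x. x \<noteq> a \<Longrightarrow> x \<noteq> b \<Longrightarrow> deg_in E' V x = deg_in E V x"
proof -
  note D = sgraphD[OF G]
  have ab': "a \<in> V" "b \<in> V" "a \<noteq> b" "finite V" using D(1) D(2,3)[OF ab] ab D(5) by auto
  show G': "sgraph V E'" using G by (auto simp: sgraph_def E'_def)
  have "{y \<in> V. E a y} = insert b {y \<in> V. E' a y}" "b \<notin> {y \<in> V. E' a y}"
    "{y \<in> V. E b y} = insert a {y \<in> V. E' b y}" "a \<notin> {y \<in> V. E' b y}"
    using ab ab' D by (auto simp: E'_def doubleton_eq_iff)
  then show da: "deg_in E' V a + 1 = deg_in E V a" and db: "deg_in E' V b + 1 = deg_in E V b"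
    using ab' by (simp_all add: deg_in_def)
  show dx: "deg_in E' V x = deg_in E V x" if "x \<noteq> a" "x \<noteq> b" for x
    using that unfolding deg_in_def E'_def by (intro arg_cong[where f = card]) auto
  have V: "V = insert a (insert b (V - {a, b}))" using ab' by auto
  have "(\<Sum>x\<in>V - {a, b}. deg_in E' V x) = (\<Sum>x\<in>V - {a, b}. deg_in E V x)"
    by (intro sum.cong) (auto simp: dx)
  moreover have "(\<Sum>x\<in>V. f x) = f a + f b + (\<Sum>x\<in>V - {a, b}. f x)" for f :: "'a \<Rightarrow> nat"
    using ab' by (subst V) (simp add: insert_Diff_if)
  ultimately show "degsum E' V + 2 = degsum E V" using da db by (simp add: degsum_def)
qed

section \<open>Mader's edge bound\<close>

lemma conn_pair: "sgraph V E \<Longrightarrow> E a b \<Longrightarrow> conn E {a, b}"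
  using conn_insert[OF conn_singleton, of b b E a] by (auto dest: sgraphD(4))

lemma degsum_ge:
  assumes "\<And>x. x \<in> S \<Longrightarrow> k \<le> deg_in E S x"
  shows "k * card S \<le> degsum E S"
  using sum_mono[of S "\<lambda>_. k" "deg_in E S"] assms by (simp add: degsum_def mult.commute)

lemma deg_in_compl:
  assumes G: "sgraph V E" and S: "finite S" "x \<in> S"
  shows "deg_in E S x + card {y \<in> S. y \<noteq> x \<and> \<not> E x y} + 1 = card S"
proof -
  have "S = insert x ({y \<in> S. E x y} \<union> {y \<in> S. y \<noteq> x \<and> \<not> E x y})" using S by auto
  then have "card S = card (insert x ({y \<in> S. E x y} \<union> {y \<in> S. y \<noteq> x \<and> \<not> E x y}))" by simp
  also have "\<dots> = Suc (card ({y \<in> S. E x y} \<union> {y \<in> S. y \<noteq> x \<and> \<not> E x y}))"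
    using S sgraphD(5)[OF G] by (intro card_insert_disjoint) auto
  also have "card ({y \<in> S. E x y} \<union> {y \<in> S. y \<noteq> x \<and> \<not> E x y}) =
      card {y \<in> S. E x y} + card {y \<in> S. y \<noteq> x \<and> \<not> E x y}"
    using S by (intro card_Un_disjoint) auto
  finally show ?thesis by (simp add: deg_in_def)
qed

lemma clique_minor_complete:
  assumes G: "sgraph V E" and S: "S \<subseteq> V" "card S = n" "\<And>x y. x \<in> S \<Longrightarrow> y \<in> S \<Longrightarrow> x \<noteq> y \<Longrightarrow> E x y"
  shows "clique_minor V E n"
proof -
  have "finite S" using S(1) sgraphD(1)[OF G] finite_subset by blast
  then obtain xs where xs: "set xs = S" "distinct xs" using finite_distinct_list by blast
  then have l: "length xs = n" using S(2) distinct_card by fastforce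
  show ?thesis
  proof (rule clique_minorI[where Bs = "map (\<lambda>x. {x}) xs"])
    show "sorted_wrt (\<lambda>S T. S \<inter> T = {} \<and> touch E S T) (map (\<lambda>x. {x}) xs)"
      using xs S(3) by (auto simp: sorted_wrt_iff_nth_less touch_def nth_eq_iff_index_eq)
  qed (use xs l S(1) conn_singleton in auto)
qed

lemma card_4_obtain:
  assumes "card U = 4" "x \<in> U" "y \<in> U" "x \<noteq> y"
  obtains z w where "U = {x, y, z, w}" "z \<noteq> w" "z \<noteq> x" "z \<noteq> y" "w \<noteq> x" "w \<noteq> y"
proof -
  have "finite U" using assms(1) card.infinite by fastforce
  then have "card (U - {x, y}) = 2" using assms by (simp add: card_Diff_subset)
  then obtain z w where "U - {x, y} = {z, w}" "z \<noteq> w" unfolding card_2_iff by blast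
  then show ?thesis using that[of z w] assms(2,3) by blast
qed

text \<open>By \<open>uniq\<close> the non-edges inside \<open>S\<close> form a matching. Absorbing
  \<open>C\<close> into \<open>p\<close> supplies the missing contact of \<open>p\<close> with
  \<open>p'\<close>, and \<open>v\<close> sees all of \<open>S\<close>; three pairwise touching
  branch sets remain to be found in the other four vertices \<open>U\<close>.\<close>

lemma clique_minor_octahedron:
  assumes G: "sgraph V E" and v: "v \<in> V" and S: "S \<subseteq> V" "card S = 6" "\<And>y. y \<in> S \<Longrightarrow> E v y"
    and uniq: "\<And>x y z. x \<in> S \<Longrightarrow> y \<in> S \<Longrightarrow> z \<in> S \<Longrightarrow> y \<noteq> x \<Longrightarrow> z \<noteq> x \<Longrightarrow> \<not> E x y \<Longrightarrow> \<not> E x z \<Longrightarrow> y = z"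
    and p: "p \<in> S" "p' \<in> S" "p \<noteq> p'" "\<not> E p p'"
    and C: "conn E C" "C \<subseteq> V" "C \<inter> insert v S = {}" "touch E {p} C" "touch E {p'} C"
  shows "clique_minor V E 6"
proof -
  note sym = sgraph_sym[OF G] and irr = sgraphD(5)[OF G]
  define U where "U = S - {p, p'}"
  have "finite S" using S(1) sgraphD(1)[OF G] finite_subset by blast
  then have U: "card U = 4" using p S(2) by (simp add: U_def card_Diff_subset)
  have vS: "v \<notin> S" using S(3) irr by blast
  have pU: "E p x" "E p' x" if "x \<in> U" for x
    using that uniq[of p p' x] uniq[of p' p x] p sym by (auto simp: U_def)
  obtain c where "c \<in> C" "E p c" using C(4) by (auto simp: touch_def)
  then have cp: "conn E (insert p C)" using conn_insert[OF C(1)] sym by blast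
  have tp: "touch E (insert p C) {p'}" using C(5) sym by (auto simp: touch_def)
  show ?thesis
  proof (cases "\<exists>x\<in>U. \<exists>y\<in>U. x \<noteq> y \<and> \<not> E x y")
    case True
    then obtain x y where xy: "x \<in> U" "y \<in> U" "x \<noteq> y" "\<not> E x y" by blast
    obtain z w where zw: "U = {x, y, z, w}" "z \<noteq> w" "z \<noteq> x" "z \<noteq> y" "w \<noteq> x" "w \<noteq> y"
      using card_4_obtain[OF U xy(1-3)] by metis
    have US: "U \<subseteq> S" by (auto simp: U_def)
    have pU': "E p x" "E p' x" "E p y" "E p' y" "E p z" "E p' z" "E p w" "E p' w" using pU zw(1) by auto
    have nin: "p' \<notin> C" "x \<notin> C" "y \<notin> C" "z \<notin> C" "w \<notin> C" "v \<notin> C" "p \<noteq> p'" "p' \<noteq> p" "x \<noteq> p" "x \<noteq> p'"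
      "y \<noteq> p" "y \<noteq> p'" "z \<noteq> p" "z \<noteq> p'" "w \<noteq> p" "w \<noteq> p'" "v \<noteq> p" "v \<noteq> p'" "v \<noteq> x" "v \<noteq> y" "v \<noteq> z" "v \<noteq> w"
      using C(3) p vS US zw(1) by (auto simp: U_def)
    have Sv: "E p v" "E p' v" "E x v" "E y v" "E z v" "E w v" using S(3) p US zw(1) sym by auto
    \<comment> \<open>Both \<open>z\<close> and \<open>w\<close> are adjacent to \<open>x\<close>
      and to \<open>y\<close>. Hence \<open>{x}\<close>, \<open>{y, z}\<close> and
      \<open>{w}\<close> touch pairwise although \<open>xy\<close>, and possibly \<open>zw\<close>,
      is a non-edge.\<close>
    have e: "E x z" "E x w" "E y z" "E y w"
      using uniq[of x y z] uniq[of x y w] uniq[of y x z] uniq[of y x w] xy zw US sym by auto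
    show ?thesis
    proof (rule clique_minorI[where Bs = "[insert p C, {p'}, {x}, {y, z}, {w}, {v}]"])
      show "\<forall>S\<in>set [insert p C, {p'}, {x}, {y, z}, {w}, {v}]. S \<subseteq> V \<and> conn E S"
        using cp C(2) p S(1) v US zw(1) conn_pair[OF G e(3)] conn_singleton by auto
      show "sorted_wrt (\<lambda>S T. S \<inter> T = {} \<and> touch E S T) [insert p C, {p'}, {x}, {y, z}, {w}, {v}]"
        using tp nin zw(2-) xy(3) pU' e e[THEN sgraphD(4)[OF G]] Sv by (simp add: touch_def)
    qed simp
  next
    case False
    obtain x where "x \<in> U" using U by fastforce
    moreover have "U \<noteq> {x}" using U by auto
    ultimately obtain y where xy: "x \<in> U" "y \<in> U" "x \<noteq> y" by blast
    obtain z w where zw: "U = {x, y, z, w}" "z \<noteq> w" "z \<noteq> x" "z \<noteq> y" "w \<noteq> x" "w \<noteq> y"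
      using card_4_obtain[OF U xy] by metis
    have US: "U \<subseteq> S" by (auto simp: U_def)
    have pU': "E p x" "E p' x" "E p y" "E p' y" "E p z" "E p' z" "E p w" "E p' w" using pU zw(1) by auto
    have nin: "p' \<notin> C" "x \<notin> C" "y \<notin> C" "z \<notin> C" "w \<notin> C" "v \<notin> C" "p \<noteq> p'" "p' \<noteq> p" "x \<noteq> p" "x \<noteq> p'"
      "y \<noteq> p" "y \<noteq> p'" "z \<noteq> p" "z \<noteq> p'" "w \<noteq> p" "w \<noteq> p'" "v \<noteq> p" "v \<noteq> p'" "v \<noteq> x" "v \<noteq> y" "v \<noteq> z" "v \<noteq> w"
      using C(3) p vS US zw(1) by (auto simp: U_def)
    have Sv: "E p v" "E p' v" "E x v" "E y v" "E z v" "E w v" using S(3) p US zw(1) sym by auto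
    have e: "E x y" "E x z" "E y z" using False zw xy(3) by auto
    show ?thesis
    proof (rule clique_minorI[where Bs = "[insert p C, {p'}, {x}, {y}, {z}, {v}]"])
      show "\<forall>S\<in>set [insert p C, {p'}, {x}, {y}, {z}, {v}]. S \<subseteq> V \<and> conn E S"
        using cp C(2) p S(1) v US zw(1) conn_singleton by auto
      show "sorted_wrt (\<lambda>S T. S \<inter> T = {} \<and> touch E S T) [insert p C, {p'}, {x}, {y}, {z}, {v}]"
        using tp nin zw(2-) xy(3) pU' e Sv by (simp add: touch_def)
    qed simp
  qed
qed

text \<open>The six neighbours of \<open>v\<close> induce minimum degree 4, so their non-edges form
  a matching, and any connected set outside that touches both ends of a non-edge gives a model. If
  the at most five remaining vertices are connected, degree 6 makes both ends reach them. If not,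
  one side has at most two vertices; a vertex there sees at least five of the six neighbours of
  \<open>v\<close>, and a non-edge survives the removal of any one neighbour.\<close>

lemma clique_minor_deg6:
  assumes G: "sgraph V E" and n: "card V \<le> 12" and v: "v \<in> V" "deg_in E V v = 6"
    and t: "\<And>x. E v x \<Longrightarrow> 4 \<le> card {y \<in> V. E v y \<and> E x y}"
    and d: "\<And>x. x \<in> V \<Longrightarrow> 6 \<le> deg_in E V x"
  shows "clique_minor V E 6"
proof (rule ccontr)
  assume no: "\<not> clique_minor V E 6"
  note sym = sgraph_sym[OF G] and irr = sgraphD(5)[OF G] and fin = sgraphD(1)[OF G]
  define S where "S = {y \<in> V. E v y}"
  define R where "R = V - insert v S"
  have S: "S \<subseteq> V" "card S = 6" "finite S" "v \<notin> S" "\<And>y. y \<in> S \<Longrightarrow> E v y"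
    using v fin irr by (auto simp: S_def deg_in_def)
  have R: "finite R" "card R \<le> 5"
    using fin S v n by (auto simp: R_def card_Diff_subset card_insert_if)
  have dS: "4 \<le> deg_in E S x" if "x \<in> S" for x
  proof -
    have "{y \<in> V. E v y \<and> E x y} = {y \<in> S. E x y}" by (auto simp: S_def)
    then show ?thesis using t[of x] S(5)[OF that] by (simp add: deg_in_def)
  qed
  have uniq: "y = z" if "x \<in> S" "y \<in> S" "z \<in> S" "y \<noteq> x" "z \<noteq> x" "\<not> E x y" "\<not> E x z" for x y z
  proof -
    have "card {y \<in> S. y \<noteq> x \<and> \<not> E x y} \<le> 1"
      using deg_in_compl[OF G S(3) that(1)] dS[OF that(1)] S(2) by simp
    then show ?thesis using that S(3) by (auto simp: card_le_Suc0_iff_eq)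
  qed
  have ex: "\<exists>p\<in>S - {a}. \<exists>p'\<in>S - {a}. p \<noteq> p' \<and> \<not> E p p'" if "a \<in> S" for a
  proof (rule ccontr)
    assume "\<not> ?thesis"
    then have "clique_minor V E 6"
      using S v that sym by (intro clique_minor_complete[OF G, of "insert v (S - {a})"]) (auto simp: card_insert_if)
    then show False using no by simp
  qed
  obtain p p' where p: "p \<in> S" "p' \<in> S" "p \<noteq> p'" "\<not> E p p'"
    using ex S(2) by (metis DiffD1 all_not_in_conv card.empty zero_neq_numeral)
  have toR: "touch E {x} R" if "x \<in> S" "y \<in> S" "y \<noteq> x" "\<not> E x y" for x y
  proof (rule ccontr)
    assume "\<not> ?thesis"
    then have "{z \<in> V. E x z} \<subseteq> insert v (S - {x, y})" using that irr by (auto simp: touch_def R_def)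
    then have "card {z \<in> V. E x z} \<le> card (insert v (S - {x, y}))" using S(3) by (intro card_mono) auto
    also have "\<dots> \<le> 5" using S that by (simp add: card_insert_if card_Diff_subset)
    finally show False using d[of x] S(1) that(1) by (auto simp: deg_in_def)
  qed
  have noC: False if "conn E C" "C \<subseteq> R" "touch E {x} C" "touch E {y} C" "x \<in> S" "y \<in> S" "x \<noteq> y" "\<not> E x y" for C x y
  proof -
    have "clique_minor V E 6"
    proof (rule clique_minor_octahedron[OF G v(1) S(1,2) _ _ that(5-8) that(1) _ _ that(3,4)])
      show "E v y" if "y \<in> S" for y using S(5) that .
      show "C \<subseteq> V" "C \<inter> insert v S = {}" using that(2) by (auto simp: R_def)
    qed (rule uniq)
    then show False using no by blast
  qed
  have "\<not> conn E R" using noC[of R p p'] toR[of p p'] toR[of p' p] p sym by auto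
  moreover have "R \<noteq> {}" using toR[of p p'] p by (auto simp: touch_def)
  ultimately obtain A where A: "A \<subseteq> R" "A \<noteq> {}" "A \<noteq> R" "\<And>a b. a \<in> A \<Longrightarrow> b \<in> R - A \<Longrightarrow> \<not> E a b"
    unfolding conn_def by blast
  have small: False if B: "B \<subseteq> R" "B \<noteq> {}" "card B \<le> 2" "\<And>a b. a \<in> B \<Longrightarrow> b \<in> R - B \<Longrightarrow> \<not> E a b" for B
  proof -
    obtain r where r: "r \<in> B" using B(2) by blast
    then have rV: "r \<in> V" "r \<notin> S" "\<not> E v r" using B(1) by (auto simp: R_def S_def)
    have "{z \<in> V. E r z} \<subseteq> (B - {r}) \<union> {z \<in> S. E r z}"
      using B(4)[OF r] rV sym irr[of r] by (auto simp: R_def)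
    then have "card {z \<in> V. E r z} \<le> card ((B - {r}) \<union> {z \<in> S. E r z})"
      using S(3) B(1) R(1) by (intro card_mono) (auto intro: finite_subset)
    also have "\<dots> \<le> card (B - {r}) + card {z \<in> S. E r z}" by (rule card_Un_le)
    also have "card (B - {r}) \<le> 1" using B(3) r by simp
    finally have "5 \<le> card {z \<in> S. E r z}" using d[OF rV(1)] by (simp add: deg_in_def)
    moreover have "card {z \<in> S. E r z} + card {z \<in> S. \<not> E r z} = card S"
      using S(3) by (subst card_Un_disjoint[symmetric]) (auto intro: arg_cong[where f = card])
    ultimately have "card {z \<in> S. \<not> E r z} \<le> 1" using S(2) by simp
    then have one: "y = z" if "y \<in> S" "z \<in> S" "\<not> E r y" "\<not> E r z" for y z
      using that S(3) by (auto simp: card_le_Suc0_iff_eq)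
    have "\<exists>a\<in>S. \<forall>z\<in>S. z \<noteq> a \<longrightarrow> E r z"
    proof (cases "\<exists>a\<in>S. \<not> E r a")
      case True
      then show ?thesis using one by blast
    next
      case False
      then show ?thesis using p(1) by blast
    qed
    then obtain a where a: "a \<in> S" "\<And>z. z \<in> S \<Longrightarrow> z \<noteq> a \<Longrightarrow> E r z" by blast
    obtain x y where xy: "x \<in> S" "x \<noteq> a" "y \<in> S" "y \<noteq> a" "x \<noteq> y" "\<not> E x y" using ex[OF a(1)] by blast
    have "E x r" "E y r" using a(2) xy sym by auto
    then have "touch E {x} {r}" "touch E {y} {r}" by (auto simp: touch_def)
    then show False using noC[OF conn_singleton _ _ _ xy(1,3,5,6)] B(1) r by blast
  qed
  have "card A + card (R - A) = card R"
    using card_Un_disjoint[of A "R - A"] A(1) R(1) by (simp add: Un_absorb1 finite_subset)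
  then have "card A \<le> 2 \<or> card (R - A) \<le> 2" using R(2) by linarith
  then show False
  proof
    assume "card A \<le> 2"
    then show False using small[OF A(1,2) _ A(4)] by blast
  next
    assume c: "card (R - A) \<le> 2"
    have "R - (R - A) = A" using A(1) by blast
    then have "\<not> E a b" if "a \<in> R - A" "b \<in> R - (R - A)" for a b using that A(4)[of b a] sym by auto
    then show False using small[of "R - A"] A(1,3) c by blast
  qed
qed

text \<open>In a smallest counterexample every edge has four common neighbours, since otherwise its
  contraction loses at most four edges, just as the bound does. A vertex of degree below 5 can be
  deleted, and one of degree 5 has a complete neighbourhood. Minimum degree 7 would need more than
  16 vertices, so a vertex of degree 6 exists and \<open>clique_minor_deg6\<close> applies. The
  restriction to 12 vertices enters in these last two steps.\<close>

theorem mader: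
  assumes "sgraph V E" "6 \<le> card V" "card V \<le> 12" "8 * card V \<le> degsum E V + 18"
  shows "clique_minor V E 6"
  using assms
proof (induction "card V + degsum E V" arbitrary: V E rule: less_induct)
  case less
  note G = less.prems(1) and n = less.prems(2,3) and D = less.prems(4)
  note sym = sgraph_sym[OF G] and irr = sgraphD(5)[OF G] and fin = sgraphD(1)[OF G]
  have le: "deg_in E V x + 1 \<le> card V" if "x \<in> V" for x
    using deg_in_compl[OF G fin that] by linarith
  \<comment> \<open>A graph above the bound can lose an edge; on six vertices the bound 30 is the
    degree sum of the complete graph; otherwise the bound is met with no edge to spare.\<close>
  consider (big) "8 * card V + 2 \<le> degsum E V + 18" | (six) "card V = 6"
    | (small) "degsum E V + 18 < 8 * card V + 2" "7 \<le> card V" using n by linarith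
  then show ?case
  proof cases
    case big
    then have "degsum E V > 0" using n by linarith
    then obtain a where "deg_in E V a > 0" unfolding degsum_def by (metis gr0I less_not_refl2 sum.neutral)
    then obtain b where "E a b" unfolding deg_in_def by (metis (mono_tags, lifting) Collect_empty_eq card.empty less_not_refl2)
    note del = degsum_delete_edge[OF G this]
    have "clique_minor V (\<lambda>x y. E x y \<and> {x, y} \<noteq> {a, b}) 6"
      by (rule less.hyps[OF _ del(1)]) (use del(2) big n in linarith)+
    then show ?thesis by (rule clique_minor_mono) auto
  next
    case six
    have full: "deg_in E V x = 5" if "x \<in> V" for x
    proof (rule ccontr)
      assume "deg_in E V x \<noteq> 5"
      then have "deg_in E V x \<le> 4" using le[OF that] six by simp
      moreover have "(\<Sum>y\<in>V - {x}. deg_in E V y) \<le> 25"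
        using sum_mono[of "V - {x}" "deg_in E V" "\<lambda>_. 5"] le six fin that by fastforce
      ultimately have "degsum E V \<le> 29" using sum.remove[OF fin that, of "deg_in E V"] by (simp add: degsum_def)
      then show False using D six by simp
    qed
    have "E x y" if "x \<in> V" "y \<in> V" "x \<noteq> y" for x y
    proof -
      have "card {y \<in> V. y \<noteq> x \<and> \<not> E x y} = 0" using deg_in_compl[OF G fin that(1)] full[OF that(1)] six by simp
      then show ?thesis using that fin by auto
    qed
    then show ?thesis using six by (intro clique_minor_complete[OF G, of V]) auto
  next
    case small
    show ?thesis
    proof (rule ccontr)
      assume no: "\<not> clique_minor V E 6"
      have t: "4 \<le> card {x \<in> V. E u x \<and> E v x}" if uv: "E u v" for u v
      proof (rule ccontr)
        assume t4: "\<not> 4 \<le> card {x \<in> V. E u x \<and> E v x}"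
        have uv': "u \<in> V" "v \<in> V" using sgraphD(2,3)[OF G uv] by auto
        note c = degsum_contr[OF G fin uv' uv]
        have cV: "card (V - {v}) = card V - 1" using uv' fin by simp
        have "clique_minor (V - {v}) (contr E u v) 6"
        proof (rule less.hyps[OF _ sgraph_contr[OF G uv]])
          show "card (V - {v}) + degsum (contr E u v) (V - {v}) < card V + degsum E V" using c cV by linarith
          show "6 \<le> card (V - {v})" "card (V - {v}) \<le> 12" using cV small n by linarith+
          show "8 * card (V - {v}) \<le> degsum (contr E u v) (V - {v}) + 18" using c cV small(2) D t4 by linarith
        qed
        then show False using clique_minor_contr[OF G uv] no by blast
      qed
      have d5: "5 \<le> deg_in E V x" if x: "x \<in> V" for x
      proof (rule ccontr)
        assume d4: "\<not> 5 \<le> deg_in E V x"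
        note c = degsum_remove[OF G fin x]
        have cV: "card (V - {x}) = card V - 1" using x fin by simp
        let ?E = "\<lambda>a b. E a b \<and> a \<noteq> x \<and> b \<noteq> x"
        have deq: "degsum ?E (V - {x}) = degsum E (V - {x})" unfolding degsum_def deg_in_def
          by (intro sum.cong refl arg_cong[where f = card]) auto
        have G': "sgraph (V - {x}) ?E" using G by (auto simp: sgraph_def)
        have "clique_minor (V - {x}) ?E 6"
        proof (rule less.hyps[OF _ G'])
          show "card (V - {x}) + degsum ?E (V - {x}) < card V + degsum E V" using c cV small deq by linarith
          show "6 \<le> card (V - {x})" "card (V - {x}) \<le> 12" using cV small n by linarith+
          show "8 * card (V - {x}) \<le> degsum ?E (V - {x}) + 18" using c cV small(2) D d4 deq by linarith
        qed
        then have "clique_minor V E 6" by (rule clique_minor_mono) auto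
        then show False using no by blast
      qed
      have n5: "deg_in E V x \<noteq> 5" if x: "x \<in> V" for x
      proof
        assume d: "deg_in E V x = 5"
        define S where "S = {y \<in> V. E x y}"
        have S: "finite S" "card S = 5" "S \<subseteq> V" "x \<notin> S" using d fin irr by (auto simp: S_def deg_in_def)
        have "E a b" if ab: "a \<in> S" "b \<in> S" "a \<noteq> b" for a b
        proof -
          have "{y \<in> V. E x y \<and> E a y} = {y \<in> S. E a y}" by (auto simp: S_def)
          then have "4 \<le> deg_in E S a" using t[of x a] ab by (simp add: deg_in_def S_def)
          then have "card {y \<in> S. y \<noteq> a \<and> \<not> E a y} = 0" using deg_in_compl[OF G S(1) ab(1)] S(2) by simp
          then show ?thesis using ab S by auto
        qed
        then have "clique_minor V E 6" using S x sym
          by (intro clique_minor_complete[OF G, of "insert x S"]) (auto simp: S_def)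
        then show False using no by blast
      qed
      have d6: "6 \<le> deg_in E V x" if "x \<in> V" for x using d5[OF that] n5[OF that] by simp
      have "\<exists>v\<in>V. deg_in E V v \<le> 6"
      proof (rule ccontr)
        assume "\<not> ?thesis"
        then have "7 * card V \<le> degsum E V" by (intro degsum_ge) auto
        then show False using small n by linarith
      qed
      then obtain v where v: "v \<in> V" "deg_in E V v = 6" using d6 by (metis le_antisym)
      have "clique_minor V E 6"
        by (rule clique_minor_deg6[OF G n(2) v _ d6]) (use t in auto)
      then show False using no by blast
    qed
  qed
qed

section \<open>From branch sets to minors\<close>

definition arc_rel :: "'a pair_pre_digraph \<Rightarrow> 'a \<Rightarrow> 'a \<Rightarrow> bool" where
  "arc_rel G x y \<longleftrightarrow> (x, y) \<in> parcs G"

lemma sgraph_arc_rel: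
  assumes "pair_graph G"
  shows "sgraph (pverts G) (arc_rel G)"
proof -
  have "finite (pverts G)" "sym (parcs G)" "parcs G \<subseteq> pverts G \<times> pverts G" "\<forall>v. (v, v) \<notin> parcs G"
    using assms by (simp_all add: pair_graph_iff)
  then show ?thesis unfolding sgraph_def arc_rel_def by (auto dest: symD)
qed

lemma clique_minor_in_contr:
  assumes G: "sgraph V E" and uv: "E u v"
    and B: "\<And>i. i < n \<Longrightarrow> B i \<subseteq> V \<and> conn E (B i)"
      "\<And>i j. i < n \<Longrightarrow> j < i \<Longrightarrow> B j \<inter> B i = {} \<and> touch E (B j) (B i)"
    and k: "k < n" "u \<in> B k" "v \<in> B k"
  shows "clique_minor (V - {v}) (contr E u v) n"
proof -
  note sym = sgraph_sym[OF G] and irr = sgraphD(5)[OF G]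
  have uv': "u \<noteq> v" using uv irr by metis
  define h where "h = (\<lambda>x. if x = v then u else x)"
  have edge: "contr E u v (h a) (h b)" if "E a b" "h a \<noteq> h b" for a b
    using that sym irr uv' by (auto simp: contr_def h_def)
  have notin: "u \<notin> B i \<and> v \<notin> B i" if "i < n" "i \<noteq> k" for i
    using B(2)[of i k] B(2)[of k i] that k by (cases "i < k") force+
  have hB: "h x \<in> B i - {v}" if "x \<in> B i" "i < n" for x i
    using that notin[of i] k uv' by (cases "i = k") (auto simp: h_def)
  have conn': "conn (contr E u v) (B i - {v})" if i: "i < n" for i
    unfolding conn_def
  proof (intro conjI allI impI)
    have "B i \<noteq> {}" using B(1)[OF i] by (auto simp: conn_def)
    then show "B i - {v} \<noteq> {}" using hB i by blast
    fix A assume A: "A \<subseteq> B i - {v}" "A \<noteq> {}" "A \<noteq> B i - {v}"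
    define A' where "A' = {x \<in> B i. h x \<in> A}"
    have "A' \<subseteq> B i" "A' \<noteq> {}" using A by (auto simp: A'_def h_def)
    moreover have "A' \<noteq> B i" using A by (auto simp: A'_def h_def split: if_splits)
    ultimately obtain a b where ab: "a \<in> A'" "b \<in> B i - A'" "E a b"
      using B(1)[OF i] unfolding conn_def by blast
    then have "h a \<in> A" "h b \<notin> A" "h b \<in> B i - {v}" using hB i by (auto simp: A'_def)
    moreover from this have "h a \<noteq> h b" by auto
    ultimately show "\<exists>a\<in>A. \<exists>b\<in>B i - {v} - A. contr E u v a b" using edge[OF ab(3)] by blast
  qed
  show ?thesis unfolding clique_minor_def
  proof (intro exI[of _ "\<lambda>i. B i - {v}"] conjI allI impI)
    fix i assume i: "i < n"
    show "B i - {v} \<subseteq> V - {v}" using B(1)[OF i] by blast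
    show "conn (contr E u v) (B i - {v})" using conn'[OF i] .
    fix j assume j: "j < i"
    show "(B j - {v}) \<inter> (B i - {v}) = {}" using B(2)[OF i j] by blast
    obtain a b where ab: "a \<in> B j" "b \<in> B i" "E a b" using B(2)[OF i j] unfolding touch_def by blast
    have hab: "h a \<in> B j - {v}" "h b \<in> B i - {v}" using hB[OF ab(1)] hB[OF ab(2) i] i j by auto
    moreover have "h a \<noteq> h b" using hab B(2)[OF i j] by auto
    ultimately show "touch (contr E u v) (B j - {v}) (B i - {v})"
      using edge[OF ab(3)] unfolding touch_def by (intro bexI[of _ "h a"] bexI[of _ "h b"])
  qed
qed

lemma arc_rel_contract_edge:
  assumes "pair_graph G" "(u, v) \<in> parcs G"
  shows "pverts (contract_edge G u v) = pverts G - {v}" "arc_rel (contract_edge G u v) = contr (arc_rel G) u v"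
proof -
  note G = sgraph_arc_rel[OF assms(1)]
  have uv: "arc_rel G u v" using assms(2) by (simp add: arc_rel_def)
  have uv': "u \<in> pverts G" "u \<noteq> v" using sgraphD(2)[OF G uv] sgraphD(5)[OF G, of u] uv by auto
  show "pverts (contract_edge G u v) = pverts G - {v}"
    using uv' by (auto simp: contract_edge_def Let_def)
  show "arc_rel (contract_edge G u v) = contr (arc_rel G) u v"
  proof (intro ext iffI)
    fix x y
    assume "arc_rel (contract_edge G u v) x y"
    then have "(x, y) \<in> map_prod (id(v := u)) (id(v := u)) ` (parcs G - {(u, v), (v, u)})"
      by (simp add: arc_rel_def contract_edge_def Let_def)
    then obtain p where p: "p \<in> parcs G - {(u, v), (v, u)}" "(x, y) = map_prod (id(v := u)) (id(v := u)) p"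
      by (elim imageE)
    obtain a b where "p = (a, b)" by (cases p)
    then have ab: "(a, b) \<in> parcs G" "(a, b) \<noteq> (u, v)" "(a, b) \<noteq> (v, u)"
      "x = (id(v := u)) a" "y = (id(v := u)) b"
      using p by (auto simp del: fun_upd_apply)
    have "arc_rel G a b" "a \<noteq> b" using ab(1) sgraphD(5)[OF G, of a] by (auto simp: arc_rel_def)
    then show "contr (arc_rel G) u v x y" using ab(2-5) uv' by (auto simp: contr_def split: if_splits)
  next
    fix x y
    assume c: "contr (arc_rel G) u v x y"
    have "\<exists>a b. (a, b) \<in> parcs G - {(u, v), (v, u)} \<and> x = (id(v := u)) a \<and> y = (id(v := u)) b"
    proof -
      consider "arc_rel G x y" | "x = u" "arc_rel G v y" | "y = u" "arc_rel G x v"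
        using c by (auto simp: contr_def)
      then show ?thesis
      proof cases
        case 1 then show ?thesis using c by (intro exI[of _ x] exI[of _ y]) (auto simp: contr_def arc_rel_def)
      next
        case 2 then show ?thesis using c by (intro exI[of _ v] exI[of _ y]) (auto simp: contr_def arc_rel_def)
      next
        case 3 then show ?thesis using c by (intro exI[of _ x] exI[of _ v]) (auto simp: contr_def arc_rel_def)
      qed
    qed
    then show "arc_rel (contract_edge G u v) x y"
      unfolding arc_rel_def contract_edge_def Let_def by (auto simp del: fun_upd_apply intro!: image_eqI)
  qed
qed

lemma has_complete_minor_step:
  assumes "minor_step G H" "has_complete_minor H n"
  shows "has_complete_minor G n"
  using assms unfolding has_complete_minor_def minor_def by (meson converse_rtranclp_into_rtranclp)

text \<open>Every step removes a vertex: one outside all branch sets is deleted, and a branch set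
  with two vertices contains an edge to contract. When neither is possible, the branch sets are
  singletons that cover the graph, so the graph itself is complete.\<close>

lemma has_complete_minorI:
  assumes "pair_graph G" "clique_minor (pverts G) (arc_rel G) n"
  shows "has_complete_minor G n"
  using assms
proof (induction "card (pverts G)" arbitrary: G rule: less_induct)
  case less
  let ?V = "pverts G" and ?E = "arc_rel G"
  note G = sgraph_arc_rel[OF less.prems(1)]
  note fin = sgraphD(1)[OF G]
  obtain B where B0: "\<forall>i<n. B i \<subseteq> ?V \<and> conn ?E (B i)"
    "\<forall>i<n. \<forall>j<i. B j \<inter> B i = {} \<and> touch ?E (B j) (B i)"
    using less.prems(2) unfolding clique_minor_def by (elim exE conjE)
  have B: "B i \<subseteq> ?V \<and> conn ?E (B i)" if "i < n" for i using B0(1) that by simp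
  have B2: "B j \<inter> B i = {} \<and> touch ?E (B j) (B i)" if "i < n" "j < i" for i j using B0(2) that by simp
  consider (out) v where "v \<in> ?V" "\<And>i. i < n \<Longrightarrow> v \<notin> B i"
    | (big) i u w where "i < n" "u \<in> B i" "w \<in> B i" "u \<noteq> w"
    | (single) "\<And>v. v \<in> ?V \<Longrightarrow> \<exists>i<n. v \<in> B i" "\<And>i u w. i < n \<Longrightarrow> u \<in> B i \<Longrightarrow> w \<in> B i \<Longrightarrow> u = w"
    by blast
  then show ?case
  proof cases
    case out
    have step: "minor_step G (delete_vertex G v)" using out(1) by (rule minor_step.delete_vertex)
    have V': "pverts (delete_vertex G v) = ?V - {v}" by (simp add: delete_vertex_def)
    have E': "arc_rel (delete_vertex G v) x y \<longleftrightarrow> ?E x y \<and> x \<noteq> v \<and> y \<noteq> v" for x y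
      by (auto simp: delete_vertex_def arc_rel_def)
    have "conn (arc_rel (delete_vertex G v)) (B i)" if i: "i < n" for i
      unfolding conn_def
    proof (intro conjI allI impI)
      show "B i \<noteq> {}" using B[OF i] by (auto simp: conn_def)
      fix A assume A: "A \<subseteq> B i" "A \<noteq> {}" "A \<noteq> B i"
      then obtain a b where "a \<in> A" "b \<in> B i - A" "?E a b" using B[OF i] unfolding conn_def by blast
      then show "\<exists>a\<in>A. \<exists>b\<in>B i - A. arc_rel (delete_vertex G v) a b" using E' out(2)[OF i] A(1) by blast
    qed
    moreover have "touch (arc_rel (delete_vertex G v)) (B j) (B i)" if ij: "i < n" "j < i" for i j
    proof -
      have "j < n" using ij by simp
      then show ?thesis using B2[OF ij] E' out(2)[OF ij(1)] out(2)[of j] unfolding touch_def by blast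
    qed
    ultimately have "clique_minor (pverts (delete_vertex G v)) (arc_rel (delete_vertex G v)) n"
      unfolding clique_minor_def V' using B B2 out(2) by (intro exI[of _ B]) blast
    moreover have "card (pverts (delete_vertex G v)) < card ?V" unfolding V' using out(1) fin by (intro psubset_card_mono) auto
    ultimately show ?thesis
      using less.hyps minor_step_pair_graph[OF step less.prems(1)] has_complete_minor_step[OF step] by blast
  next
    case big
    have "{u} \<subseteq> B i" "{u} \<noteq> B i" using big by auto
    then obtain v where v: "v \<in> B i" "?E u v" using B[OF big(1)] unfolding conn_def by blast
    have uv: "(u, v) \<in> parcs G" using v by (simp add: arc_rel_def)
    have step: "minor_step G (contract_edge G u v)" using uv by (rule minor_step.contract_edge)
    note c = arc_rel_contract_edge[OF less.prems(1) uv]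
    have "clique_minor (pverts (contract_edge G u v)) (arc_rel (contract_edge G u v)) n"
      unfolding c by (rule clique_minor_in_contr[where B = B and k = i and n = n, OF G v(2) B B2 big(1,2) v(1)])
    moreover have "card (pverts (contract_edge G u v)) < card ?V"
      unfolding c using sgraphD(3)[OF G v(2)] fin by (intro psubset_card_mono) auto
    ultimately show ?thesis
      using less.hyps minor_step_pair_graph[OF step less.prems(1)] has_complete_minor_step[OF step] by blast
  next
    case single
    have "\<exists>x. B i = {x}" if i: "i < n" for i
    proof -
      obtain x where "x \<in> B i" using B[OF i] by (auto simp: conn_def)
      then have "B i = {x}" using single(2)[OF i] by auto
      then show ?thesis ..
    qed
    then obtain b where b: "\<And>i. i < n \<Longrightarrow> B i = {b i}" by metis
    have adj: "?E (b j) (b i)" if "i < n" "j < i" for i j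
      using B2[OF that] b[of i] b[of j] that by (auto simp: touch_def)
    have V: "?V = b ` {..<n}" using single(1) b B by force
    have inj: "inj_on b {..<n}"
    proof (rule inj_onI)
      fix i j assume "i \<in> {..<n}" "j \<in> {..<n}" "b i = b j"
      then show "i = j" using adj[of i j] adj[of j i] sgraphD(5)[OF G]
        by (cases i j rule: linorder_cases) auto
    qed
    have "(x, y) \<in> parcs G \<longleftrightarrow> x \<in> ?V \<and> y \<in> ?V \<and> x \<noteq> y" for x y
    proof
      assume "(x, y) \<in> parcs G"
      then show "x \<in> ?V \<and> y \<in> ?V \<and> x \<noteq> y" using G unfolding sgraph_def arc_rel_def by blast
    next
      assume "x \<in> ?V \<and> y \<in> ?V \<and> x \<noteq> y"
      then obtain i j where "i < n" "j < n" "x = b i" "y = b j" "i \<noteq> j" using V by auto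
      then show "(x, y) \<in> parcs G" using adj[of i j] adj[of j i] sgraph_sym[OF G]
        by (cases i j rule: linorder_cases) (auto simp: arc_rel_def)
    qed
    then have "parcs G = {(u, v). (u, v) \<in> ?V \<times> ?V \<and> u \<noteq> v}" by auto
    then have "K\<^bsub>n\<^esub> (with_proj G)"
      unfolding complete_digraph_pair_def using V inj fin by (simp add: card_image)
    then show ?thesis unfolding has_complete_minor_def minor_def by blast
  qed
qed

section \<open>The non-neighbours of a vertex of degree 6\<close>

lemma conn_star:
  assumes "\<And>a. a \<in> A \<Longrightarrow> E v a \<and> E a v"
  shows "conn E (insert v A)"
  unfolding conn_def
proof (intro conjI allI impI)
  fix C assume C: "C \<subseteq> insert v A" "C \<noteq> {}" "C \<noteq> insert v A"
  show "\<exists>a\<in>C. \<exists>b\<in>insert v A - C. E a b"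
  proof (cases "v \<in> C")
    case True
    then obtain b where "b \<in> A" "b \<notin> C" using C by blast
    then show ?thesis using assms True by blast
  next
    case False
    then obtain a where "a \<in> C" "a \<in> A" using C by blast
    then show ?thesis using assms False by blast
  qed
qed simp

lemma card_3_obtain:
  assumes "card U = 3" "x \<in> U"
  obtains y z where "U = {x, y, z}" "x \<noteq> y" "x \<noteq> z" "y \<noteq> z"
proof -
  have "finite U" using assms(1) card.infinite by fastforce
  then have "card (U - {x}) = 2" using assms by simp
  then obtain y z where "U - {x} = {y, z}" "y \<noteq> z" unfolding card_2_iff by blast
  then show ?thesis using that[of y z] assms(2) by blast
qed

text \<open>With c common neighbours, the contraction has degree sum
  \<open>degsum E V - 2 - 2c\<close>, which must stay below Mader's value
  \<open>8 * (card V - 1) - 18\<close>.\<close>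

lemma common_nbrs_gt:
  assumes G: "sgraph V E" and "\<not> clique_minor V E 6" "7 \<le> card V" "card V \<le> 12" and uv: "E u v"
  shows "degsum E V + 24 < 8 * card V + 2 * card {x \<in> V. E u x \<and> E v x}"
proof (rule ccontr)
  assume l: "\<not> ?thesis"
  note fin = sgraphD(1)[OF G] and uv' = sgraphD(2,3)[OF G uv]
  have c: "card (V - {v}) = card V - 1" using uv' fin by simp
  have "clique_minor (V - {v}) (contr E u v) 6"
    by (rule mader[OF sgraph_contr[OF G uv]]) (use c l degsum_contr[OF G fin uv' uv] assms(3,4) in linarith)+
  then show False using clique_minor_contr[OF G uv] assms(2) by blast
qed

text \<open>At most one edge below Mader's bound, every edge has at least three common neighbours.
  Those of \<open>w\<close> and \<open>x\<close> are the neighbours of \<open>x\<close> inside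
  \<open>N\<close>, and the five degrees there cannot sum to the odd number 15.\<close>

lemma critical_deg5:
  assumes G: "sgraph V E" and "\<not> clique_minor V E 6" "7 \<le> card V" "card V \<le> 12"
    and crit: "8 * card V \<le> degsum E V + 20"
    and N: "N = {y \<in> V. E w y}" "card N = 5"
  shows "x \<in> N \<Longrightarrow> 3 \<le> deg_in E N x" "16 \<le> degsum E N"
proof -
  show 1: "3 \<le> deg_in E N x" if "x \<in> N" for x
  proof -
    have "E w x" using that N by simp
    from common_nbrs_gt[OF assms(1-4) this] crit
    have "3 \<le> card {y \<in> V. E w y \<and> E x y}" by linarith
    also have "{y \<in> V. E w y \<and> E x y} = {y \<in> N. E x y}" using N by auto
    finally show ?thesis by (simp add: deg_in_def)
  qed
  have "finite N" using N sgraphD(1)[OF G] by simp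
  then have "even (degsum E N)" by (rule even_degsum[OF G])
  moreover have "3 * card N \<le> degsum E N" by (rule degsum_ge[OF 1])
  ultimately show "16 \<le> degsum E N" using N(2) by (cases "degsum E N = 15") auto
qed

text \<open>
  Let \<open>b1 b2\<close> be the only non-edge inside \<open>B\<close>. A common neighbour in \<open>H\<close> could be merged into \<open>b1\<close>,
  so the neighbours of \<open>b1\<close> and \<open>b2\<close> split \<open>H\<close> into two triples \<open>P\<close> and \<open>Q\<close>. An edge \<open>p q\<close> between
  them gives the branch sets \<open>{b1, p}\<close>, \<open>{b2, q}\<close>, the other three vertices of \<open>B\<close>, and \<open>v\<close> with the
  rest of \<open>H\<close>, unless \<open>p\<close> and \<open>q\<close> are all the neighbours in \<open>H\<close> of one of those three; so at most
  three such edges have to be considered.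
\<close>

lemma clique_minor_near_K5:
  assumes G: "sgraph V E" and v: "v \<in> V" "H = {y \<in> V. E v y}" "card H = 6"
    and B: "B = V - insert v H" "card B = 5" "18 \<le> degsum E B"
    and deg: "\<And>x. x \<in> V \<Longrightarrow> 6 \<le> deg_in E V x"
  shows "clique_minor V E 6"
proof (rule ccontr)
  assume no: "\<not> clique_minor V E 6"
  note sym = sgraph_sym[OF G] and irr = sgraphD(5)[OF G] and fin = sgraphD(1)[OF G]
  have fH: "finite H" "finite B" and vHB: "v \<notin> H" "v \<notin> B" "H \<inter> B = {}" "V = insert v (H \<union> B)"
    and HV: "H \<subseteq> V" "B \<subseteq> V" and Ev: "\<And>h. h \<in> H \<Longrightarrow> E v h \<and> E h v" "\<And>b. b \<in> B \<Longrightarrow> \<not> E v b \<and> \<not> E b v"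
    using v B(1) fin irr sym by auto
  \<comment> \<open>\<open>m x\<close> counts the non-neighbours of \<open>x\<close> inside
    \<open>B\<close>. They sum to at most 20 - 18 = 2, so at most one pair is non-adjacent.\<close>
  define m where "m x = card {y \<in> B. y \<noteq> x \<and> \<not> E x y}" for x
  have dB: "deg_in E B x + m x = 4" if "x \<in> B" for x
    using deg_in_compl[OF G fH(2) that] B(2) by (simp add: m_def)
  have "(\<Sum>x\<in>B. deg_in E B x + m x) = (\<Sum>x\<in>B. 4)" by (intro sum.cong refl dB)
  then have m2: "sum m B \<le> 2" using B(2,3) by (simp add: sum.distrib degsum_def)
  have m0: "\<not> E x y \<Longrightarrow> x \<in> B \<Longrightarrow> y \<in> B \<Longrightarrow> x \<noteq> y \<Longrightarrow> 1 \<le> m x" for x y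
    unfolding m_def using fH(2) by (simp add: Suc_le_eq card_gt_0_iff) blast
  have "\<exists>b1\<in>B. \<exists>b2\<in>B. b1 \<noteq> b2 \<and> (\<forall>x\<in>B. \<forall>y\<in>B. x \<noteq> y \<longrightarrow> {x, y} \<noteq> {b1, b2} \<longrightarrow> E x y)"
  proof (cases "\<exists>x\<in>B. \<exists>y\<in>B. x \<noteq> y \<and> \<not> E x y")
    case True
    then obtain b1 b2 where b: "b1 \<in> B" "b2 \<in> B" "b1 \<noteq> b2" "\<not> E b1 b2" by blast
    have "E x y" if xy: "x \<in> B" "y \<in> B" "x \<noteq> y" "{x, y} \<noteq> {b1, b2}" for x y
    proof (rule ccontr)
      assume n: "\<not> E x y"
      have gen: "sum m {b1, b2, z} \<le> 2" if "z \<in> B" for z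
        using sum_mono2[of B "{b1, b2, z}" m] fH(2) b that m2 by auto
      have m1: "1 \<le> m b1" "1 \<le> m b2" "1 \<le> m x" "1 \<le> m y" using m0 b xy n sym by metis+
      have "x \<in> {b1, b2}" using gen[OF xy(1)] m1 b(3) by (cases "x \<in> {b1, b2}") auto
      moreover have "y \<in> {b1, b2}" using gen[OF xy(2)] m1 b(3) by (cases "y \<in> {b1, b2}") auto
      ultimately show False using xy by auto
    qed
    then show ?thesis using b by blast
  next
    case False
    have "card B \<noteq> 0" "card B \<noteq> 1" using B(2) by auto
    then obtain b1 where b1: "b1 \<in> B" by fastforce
    moreover have "B \<noteq> {b1}" using B(2) by auto
    ultimately obtain b2 where "b2 \<in> B" "b1 \<noteq> b2" by blast
    then show ?thesis using False b1 by blast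
  qed
  then obtain b1 b2 where b: "b1 \<in> B" "b2 \<in> B" "b1 \<noteq> b2"
    and adj0: "\<forall>x\<in>B. \<forall>y\<in>B. x \<noteq> y \<longrightarrow> {x, y} \<noteq> {b1, b2} \<longrightarrow> E x y" by (elim bexE conjE)
  have adj: "E x y" if "x \<in> B" "y \<in> B" "x \<noteq> y" "{x, y} \<noteq> {b1, b2}" for x y using adj0 that by simp
  define T where "T = B - {b1, b2}"
  have T: "card T = 3" "finite T" "T \<subseteq> B" using b B(2) fH(2) by (auto simp: T_def card_Diff_subset)
  have adjT: "E b1 x" "E x b1" "E b2 x" "E x b2" if "x \<in> T" for x
    using that adj b sym by (auto simp: T_def doubleton_eq_iff)
  have adjTT: "E x y" if "x \<in> T" "y \<in> T" "x \<noteq> y" for x y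
    using that adj b by (auto simp: T_def doubleton_eq_iff)
  define hn where "hn x = {h \<in> H. E x h}" for x
  have hnf: "finite (hn x)" "hn x \<subseteq> H" for x using fH by (auto simp: hn_def)
  have degB: "6 \<le> deg_in E B x + card (hn x)" if "x \<in> B" for x
  proof -
    have "{y \<in> V. E x y} = {y \<in> B. E x y} \<union> hn x" using vHB(4) Ev(2)[OF that] by (auto simp: hn_def)
    then have "card {y \<in> V. E x y} \<le> card {y \<in> B. E x y} + card (hn x)" by (simp add: card_Un_le)
    then show ?thesis using deg[of x] that HV by (auto simp: deg_in_def)
  qed
  have hn2: "2 \<le> card (hn x)" if "x \<in> B" for x using degB[OF that] dB[OF that] by linarith
  \<comment> \<open>The second alternative works because \<open>x\<close> has at least two
    neighbours in \<open>H\<close>: if all lie in a set \<open>A\<close> of at most two vertices,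
    they fill it.\<close>
  have hnout: "\<exists>h\<in>H - A. E x h" if "x \<in> B" "card A < card (hn x) \<or> hn x \<noteq> A \<and> card A \<le> 2" "finite A" for x A
  proof (rule ccontr)
    assume "\<not> ?thesis"
    then have sub: "hn x \<subseteq> A" by (auto simp: hn_def)
    then show False using card_mono[OF that(3) sub] card_subset_eq[OF that(3) sub] hn2[OF that(1)] that(2) by linarith
  qed
  obtain x y z where Tx: "T = {x, y, z}" "x \<noteq> y" "x \<noteq> z" "y \<noteq> z" using T(1) by (metis card_3_iff)
  have Bx: "b1 \<in> B" "b2 \<in> B" "x \<in> B" "y \<in> B" "z \<in> B" "distinct [b1, b2, x, y, z]" using b Tx T by (auto simp: T_def)
  have Txy: "E x y" "E x z" "E y z" "E b1 x" "E b1 y" "E b1 z" "E b2 x" "E b2 y" "E b2 z"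
    "E x b1" "E y b1" "E z b1" "E x b2" "E y b2" "E z b2"
    using adjT adjTT Tx by auto
  have inV: "a \<in> V" if "a \<in> B \<or> a \<in> H \<or> a = v" for a using that v(1) HV by auto
  have nB: "a \<notin> H" "a \<noteq> v" if "a \<in> B" for a using that vHB by auto
  note nb = nB[OF Bx(1)] nB[OF Bx(2)] nB[OF Bx(3)] nB[OF Bx(4)] nB[OF Bx(5)]
  have nb12: "\<not> E b1 b2"
  proof
    assume e: "E b1 b2"
    have tH: "touch E {a} (insert v H)" if "a \<in> B" for a
      using hnout[of a "{}"] hn2[OF that] that by (fastforce simp: touch_def)
    have "clique_minor V E 6"
    proof (rule clique_minorI[where Bs = "[{b1}, {b2}, {x}, {y}, {z}, insert v H]"])
      show "\<forall>S\<in>set [{b1}, {b2}, {x}, {y}, {z}, insert v H]. S \<subseteq> V \<and> conn E S"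
        using Bx inV HV conn_star[of H E v] Ev conn_singleton by auto
      show "sorted_wrt (\<lambda>S T. S \<inter> T = {} \<and> touch E S T) [{b1}, {b2}, {x}, {y}, {z}, insert v H]"
        using tH[OF Bx(1)] tH[OF Bx(2)] tH[OF Bx(3)] tH[OF Bx(4)] tH[OF Bx(5)] Bx(6) Txy e nb
        by (simp add: touch_def)
    qed simp
    then show False using no by simp
  qed
  have hn3: "3 \<le> card (hn b1)" "3 \<le> card (hn b2)"
    using degB dB m0[OF nb12] m0[of b2 b1] nb12 sym b by (fastforce)+
  have tH2: "touch E {a} (insert v (H - A))" if "a \<in> B" "card A < card (hn a) \<or> hn a \<noteq> A \<and> card A \<le> 2" "finite A" for a A
    using hnout[OF that] by (auto simp: touch_def)
  have disj: "hn b1 \<inter> hn b2 = {}"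
  proof (rule ccontr)
    assume "\<not> ?thesis"
    then obtain h where h: "h \<in> H" "E b1 h" "E b2 h" by (auto simp: hn_def)
    have hB: "h \<notin> B" "h \<noteq> v" "E h b2" "E h b1" using h vHB sym by auto
    have t: "touch E {a} (insert v (H - {h}))" if "a \<in> B" for a
      by (rule tH2[OF that]) (use hn2[OF that] in auto)
    have t1: "touch E {b1, h} (insert v (H - {h}))" using t[OF Bx(1)] by (auto simp: touch_def)
    have "clique_minor V E 6"
    proof (rule clique_minorI[where Bs = "[{b1, h}, {b2}, {x}, {y}, {z}, insert v (H - {h})]"])
      show "\<forall>S\<in>set [{b1, h}, {b2}, {x}, {y}, {z}, insert v (H - {h})]. S \<subseteq> V \<and> conn E S"
        using Bx inV HV h conn_star[of "H - {h}" E v] Ev conn_singleton conn_pair[OF G h(2)] by auto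
      have "b2 \<noteq> h" "x \<noteq> h" "y \<noteq> h" "z \<noteq> h" using hB Bx by auto
      then show "sorted_wrt (\<lambda>S T. S \<inter> T = {} \<and> touch E S T) [{b1, h}, {b2}, {x}, {y}, {z}, insert v (H - {h})]"
        using t[OF Bx(2)] t[OF Bx(3)] t[OF Bx(4)] t[OF Bx(5)] t1 Bx(6) Txy hB nb by (simp add: touch_def)
    qed simp
    then show False using no by simp
  qed
  define P Q where "P = hn b1" and "Q = hn b2"
  have PQ: "P \<subseteq> H" "Q \<subseteq> H" "P \<inter> Q = {}" "3 \<le> card P" "3 \<le> card Q" "finite P" "finite Q"
    using disj hn3 hnf by (auto simp: P_def Q_def)
  have "card (P \<union> Q) = card P + card Q" using PQ by (intro card_Un_disjoint)
  moreover have "card (P \<union> Q) \<le> 6" using card_mono[OF fH(1), of "P \<union> Q"] PQ v(3) by auto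
  ultimately have PQ3: "card P = 3" "card Q = 3" "card (P \<union> Q) = card H" using PQ v(3) by linarith+
  have HPQ: "H = P \<union> Q" using card_subset_eq[OF fH(1) _ PQ3(3)] PQ by simp
  have cross: "\<exists>a\<in>T. hn a = {p, q}" if pq: "p \<in> P" "q \<in> Q" "E p q" for p q
  proof (rule ccontr)
    assume n: "\<not> ?thesis"
    have e: "E b1 p" "E b2 q" "p \<in> H" "q \<in> H" "p \<noteq> q" "p \<noteq> v" "q \<noteq> v" "p \<notin> B" "q \<notin> B"
      using pq PQ vHB by (auto simp: P_def Q_def hn_def)
    have c2: "card {p, q} = 2" using e(5) by simp
    have t: "touch E {a} (insert v (H - {p, q}))" if "a \<in> T" for a
      by (rule tH2) (use n that T c2 in auto)
    have t12: "touch E {b1, p} (insert v (H - {p, q}))" "touch E {b2, q} (insert v (H - {p, q}))"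
      using e(3,4) Ev by (auto simp: touch_def)
    have "clique_minor V E 6"
    proof (rule clique_minorI[where Bs = "[{b1, p}, {b2, q}, {x}, {y}, {z}, insert v (H - {p, q})]"])
      show "\<forall>S\<in>set [{b1, p}, {b2, q}, {x}, {y}, {z}, insert v (H - {p, q})]. S \<subseteq> V \<and> conn E S"
        using Bx inV HV e conn_star[of "H - {p, q}" E v] Ev conn_singleton conn_pair[OF G e(1)] conn_pair[OF G e(2)] by auto
      have "b1 \<noteq> q" "b2 \<noteq> p" "b2 \<noteq> q" "b1 \<noteq> p" "x \<noteq> p" "y \<noteq> p" "z \<noteq> p" "x \<noteq> q" "y \<noteq> q" "z \<noteq> q" using e(8,9) Bx by auto
      then show "sorted_wrt (\<lambda>S T. S \<inter> T = {} \<and> touch E S T) [{b1, p}, {b2, q}, {x}, {y}, {z}, insert v (H - {p, q})]"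
        using t[of x] t[of y] t[of z] Tx(1) t12 Bx(6) Txy e pq(3) nb by (simp add: touch_def)
    qed simp
    then show False using no by simp
  qed
  have PQn: "\<not> E p b2" "E p b1" if "p \<in> P" for p
    using that PQ(1,3) sym by (auto simp: P_def Q_def hn_def)
  have QPn: "\<not> E q b1" "E q b2" if "q \<in> Q" for q
    using that PQ(2,3) sym by (auto simp: P_def Q_def hn_def)
  \<comment> \<open>The 2 stands for \<open>v\<close> and for the one vertex among
    \<open>b1\<close>, \<open>b2\<close> that is adjacent to \<open>p\<close>.\<close>
  have degH: "6 \<le> 2 + (card {q \<in> P. E p q} + card {q \<in> Q. E p q} + card {a \<in> T. E p a})" if p: "p \<in> H" for p
  proof -
    define c where "c = (if p \<in> P then b1 else b2)"
    define A where "A = {q \<in> P. E p q} \<union> {q \<in> Q. E p q} \<union> {a \<in> T. E p a}"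
    have "{y \<in> V. E p y} \<subseteq> insert v (insert c A)"
    proof -
      have "B = insert b1 (insert b2 T)" using b by (auto simp: T_def)
      then show ?thesis using vHB(4) HPQ PQn QPn p by (auto simp: A_def c_def)
    qed
    moreover have fA: "finite A" using PQ T by (auto simp: A_def)
    ultimately have "card {y \<in> V. E p y} \<le> card (insert v (insert c A))" by (intro card_mono) auto
    also have "\<dots> \<le> 2 + card A" using fA by (simp add: card_insert_if)
    also have "\<dots> \<le> 2 + (card {q \<in> P. E p q} + card {q \<in> Q. E p q} + card {a \<in> T. E p a})"
      unfolding A_def by (intro add_left_mono order_trans[OF card_Un_le] add_right_mono card_Un_le)
    finally show ?thesis using deg[of p] p HV by (auto simp: deg_in_def)
  qed
  have le2: "card {q \<in> S. E p q} \<le> 2" if "p \<in> S" "card S = 3" "finite S" for p S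
  proof -
    have "{q \<in> S. E p q} \<subseteq> S - {p}" using irr by auto
    then have "card {q \<in> S. E p q} \<le> card (S - {p})" using that(3) by (intro card_mono) auto
    then show ?thesis using that by simp
  qed
  have full: "E p q" if "p \<in> S" "card S = 3" "finite S" "2 \<le> card {q \<in> S. E p q}" "q \<in> S" "q \<noteq> p" for p q S
  proof -
    have "{q \<in> S. E p q} \<subseteq> S - {p}" using irr by auto
    moreover have "card {q \<in> S. E p q} = card (S - {p})" using that le2[OF that(1-3)] by simp
    ultimately have "{q \<in> S. E p q} = S - {p}" using that(3) by (intro card_subset_eq) auto
    then show ?thesis using that by auto
  qed
  have hnT: "E p a \<longleftrightarrow> p \<in> hn a" if "p \<in> H" for p a using that sym by (auto simp: hn_def)
  have PH: "p \<in> H" if "p \<in> P" for p using that HPQ by auto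
  have QH: "p \<in> H" if "p \<in> Q" for p using that HPQ by auto
  have PQd: "p \<noteq> q" if "p \<in> P" "q \<in> Q" for p q using that PQ(3) by auto
  have nem: "p \<noteq> a" "p \<noteq> v" "a \<noteq> v" if "p \<in> H" "a \<in> B" for p a using that vHB by auto
  consider (all) "\<forall>p\<in>P. \<exists>q\<in>Q. E p q"
    | (some) p2 p1 q1 where "p2 \<in> P" "\<forall>q\<in>Q. \<not> E p2 q" "p1 \<in> P" "q1 \<in> Q" "E p1 q1"
    | (none) "\<forall>p\<in>P. \<forall>q\<in>Q. \<not> E p q" by blast
  then show False
  proof cases
    \<comment> \<open>The crossing edges at the three vertices of \<open>P\<close> have distinct
      witnesses in \<open>T\<close>, so each vertex of \<open>T\<close> sees exactly one matched
      pair of \<open>H\<close>. The degrees then make \<open>P\<close> and \<open>Q\<close>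
      triangles, which determines the whole graph; a model on all twelve vertices finishes.\<close>
    case all
    obtain p1 p2 p3 where P: "P = {p1, p2, p3}" "p1 \<noteq> p2" "p1 \<noteq> p3" "p2 \<noteq> p3" using PQ3(1) by (metis card_3_iff)
    have ex: "\<exists>q a. q \<in> Q \<and> E p q \<and> a \<in> T \<and> hn a = {p, q}" if "p \<in> P" for p
      using all that cross by blast
    obtain q1 a1 where 1: "q1 \<in> Q" "E p1 q1" "a1 \<in> T" "hn a1 = {p1, q1}" using ex[of p1] P by auto
    obtain q2 a2 where 2: "q2 \<in> Q" "E p2 q2" "a2 \<in> T" "hn a2 = {p2, q2}" using ex[of p2] P by auto
    obtain q3 a3 where 3: "q3 \<in> Q" "E p3 q3" "a3 \<in> T" "hn a3 = {p3, q3}" using ex[of p3] P by auto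
    have Pm: "p1 \<in> P" "p2 \<in> P" "p3 \<in> P" using P(1) by simp_all
    have Pq: "p1 \<noteq> q2" "p1 \<noteq> q3" "p2 \<noteq> q1" "p2 \<noteq> q3" "p3 \<noteq> q1" "p3 \<noteq> q2" "p1 \<noteq> q1" "p2 \<noteq> q2" "p3 \<noteq> q3"
      using PQd[OF Pm(1) 1(1)] PQd[OF Pm(1) 2(1)] PQd[OF Pm(1) 3(1)] PQd[OF Pm(2) 1(1)] PQd[OF Pm(2) 2(1)]
        PQd[OF Pm(2) 3(1)] PQd[OF Pm(3) 1(1)] PQd[OF Pm(3) 2(1)] PQd[OF Pm(3) 3(1)] by simp_all
    have "{p1, q1} \<noteq> {p2, q2}" "{p1, q1} \<noteq> {p3, q3}" "{p2, q2} \<noteq> {p3, q3}"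
      using P(2-4) Pq by (simp_all add: doubleton_eq_iff)
    then have ad: "a1 \<noteq> a2" "a1 \<noteq> a3" "a2 \<noteq> a3" using 1(4) 2(4) 3(4) by metis+
    have Ta: "T = {a1, a2, a3}" using card_subset_eq[OF T(2), of "{a1, a2, a3}"] T(1) 1 2 3 ad by simp
    have crossq: "q = q1 \<and> p = p1 \<or> q = q2 \<and> p = p2 \<or> q = q3 \<and> p = p3" if pq: "p \<in> P" "q \<in> Q" "E p q" for p q
    proof -
      obtain a where a: "a \<in> T" "hn a = {p, q}" using cross[OF pq] by blast
      have "a = a1 \<or> a = a2 \<or> a = a3" using a(1) Ta by simp
      then have "{p, q} = {p1, q1} \<or> {p, q} = {p2, q2} \<or> {p, q} = {p3, q3}" using a(2) 1(4) 2(4) 3(4) by metis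
      then show ?thesis using PQd[OF pq(1) 1(1)] PQd[OF pq(1) 2(1)] PQd[OF pq(1) 3(1)]
        unfolding doubleton_eq_iff by blast
    qed
    have "Q \<subseteq> {q1, q2, q3}"
    proof
      fix q assume q: "q \<in> Q"
      show "q \<in> {q1, q2, q3}"
      proof (rule ccontr)
        assume n: "q \<notin> {q1, q2, q3}"
        have "{p \<in> P. E q p} = {}" using crossq[of _ q] q sym n by blast
        moreover have "\<not> E q a1" "\<not> E q a2" "\<not> E q a3"
          using hnT[OF QH[OF q]] 1(4) 2(4) 3(4) n PQd[OF Pm(1) q] PQd[OF Pm(2) q] PQd[OF Pm(3) q] by simp_all
        then have "{a \<in> T. E q a} = {}" unfolding Ta by auto
        ultimately have "card {p \<in> P. E q p} = 0" "card {a \<in> T. E q a} = 0" by (simp_all only: card.empty)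
        then show False using degH[OF QH[OF q]] le2[OF q PQ3(2) PQ(7)] by linarith
      qed
    qed
    then have Qq: "Q = {q1, q2, q3}" using 1(1) 2(1) 3(1) by blast
    have qne: "q1 \<noteq> q2" "q1 \<noteq> q3" "q2 \<noteq> q3" using PQ3(2) unfolding Qq by (auto simp: card_insert_if split: if_splits)
    have le1: "card S \<le> 1" if "S \<subseteq> {s}" for S :: "'a set" and s using card_mono[OF _ that] by simp
    have nP: "\<not> E p1 a2" "\<not> E p1 a3" "\<not> E p2 a1" "\<not> E p2 a3" "\<not> E p3 a1" "\<not> E p3 a2"
      using hnT[OF PH[OF Pm(1)]] hnT[OF PH[OF Pm(2)]] hnT[OF PH[OF Pm(3)]] 1(4) 2(4) 3(4) P(2-4) Pq by simp_all
    have nQ: "\<not> E q1 a2" "\<not> E q1 a3" "\<not> E q2 a1" "\<not> E q2 a3" "\<not> E q3 a1" "\<not> E q3 a2"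
      using hnT[OF QH[OF 1(1)]] hnT[OF QH[OF 2(1)]] hnT[OF QH[OF 3(1)]] 1(4) 2(4) 3(4) qne Pq by simp_all
    have s1: "{a \<in> T. E p1 a} \<subseteq> {a1}" "{a \<in> T. E p2 a} \<subseteq> {a2}" "{a \<in> T. E p3 a} \<subseteq> {a3}"
      "{a \<in> T. E q1 a} \<subseteq> {a1}" "{a \<in> T. E q2 a} \<subseteq> {a2}" "{a \<in> T. E q3 a} \<subseteq> {a3}"
      unfolding Ta using nP nQ by auto
    have s2: "{q \<in> Q. E p1 q} \<subseteq> {q1}" "{q \<in> Q. E p2 q} \<subseteq> {q2}" "{q \<in> Q. E p3 q} \<subseteq> {q3}"
      using crossq[OF Pm(1)] crossq[OF Pm(2)] crossq[OF Pm(3)] P(2-4) by auto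
    have s3: "{p \<in> P. E q1 p} \<subseteq> {p1}" "{p \<in> P. E q2 p} \<subseteq> {p2}" "{p \<in> P. E q3 p} \<subseteq> {p3}"
      using crossq[OF _ 1(1)] crossq[OF _ 2(1)] crossq[OF _ 3(1)] qne sym by auto
    have one: "card {a \<in> T. E p a} \<le> 1" "card {q \<in> Q. E p q} \<le> 1" if p: "p \<in> P" for p
    proof -
      have "p = p1 \<or> p = p2 \<or> p = p3" using p P(1) by simp
      then show "card {a \<in> T. E p a} \<le> 1" "card {q \<in> Q. E p q} \<le> 1"
        using le1[OF s1(1)] le1[OF s1(2)] le1[OF s1(3)] le1[OF s2(1)] le1[OF s2(2)] le1[OF s2(3)] by blast+
    qed
    have oneQ: "card {a \<in> T. E q a} \<le> 1" "card {p \<in> P. E q p} \<le> 1" if q: "q \<in> Q" for q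
    proof -
      have "q = q1 \<or> q = q2 \<or> q = q3" using q Qq by simp
      then show "card {a \<in> T. E q a} \<le> 1" "card {p \<in> P. E q p} \<le> 1"
        using le1[OF s1(4)] le1[OF s1(5)] le1[OF s1(6)] le1[OF s3(1)] le1[OF s3(2)] le1[OF s3(3)] by blast+
    qed
    have PP: "E p p'" if "p \<in> P" "p' \<in> P" "p' \<noteq> p" for p p'
      by (rule full[OF that(1) PQ3(1) PQ(6) _ that(2,3)]) (use degH[OF PH[OF that(1)]] one[OF that(1)] in linarith)
    have QQ: "E p p'" if "p \<in> Q" "p' \<in> Q" "p' \<noteq> p" for p p'
      by (rule full[OF that(1) PQ3(2) PQ(7) _ that(2,3)]) (use degH[OF QH[OF that(1)]] oneQ[OF that(1)] in linarith)
    have inH: "p1 \<in> H" "p2 \<in> H" "p3 \<in> H" "q1 \<in> H" "q2 \<in> H" "q3 \<in> H"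
      using PH[OF Pm(1)] PH[OF Pm(2)] PH[OF Pm(3)] QH[OF 1(1)] QH[OF 2(1)] QH[OF 3(1)] by simp_all
    have inB: "a1 \<in> B" "a2 \<in> B" "a3 \<in> B" "a1 \<noteq> b1" "a1 \<noteq> b2" "a2 \<noteq> b1" "a2 \<noteq> b2" "a3 \<noteq> b1" "a3 \<noteq> b2"
      using 1(3) 2(3) 3(3) by (simp_all add: T_def)
    have hnE: "E p1 a1" "E q1 a1" "E p2 a2" "E q2 a2" "E p3 a3" "E q3 a3"
      using hnT[OF inH(1)] hnT[OF inH(2)] hnT[OF inH(3)] hnT[OF inH(4)] hnT[OF inH(5)] hnT[OF inH(6)] 1(4) 2(4) 3(4) by simp_all
    have eP: "E p1 p2" "E p1 p3" "E p2 p3" using PP[OF Pm(1) Pm(2)] PP[OF Pm(1) Pm(3)] PP[OF Pm(2) Pm(3)] P(2-4) by simp_all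
    have eQ: "E q2 q3" using QQ[OF 2(1) 3(1)] qne(3) by simp
    have ev: "E p1 v" "E p2 v" "E p3 v" "E q1 v" "E q2 v" "E q3 v"
      using Ev(1)[OF inH(1)] Ev(1)[OF inH(2)] Ev(1)[OF inH(3)] Ev(1)[OF inH(4)] Ev(1)[OF inH(5)] Ev(1)[OF inH(6)] by simp_all
    have eb: "E p1 b1" "E p2 b1" "E p3 b1" "E q1 b2"
      using PQn(2)[OF Pm(1)] PQn(2)[OF Pm(2)] PQn(2)[OF Pm(3)] QPn(2)[OF 1(1)] by simp_all
    have ea: "E a1 a2" "E a2 a3" "E b1 a3" "E b2 a3" "E b1 a2"
      using adjTT[OF 1(3) 2(3) ad(1)] adjTT[OF 2(3) 3(3) ad(3)] adjT(1)[OF 3(3)] adjT(3)[OF 3(3)] adjT(1)[OF 2(3)] by simp_all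
    note edges = hnE 1(2) 2(2) 3(2) eP eQ ev eb ea
    note edges' = edges edges[THEN sgraphD(4)[OF G]]
    note nems = nem[OF inH(1) inB(1)] nem[OF inH(1) inB(2)] nem[OF inH(1) inB(3)] nem[OF inH(1) b(1)] nem[OF inH(1) b(2)]
      nem[OF inH(2) inB(1)] nem[OF inH(2) inB(2)] nem[OF inH(2) inB(3)] nem[OF inH(2) b(1)] nem[OF inH(2) b(2)]
      nem[OF inH(3) inB(1)] nem[OF inH(3) inB(2)] nem[OF inH(3) inB(3)] nem[OF inH(3) b(1)] nem[OF inH(3) b(2)]
      nem[OF inH(4) inB(1)] nem[OF inH(4) inB(2)] nem[OF inH(4) inB(3)] nem[OF inH(4) b(1)] nem[OF inH(4) b(2)]
      nem[OF inH(5) inB(1)] nem[OF inH(5) inB(2)] nem[OF inH(5) inB(3)] nem[OF inH(5) b(1)] nem[OF inH(5) b(2)]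
      nem[OF inH(6) inB(1)] nem[OF inH(6) inB(2)] nem[OF inH(6) inB(3)] nem[OF inH(6) b(1)] nem[OF inH(6) b(2)]
    have ne: "distinct [p1, p2, p3, v, q1, q2, q3, a1, a2, a3, b1, b2]"
      using P(2-4) Pq qne ad inB(4-9) b(3) nems by simp
    have "conn E {q2, a2, a1}" by (rule conn_insert[OF conn_pair[OF G, of a2 a1], of a2]) (use edges' in simp_all)
    then have "conn E (insert q3 {q2, a2, a1})" by (rule conn_insert[of E _ q2]) (use edges' in simp_all)
    then have c1: "conn E {q2, q3, a2, a1}" by (simp add: insert_commute)
    have c2: "conn E {b1, a3, b2}"
      by (rule conn_insert[OF conn_pair[OF G, of a3 b2], of a3]) (use edges' in simp_all)
    have "clique_minor V E 6"
    proof (rule clique_minorI[where Bs = "[{p1}, {p2}, {p3}, {v, q1}, {q2, q3, a2, a1}, {b1, a3, b2}]"])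
      have "conn E {v, q1}" by (rule conn_pair[OF G]) (use edges' in simp)
      then show "\<forall>S\<in>set [{p1}, {p2}, {p3}, {v, q1}, {q2, q3, a2, a1}, {b1, a3, b2}]. S \<subseteq> V \<and> conn E S"
        using c1 c2 inV inH inB b conn_singleton[of E] by simp
      show "sorted_wrt (\<lambda>S T. S \<inter> T = {} \<and> touch E S T) [{p1}, {p2}, {p3}, {v, q1}, {q2, q3, a2, a1}, {b1, a3, b2}]"
        using ne edges' by (simp add: touch_def)
    qed simp
    then show False using no by simp
  next
    case some
    obtain a where a: "a \<in> T" "hn a = {p1, q1}" using cross some by blast
    obtain y z where T': "T = {a, y, z}" "a \<noteq> y" "a \<noteq> z" "y \<noteq> z" using card_3_obtain[OF T(1) a(1)] .
    have p12: "p1 \<noteq> p2" using some by auto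
    obtain s t where st: "P = {p1, s, t}" "p1 \<noteq> s" "p1 \<noteq> t" "s \<noteq> t" using card_3_obtain[OF PQ3(1) some(3)] .
    have "p2 = s \<or> p2 = t" using some(1) p12 st(1) by simp
    then have "\<exists>p3. P = {p1, p2, p3} \<and> p3 \<noteq> p1 \<and> p3 \<noteq> p2"
    proof
      assume "p2 = s" then show ?thesis using st by (intro exI[of _ t]) simp
    next
      assume "p2 = t" then show ?thesis using st by (intro exI[of _ s]) (simp add: insert_commute)
    qed
    then obtain p3 where P: "P = {p1, p2, p3}" "p3 \<noteq> p1" "p3 \<noteq> p2" by (elim exE conjE)
    \<comment> \<open>Without neighbours in \<open>Q\<close> and not adjacent to \<open>a\<close>,
      such a \<open>p\<close> needs \<open>y\<close>, \<open>z\<close> and both other vertices of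
      \<open>P\<close> to reach degree 6.\<close>
    have nocross: "E p y \<and> E p z \<and> (\<forall>p'\<in>P. p' \<noteq> p \<longrightarrow> E p p')" if p: "p \<in> P" "\<forall>q\<in>Q. \<not> E p q" "p \<noteq> p1" for p
    proof -
      have 0: "{q \<in> Q. E p q} = {}" using p by auto
      have "p \<noteq> q1" using p some PQd by auto
      then have "\<not> E p a" using hnT[OF PH[OF p(1)]] a p(3) by auto
      then have sub: "{a \<in> T. E p a} \<subseteq> {y, z}" using T' by auto
      have c: "card {a \<in> T. E p a} \<le> 2" using card_mono[OF _ sub] T'(4) by simp
      have "2 \<le> card {a \<in> T. E p a}" "2 \<le> card {q \<in> P. E p q}"
        using degH[OF PH[OF p(1)]] 0 c le2[OF p(1) PQ3(1) PQ(6)] by simp_all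
      moreover from this have "{a \<in> T. E p a} = {y, z}" using card_subset_eq[OF _ sub] c T'(4) by simp
      ultimately show ?thesis using full[OF p(1) PQ3(1) PQ(6)] by blast
    qed
    have Pm: "p1 \<in> P" "p2 \<in> P" "p3 \<in> P" using P(1) by simp_all
    have n2: "E p2 y" "E p2 z" "E p2 p1" "E p2 p3"
      using nocross[OF some(1,2)] p12 Pm P(3) by (metis)+
    \<comment> \<open>A crossing edge at \<open>p3\<close> would have a witness in \<open>T\<close>
      that is not adjacent to \<open>p2\<close>. That can only be \<open>a\<close>, whose pair is
      \<open>{p1, q1}\<close>.\<close>
    have "\<not> E p3 q" if q: "q \<in> Q" for q
    proof
      assume "E p3 q"
      then obtain a' where a': "a' \<in> T" "hn a' = {p3, q}" using cross[OF Pm(3) q] by blast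
      have "p2 \<notin> hn a'" using a'(2) P(3) PQd[OF Pm(2) q] by simp
      then have "\<not> E p2 a'" using hnT[OF PH[OF some(1)]] by simp
      then have "a' = a" using n2(1,2) a'(1) T'(1) by auto
      then have "{p3, q} = {p1, q1}" using a(2) a'(2) by simp
      then show False using P(2) PQd[OF Pm(3) some(4)] by (simp add: doubleton_eq_iff)
    qed
    then have n3: "E p3 y" "E p3 z" "E p3 p1" using nocross[OF Pm(3)] P(2) Pm(1) by metis+
    have "E a p1" using a by (auto simp: hn_def)
    then have ap: "E p1 a" using sym by blast
    have edges: "E p1 b1" "E p2 b1" "E p3 b1" "E b1 y" "E b1 z" "E y z" "E y a" "E z a" "E b1 a"
      using PQn P adjT adjTT T' by auto
    have inH: "p1 \<in> H" "p2 \<in> H" "p3 \<in> H" using PH P by auto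
    have inB: "a \<in> B" "y \<in> B" "z \<in> B" "a \<noteq> b1" "y \<noteq> b1" "z \<noteq> b1" using T' T_def by auto
    have ne: "distinct [p1, p2, p3, a, y, z, b1]" using P p12 inH inB T' nem b by auto
    have "clique_minor V E 6"
    proof (rule clique_minorI[where Bs = "[{p2}, {p3}, {b1}, {y}, {z}, {p1, a}]"])
      show "\<forall>S\<in>set [{p2}, {p3}, {b1}, {y}, {z}, {p1, a}]. S \<subseteq> V \<and> conn E S"
        using inV inH inB b conn_singleton conn_pair[OF G ap] by auto
      show "sorted_wrt (\<lambda>S T. S \<inter> T = {} \<and> touch E S T) [{p2}, {p3}, {b1}, {y}, {z}, {p1, a}]"
        using ne n2 n3 edges by (auto simp: touch_def)
    qed simp
    then show False using no by simp
  next
    case none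
    obtain p1 p2 p3 where P: "P = {p1, p2, p3}" "p1 \<noteq> p2" "p1 \<noteq> p3" "p2 \<noteq> p3" using PQ3(1) by (metis card_3_iff)
    obtain q where q: "q \<in> Q" using PQ3(2) by fastforce
    have d: "4 \<le> card {q \<in> P. E p q} + card {a \<in> T. E p a}" if "p \<in> P" for p
    proof -
      have "{q \<in> Q. E p q} = {}" using none that by auto
      then have "card {q \<in> Q. E p q} = 0" by (simp only: card.empty)
      then show ?thesis using degH[OF PH[OF that]] by linarith
    qed
    \<comment> \<open>\<open>p'\<close> joins \<open>b1\<close> and \<open>v\<close> joins
      \<open>b2\<close> by way of \<open>q\<close>, so the edge \<open>p' v\<close> replaces the
      missing edge \<open>b1 b2\<close>; \<open>S\<close> is the sixth branch set.\<close>
    have model: False if S: "S \<subseteq> P" "conn E S" "p' \<in> P - S" "\<And>a. a \<in> T \<Longrightarrow> touch E S {a}" for S p'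
    proof -
      have p'P: "p' \<in> P" "p' \<notin> S" using S(3) by auto
      have p': "p' \<in> H" "p' \<notin> S" "E p' b1" "E b1 p'" "E p' v" "p' \<noteq> q"
        using PH[OF p'P(1)] p'P(2) PQn(2)[OF p'P(1)] sgraphD(4)[OF G PQn(2)[OF p'P(1)]] Ev(1)[OF PH[OF p'P(1)]]
          PQd[OF p'P(1) q] by simp_all
      have qq: "q \<in> H" "E q b2" "E b2 q" "E q v" "E v q" "q \<notin> S"
        using QH[OF q] QPn(2)[OF q] sgraphD(4)[OF G QPn(2)[OF q]] Ev(1)[OF QH[OF q]] PQ(3) S(1) q by auto
      have nB': "p' \<notin> B" "p' \<noteq> v" "q \<notin> B" "q \<noteq> v" using p'(1) qq(1) vHB(1,3) by auto
      have SB: "s \<notin> B \<and> s \<noteq> v" if "s \<in> S" for s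
      proof -
        have "s \<in> H" using that S(1) PH by blast
        then show ?thesis using vHB(1,3) by auto
      qed
      have Sb: "b1 \<notin> S" "b2 \<notin> S" "v \<notin> S" "x \<notin> S" "y \<notin> S" "z \<notin> S" using SB Bx by auto
      obtain s where s: "s \<in> S" using S(2) by (auto simp: conn_def)
      have "E s b1" "E s v" using s S(1) PQn PH Ev by auto
      then have ts: "touch E S {b1, p'}" "touch E S {b2, q, v}" using s by (auto simp: touch_def)
      have tx: "touch E S {x}" "touch E S {y}" "touch E S {z}" using S(4) Tx by auto
      have ne: "distinct [b1, b2, x, y, z, p', q, v]" using Bx p'(6) nB' vHB(2) by auto
      have c: "conn E {b2, q, v}" using conn_insert[of E "{q, v}" q b2] conn_pair[OF G qq(4)] qq by simp
      have "clique_minor V E 6"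
      proof (rule clique_minorI[where Bs = "[S, {b1, p'}, {b2, q, v}, {x}, {y}, {z}]"])
        show "\<forall>S\<in>set [S, {b1, p'}, {b2, q, v}, {x}, {y}, {z}]. S \<subseteq> V \<and> conn E S"
          using S(1,2) PH HV c p' qq Bx v(1) conn_singleton conn_pair[OF G p'(4)] by auto
        show "sorted_wrt (\<lambda>S T. S \<inter> T = {} \<and> touch E S T) [S, {b1, p'}, {b2, q, v}, {x}, {y}, {z}]"
          using ne ts tx Sb p' qq Txy by (auto simp: touch_def)
      qed simp
      then show False using no by simp
    qed
    have miss: "\<exists>a\<in>T. \<not> E p a" if p: "p \<in> P" for p
    proof (rule ccontr)
      assume "\<not> ?thesis"
      moreover obtain p' where "p' \<in> P" "p' \<noteq> p" using P p by blast
      ultimately show False using model[of "{p}" p'] p conn_singleton[of E p] by (auto simp: touch_def)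
    qed
    have Tle: "card {a \<in> T. E p a} \<le> 2" if p: "p \<in> P" for p
    proof -
      obtain a where a: "a \<in> T" "\<not> E p a" using miss[OF p] by blast
      then have "{a \<in> T. E p a} \<subseteq> T - {a}" by auto
      then have "card {a \<in> T. E p a} \<le> card (T - {a})" using T(2) by (intro card_mono) auto
      then show ?thesis using a T(1,2) by simp
    qed
    have PP: "E p p'" if "p \<in> P" "p' \<in> P" "p' \<noteq> p" for p p'
      by (rule full[OF that(1) PQ3(1) PQ(6) _ that(2,3)]) (use d[OF that(1)] Tle[OF that(1)] in linarith)
    have only: "E p a'" if pa: "p \<in> P" "a \<in> T" "\<not> E p a" "a' \<in> T" "a' \<noteq> a" for p a a'
    proof -
      have sub: "{a \<in> T. E p a} \<subseteq> T - {a}" using pa by auto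
      have "card {a \<in> T. E p a} = card (T - {a})"
        using d[OF pa(1)] le2[OF pa(1) PQ3(1) PQ(6)] Tle[OF pa(1)] T(1,2) pa(2) by simp
      then have "{a \<in> T. E p a} = T - {a}" using sub T(2) by (intro card_subset_eq) auto
      then show ?thesis using pa by auto
    qed
    obtain a where a: "a \<in> T" "\<not> E p1 a" using miss[of p1] P by auto
    \<comment> \<open>Two vertices of \<open>P\<close> that miss different vertices of
      \<open>T\<close> would together see all of \<open>T\<close>. So all of \<open>P\<close> misses
      the same \<open>a\<close>, and \<open>P\<close>, \<open>b1\<close> and the rest of
      \<open>T\<close> are complete.\<close>
    have same: "\<not> E p a" if p: "p \<in> P" for p
    proof (cases "p = p1")
      case False
      show ?thesis
      proof
        assume e: "E p a"
        have "E p1 p" using PP P(1) p False by auto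
        moreover obtain p' where "p' \<in> P - {p1, p}" using P by blast
        moreover have "touch E {p1, p} {c}" if "c \<in> T" for c
          using e only[of p1 a c] a that P(1) by (cases "c = a") (auto simp: touch_def)
        ultimately show False using model[of "{p1, p}" p'] p P(1) conn_pair[OF G] by auto
      qed
    qed (use a in simp)
    obtain y' z' where T': "T = {a, y', z'}" "a \<noteq> y'" "a \<noteq> z'" "y' \<noteq> z'" using card_3_obtain[OF T(1) a(1)] .
    have e: "E p y'" "E p z'" if "p \<in> P" for p using only[OF that a(1) same[OF that]] T' by auto
    have "clique_minor V E 6"
    proof (rule clique_minor_complete[OF G])
      show "P \<union> {b1, y', z'} \<subseteq> V" using P PH inV b(1) T T' by auto
      have yz: "y' \<in> B" "z' \<in> B" "b1 \<noteq> y'" "b1 \<noteq> z'" using T' by (auto simp: T_def)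
      have "p \<notin> B" if "p \<in> P" for p using PH[OF that] vHB(3) by blast
      then have "b1 \<notin> P" "y' \<notin> P" "z' \<notin> P" "b1 \<noteq> y'" "b1 \<noteq> z'" using b(1) yz by auto
      then show "card (P \<union> {b1, y', z'}) = 6" using PQ3(1) PQ(6) T'(4) by simp
      have eP: "E b1 p" "E y' p" "E z' p" if "p \<in> P" for p
        using sgraphD(4)[OF G PQn(2)[OF that]] sgraphD(4)[OF G e(1)[OF that]] sgraphD(4)[OF G e(2)[OF that]] .
      have eT: "E b1 y'" "E b1 z'" "E y' z'" using adjT[of y'] adjT[of z'] adjTT[of y' z'] T' by auto
      note eT' = eT eT[THEN sgraphD(4)[OF G]]
      show "E s t" if "s \<in> P \<union> {b1, y', z'}" "t \<in> P \<union> {b1, y', z'}" "s \<noteq> t" for s t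
        using that PP e PQn(2) eP eT' by auto
    qed
    then show False using no by simp
  qed
qed

section \<open>Minimal counterexamples\<close>

lemma sum_deg_swap:
  assumes "sgraph V E" "finite A" "finite C"
  shows "(\<Sum>x\<in>A. deg_in E C x) = (\<Sum>y\<in>C. deg_in E A y)"
proof -
  have *: "deg_in E S x = (\<Sum>y\<in>S. if E x y then 1 else 0)" if "finite S" for S x
    using that by (simp add: deg_in_def sum.If_cases Int_def)
  have "(\<Sum>x\<in>A. deg_in E C x) = (\<Sum>x\<in>A. \<Sum>y\<in>C. if E x y then 1 else 0)" using * assms(3) by simp
  also have "\<dots> = (\<Sum>y\<in>C. \<Sum>x\<in>A. if E x y then 1 else 0)" by (rule sum.swap)
  also have "\<dots> = (\<Sum>y\<in>C. \<Sum>x\<in>A. if E y x then 1 else 0)" using sgraph_sym[OF assms(1)] by (intro sum.cong refl) metis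
  finally show ?thesis using * assms(2) by simp
qed

lemma deg_in_Un:
  assumes "finite A" "finite C" "A \<inter> C = {}"
  shows "deg_in E (A \<union> C) x = deg_in E A x + deg_in E C x"
proof -
  have "{y \<in> A \<union> C. E x y} = {y \<in> A. E x y} \<union> {y \<in> C. E x y}" by auto
  then show ?thesis using assms unfolding deg_in_def by (simp add: card_Un_disjoint disjoint_iff)
qed

lemma exists_minimal_subgraph:
  assumes "sgraph V E" "\<And>x. x \<in> V \<Longrightarrow> 6 \<le> deg_in E V x"
  shows "\<exists>E'. sgraph V E' \<and> (\<forall>x y. E' x y \<longrightarrow> E x y) \<and> (\<forall>x\<in>V. 6 \<le> deg_in E' V x) \<and>
    (\<forall>x y. E' x y \<longrightarrow> deg_in E' V x = 6 \<or> deg_in E' V y = 6)"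
  using assms
proof (induction "degsum E V" arbitrary: E rule: less_induct)
  case less
  show ?case
  proof (cases "\<forall>x y. E x y \<longrightarrow> deg_in E V x = 6 \<or> deg_in E V y = 6")
    case True
    then show ?thesis using less.prems by (intro exI[of _ E]) simp
  next
    case False
    then obtain a b where ab: "E a b" "deg_in E V a \<noteq> 6" "deg_in E V b \<noteq> 6" by blast
    define E' where "E' = (\<lambda>x y. E x y \<and> {x, y} \<noteq> {a, b})"
    note d = degsum_delete_edge[OF less.prems(1) ab(1), folded E'_def]
    have V: "a \<in> V" "b \<in> V" using sgraphD(2,3)[OF less.prems(1) ab(1)] .
    have "6 \<le> deg_in E' V x" if "x \<in> V" for x
    proof -
      consider "x = a" | "x = b" | "x \<noteq> a" "x \<noteq> b" by blast
      then show ?thesis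
        using d(3-5) less.prems(2)[OF that] less.prems(2)[OF V(1)] less.prems(2)[OF V(2)] ab(2,3) by cases fastforce+
    qed
    moreover have "degsum E' V < degsum E V" using d(2) by simp
    ultimately obtain F where F: "sgraph V F" "\<forall>x y. F x y \<longrightarrow> E' x y" "\<forall>x\<in>V. 6 \<le> deg_in F V x"
      "\<forall>x y. F x y \<longrightarrow> deg_in F V x = 6 \<or> deg_in F V y = 6"
      using less.hyps[OF _ d(1)] by blast
    have "\<forall>x y. F x y \<longrightarrow> E x y" using F(2) by (simp add: E'_def)
    then show ?thesis using F by blast
  qed
qed

locale counterexample =
  fixes V :: "'a set" and E :: "'a \<Rightarrow> 'a \<Rightarrow> bool"
  assumes G: "sgraph V E" and free: "\<not> clique_minor V E 6" and nV: "card V = 12"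
    and deg6: "x \<in> V \<Longrightarrow> 6 \<le> deg_in E V x"
    and minimal: "E x y \<Longrightarrow> deg_in E V x = 6 \<or> deg_in E V y = 6"
begin

definition N where "N x = {y \<in> V. E x y}"
definition B where "B x = V - insert x (N x)"
definition cn where "cn x y = {z \<in> V. E x z \<and> E y z}"
definition L where "L = {x \<in> V. deg_in E V x = 6}"
definition Z where "Z = V - L"
text \<open>Natural subtraction is exact here, since all degrees in \<open>V\<close> are at least
  6.\<close>

definition exc where "exc S = (\<Sum>x\<in>S. deg_in E V x - 6)"

lemmas sym = sgraphD(4)[OF G] and irr = sgraphD(5)[OF G] and fin = sgraphD(1)[OF G]
  and inV = sgraphD(2,3)[OF G]

lemma sym_iff: "E x y \<longleftrightarrow> E y x" using sym by blast

lemma finN: "finite (N x)" "finite (B x)" "finite (cn x y)"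
  using fin by (simp_all add: N_def B_def cn_def)

lemma inN: "y \<in> N x \<longleftrightarrow> E x y" using inV by (auto simp: N_def)

lemma incn: "z \<in> cn x y \<longleftrightarrow> E x z \<and> E y z" using inV by (auto simp: cn_def)

lemma cn_commute: "cn x y = cn y x" by (auto simp: cn_def)

lemma inB: "y \<in> B x \<longleftrightarrow> y \<in> V \<and> y \<noteq> x \<and> \<not> E x y" by (auto simp: B_def inN)

lemma cardN: "card (N x) = deg_in E V x" by (simp add: N_def deg_in_def)

lemma L_card: "v \<in> L \<longleftrightarrow> v \<in> V \<and> card (N v) = 6" by (simp add: L_def cardN)

lemma V_split: "x \<in> V \<Longrightarrow> V = insert x (N x \<union> B x)" "x \<notin> N x" "x \<notin> B x" "N x \<inter> B x = {}"
  using inV irr by (auto simp: N_def B_def)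

lemma cardB: "v \<in> L \<Longrightarrow> card (B v) = 5"
  using V_split[of v] nV finN[of v] fin by (auto simp: L_card B_def card_Diff_subset card_insert_if inN N_def irr)

lemma deg_in_N: "deg_in E (N v) x = card (cn v x)"
  unfolding deg_in_def by (intro arg_cong[where f = card]) (auto simp: inN incn)

lemma exc_Un: "finite A \<Longrightarrow> finite C \<Longrightarrow> A \<inter> C = {} \<Longrightarrow> exc (A \<union> C) = exc A + exc C"
  by (simp add: exc_def sum.union_disjoint)

lemma sum_deg_exc:
  assumes "S \<subseteq> V"
  shows "(\<Sum>x\<in>S. deg_in E V x) = 6 * card S + exc S"
proof -
  have "(\<Sum>x\<in>S. deg_in E V x) = (\<Sum>x\<in>S. 6 + (deg_in E V x - 6))"
    using assms deg6 by (intro sum.cong refl) force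
  then show ?thesis by (simp add: exc_def sum.distrib)
qed

lemma degsum_V: "degsum E V = 72 + exc V"
  using sum_deg_exc[of V] nV by (simp add: degsum_def)

text \<open>\<open>72 + exc V\<close> is even and below 78, which is twice 4n - 9 for n =
  12.\<close>

lemma exc_cases: "exc V = 0 \<or> exc V = 2 \<or> exc V = 4"
proof -
  have "degsum E V < 78" using mader[OF G] nV free by (rule_tac ccontr) simp
  moreover have "even (degsum E V)" by (rule even_degsum[OF G fin])
  ultimately have "even (exc V)" "exc V < 6" using degsum_V by simp_all
  then show ?thesis by (auto elim!: evenE)
qed

lemma exc_split: "v \<in> L \<Longrightarrow> exc V = exc (N v) + exc (B v)"
proof -
  assume v: "v \<in> L"
  then have vV: "v \<in> V" "deg_in E V v = 6" by (auto simp: L_def)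
  have "exc V = exc (insert v (N v \<union> B v))" using V_split(1)[OF vV(1)] by simp
  also have "\<dots> = exc (N v \<union> B v)" using V_split(2,3)[of v] finN vV(2) by (simp add: exc_def)
  finally show ?thesis using exc_Un[OF finN(1,2) V_split(4)] by simp
qed

lemma cn_gt: "E u v \<Longrightarrow> exc V < 2 * card (cn u v)"
  using common_nbrs_gt[OF G free _ _, of u v] nV degsum_V by (simp add: cn_def)

text \<open>Both sides count the edges between \<open>N v\<close> and \<open>B v\<close>. Seen from
  \<open>N v\<close> there are \<open>36 + exc (N v) - 6 - degsum E (N v)\<close>, where 6 edges go
  to \<open>v\<close>; seen from \<open>B v\<close> there are
  \<open>30 + exc (B v) - degsum E (B v)\<close>.\<close>

lemma degsum_N_B:
  assumes v: "v \<in> L"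
  shows "degsum E (N v) + exc (B v) = degsum E (B v) + exc (N v)"
proof -
  have vV: "v \<in> V" and c: "card (N v) = 6" using v by (auto simp: L_card)
  have sub: "N v \<subseteq> V" "B v \<subseteq> V" by (auto simp: N_def B_def)
  have split: "deg_in E V x = (if E x v then 1 else 0) + (deg_in E (N v) x + deg_in E (B v) x)" for x
  proof -
    have "deg_in E V x = deg_in E ({v} \<union> (N v \<union> B v)) x" using V_split(1)[OF vV] by simp
    also have "\<dots> = deg_in E {v} x + deg_in E (N v \<union> B v) x"
      using V_split(2,3) finN by (intro deg_in_Un) auto
    also have "deg_in E (N v \<union> B v) x = deg_in E (N v) x + deg_in E (B v) x"
      using V_split(4) finN by (intro deg_in_Un) auto
    also have "deg_in E {v} x = (if E x v then 1 else 0)"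
    proof -
      have "{y \<in> {v}. E x y} = (if E x v then {v} else {})" by auto
      then show ?thesis by (simp add: deg_in_def)
    qed
    finally show ?thesis .
  qed
  have "(\<Sum>x\<in>N v. deg_in E V x) =
      (\<Sum>x\<in>N v. 1) + ((\<Sum>x\<in>N v. deg_in E (N v) x) + (\<Sum>x\<in>N v. deg_in E (B v) x))"
    unfolding sum.distrib[symmetric] by (intro sum.cong refl) (auto simp: split inN sym_iff)
  then have 1: "36 + exc (N v) = 6 + (degsum E (N v) + (\<Sum>x\<in>N v. deg_in E (B v) x))"
    using sum_deg_exc[OF sub(1)] c by (simp add: degsum_def)
  have "(\<Sum>x\<in>B v. deg_in E V x) = (\<Sum>x\<in>B v. deg_in E (N v) x + deg_in E (B v) x)"
    by (intro sum.cong refl) (auto simp: split inB sym_iff)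
  then have 2: "30 + exc (B v) = (\<Sum>x\<in>B v. deg_in E (N v) x) + degsum E (B v)"
    using sum_deg_exc[OF sub(2)] cardB[OF v] by (simp add: sum.distrib degsum_def)
  show ?thesis using 1 2 sum_deg_swap[OF G finN(1,2), of v v] by linarith
qed

lemma degsum_B_le: "v \<in> L \<Longrightarrow> degsum E (B v) \<le> 16"
proof (rule ccontr)
  assume v: "v \<in> L" and n: "\<not> degsum E (B v) \<le> 16"
  have "even (degsum E (B v))" by (rule even_degsum[OF G finN(2)])
  then have "18 \<le> degsum E (B v)" using n by (auto elim!: evenE)
  then have "clique_minor V E 6"
    using clique_minor_near_K5[OF G _ N_def _ B_def cardB[OF v] _ deg6] v by (auto simp: L_card)
  then show False using free by blast
qed

lemma degsum_N_le: "v \<in> L \<Longrightarrow> degsum E (N v) + exc (B v) \<le> 16 + exc (N v)"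
  using degsum_N_B degsum_B_le by fastforce

lemma degsum_N: "degsum E (N v) = (\<Sum>x\<in>N v. card (cn v x))"
  by (simp add: degsum_def deg_in_N)

text \<open>Each of the six neighbours contributes at least 3 to \<open>degsum E (N v)\<close>,
  except that those in the set on the right contribute 2.\<close>

lemma count_two:
  assumes v: "v \<in> L" and t: "\<And>x. E v x \<Longrightarrow> 2 \<le> card (cn v x)"
  shows "18 \<le> card {x \<in> N v. card (cn v x) = 2} + degsum E (N v)"
proof -
  define A where "A = {x \<in> N v. card (cn v x) = 2}"
  have A: "A \<subseteq> N v" "finite A" using finN by (auto simp: A_def)
  have "card (N v - A) = card (N v) - card A" using A by (simp add: card_Diff_subset)
  then have c: "card (N v - A) + card A = 6" using v A finN card_mono[OF finN(1) A(1)] by (simp add: L_card)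
  have "degsum E (N v) = (\<Sum>x\<in>A. card (cn v x)) + (\<Sum>x\<in>N v - A. card (cn v x))"
    unfolding degsum_N using sum.subset_diff[OF A(1) finN(1)] by (simp add: add.commute)
  moreover have "(\<Sum>x\<in>A. card (cn v x)) = 2 * card A" by (simp add: A_def)
  moreover have "3 * card (N v - A) \<le> (\<Sum>x\<in>N v - A. card (cn v x))"
  proof -
    have "3 \<le> card (cn v x)" if "x \<in> N v - A" for x using t[of x] that by (auto simp: A_def inN)
    then show ?thesis using sum_mono[of "N v - A" "\<lambda>_. 3" "\<lambda>x. card (cn v x)"] by (simp add: mult.commute)
  qed
  ultimately show ?thesis using c unfolding A_def[symmetric] by linarith
qed

text \<open>The contracted graph is one edge short of Mader's bound, and \<open>w\<close> has degree 5 in it.\<close>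

lemma critical_contr:
  assumes uv: "E u v" and crit: "2 * card (cn u v) \<le> exc V + 2" and w: "w \<in> cn u v" "w \<in> L"
  shows "y \<in> N w - {v} \<Longrightarrow> 3 \<le> deg_in (contr E u v) (N w - {v}) y"
    and "18 + 2 * card {x \<in> N w. x \<in> cn u v} \<le> degsum E (N w)"
proof -
  let ?E = "contr E u v"
  have uv': "u \<in> V" "v \<in> V" "u \<noteq> v" using inV uv irr by metis+
  have G': "sgraph (V - {v}) ?E" by (rule sgraph_contr[OF G uv])
  have free': "\<not> clique_minor (V - {v}) ?E 6" using clique_minor_contr[OF G uv] free by blast
  have c: "card (V - {v}) = 11" using uv' fin nV by simp
  have d: "degsum ?E (V - {v}) + 2 + 2 * card (cn u v) = degsum E V"
    using degsum_contr[OF G fin uv'(1,2) uv] by (simp add: cn_def)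
  have wuv: "E w u" "E w v" "w \<noteq> u" "w \<noteq> v" using w sym irr by (auto simp: incn)
  have eq: "N w - {v} = {y \<in> V - {v}. ?E w y}"
    using wuv irr[of w] inV by (auto simp: contr_def N_def)
  have c5: "card (N w - {v}) = 5" using w(2) wuv finN by (simp add: L_card inN)
  note * = critical_deg5[OF G' free' _ _ _ eq c5]
  show "3 \<le> deg_in ?E (N w - {v}) y" if "y \<in> N w - {v}"
    using *(1)[OF _ _ _ that] c d degsum_V crit by simp
  have "16 \<le> degsum ?E (N w - {v})" using *(2) c d degsum_V crit by simp
  \<comment> \<open>Inside \<open>N w\<close> the contraction loses \<open>uv\<close> and one edge
    per common neighbour of \<open>u\<close> and \<open>v\<close> there; undoing it turns 16 into
    the claimed bound.\<close>
  moreover have "degsum ?E (N w - {v}) + 2 + 2 * card {x \<in> N w. E u x \<and> E v x} = degsum E (N w)"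
    by (rule degsum_contr[OF G finN(1) _ _ uv]) (use wuv in \<open>auto simp: inN\<close>)
  ultimately show "18 + 2 * card {x \<in> N w. x \<in> cn u v} \<le> degsum E (N w)" by (simp add: incn)
qed

end

section \<open>Regular counterexamples\<close>

text \<open>The sides \<open>uv\<close> and \<open>xy\<close> are left out: in the applications they
  are the edges to be contracted. The disjuncts are the two ways of choosing the other pair of
  sides.\<close>

definition induced_square where
  "induced_square E u v x y \<longleftrightarrow> (E u x \<and> E v y \<and> \<not> E u y \<and> \<not> E v x) \<or> (E u y \<and> E v x \<and> \<not> E u x \<and> \<not> E v y)"

text \<open>Only an induced square makes the contracted vertex a new common neighbour of \<open>x\<close> and \<open>y\<close>.\<close>

lemma common_contr_le:
  assumes G: "sgraph V E" and uv: "E u v" and xy: "x \<notin> {u, v}" "y \<notin> {u, v}" and np: "\<not> induced_square E u v x y"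
  shows "card {z \<in> V - {v}. contr E u v x z \<and> contr E u v y z} \<le> card {z \<in> V. E x z \<and> E y z}"
proof -
  note sym = sgraph_sym[OF G]
  define h where "h = (\<lambda>z. if z = v then u else z)"
  have "{z \<in> V - {v}. contr E u v x z \<and> contr E u v y z} \<subseteq> h ` {z \<in> V. E x z \<and> E y z}"
  proof
    fix z assume z: "z \<in> {z \<in> V - {v}. contr E u v x z \<and> contr E u v y z}"
    show "z \<in> h ` {z \<in> V. E x z \<and> E y z}"
    proof (cases "z = u")
      case False
      then show ?thesis using z xy by (intro image_eqI[of _ _ z]) (auto simp: h_def contr_def)
    next
      case True
      then have "E u x \<or> E v x" "E u y \<or> E v y" using z xy sym by (auto simp: contr_def)
      then have "(E x u \<and> E y u) \<or> (E x v \<and> E y v)" using np sym unfolding induced_square_def by blast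
      then show ?thesis
      proof
        assume "E x u \<and> E y u"
        then show ?thesis using True sgraphD(3)[OF G, of x u] uv sgraphD(5)[OF G]
          by (intro image_eqI[of _ _ u]) (auto simp: h_def)
      next
        assume "E x v \<and> E y v"
        then show ?thesis using True sgraphD(3)[OF G, of x v]
          by (intro image_eqI[of _ _ v]) (auto simp: h_def)
      qed
    qed
  qed
  then show ?thesis using surj_card_le[of "{z \<in> V. E x z \<and> E y z}"] sgraphD(1)[OF G] by simp
qed

lemma contr_other: "a \<notin> {u, v} \<Longrightarrow> b \<notin> {u, v} \<Longrightarrow> a \<noteq> b \<Longrightarrow> contr E u v a b \<longleftrightarrow> E a b"
  by (auto simp: contr_def)

text \<open>\<open>m\<close> counts the missing neighbours of a vertex and sums to at most 2; a
  second missing pair would add a third vertex with a missing neighbour.\<close>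

lemma almost_complete:
  assumes G: "sgraph V E" and S: "finite S" and d: "card S * (card S - 1) \<le> degsum E S + 2"
    and st: "s \<in> S" "t \<in> S" "s \<noteq> t" "\<not> E s t" and xy: "x \<in> S" "y \<in> S" "x \<noteq> y" "{x, y} \<noteq> {s, t}"
  shows "E x y"
proof (rule ccontr)
  assume n: "\<not> E x y"
  note sym = sgraph_sym[OF G]
  define m where "m a = card {b \<in> S. b \<noteq> a \<and> \<not> E a b}" for a
  have "(\<Sum>a\<in>S. deg_in E S a + m a) = (\<Sum>a\<in>S. card S - 1)"
    using deg_in_compl[OF G S] by (intro sum.cong refl) (force simp: m_def)
  then have m2: "sum m S \<le> 2" using d by (simp add: sum.distrib degsum_def)
  have m0: "1 \<le> m a" if "a \<in> S" "b \<in> S" "b \<noteq> a" "\<not> E a b" for a b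
  proof -
    have "{b} \<subseteq> {b \<in> S. b \<noteq> a \<and> \<not> E a b}" using that by auto
    then show ?thesis unfolding m_def using card_mono[of "{b \<in> S. b \<noteq> a \<and> \<not> E a b}" "{b}"] S by simp
  qed
  have m1: "1 \<le> m s" "1 \<le> m t" "1 \<le> m x" "1 \<le> m y"
    using m0[of s t] m0[of t s] m0[of x y] m0[of y x] st xy n sym by auto
  have gen: "z \<in> {s, t}" if "z \<in> S" "1 \<le> m z" for z
  proof (rule ccontr)
    assume "z \<notin> {s, t}"
    then have "s \<noteq> z" "t \<noteq> z" by auto
    then have "sum m {s, t, z} = m s + m t + m z" using st(3) by simp
    moreover have "sum m {s, t, z} \<le> sum m S" using st that by (intro sum_mono2[OF S]) auto
    ultimately show False using m1(1,2) that(2) m2 by linarith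
  qed
  show False using gen[OF xy(1) m1(3)] gen[OF xy(2) m1(4)] xy(3,4) by auto
qed

locale regular_counterexample = counterexample +
  assumes reg: "exc V = 0"
begin

definition F where "F x y \<longleftrightarrow> E x y \<and> card (cn x y) = 2"

lemma FE: "F x y \<Longrightarrow> E x y" by (simp add: F_def)

lemma in_L: "x \<in> V \<Longrightarrow> x \<in> L"
  using reg deg6[of x] fin by (auto simp: exc_def L_def)

lemma card_N6: "x \<in> V \<Longrightarrow> card (N x) = 6" using in_L L_card by blast

lemma exc0: "S \<subseteq> V \<Longrightarrow> exc S = 0"
  using reg fin finite_subset by (fastforce simp: exc_def)

lemma degsum_N_eq: "x \<in> V \<Longrightarrow> degsum E (N x) = degsum E (B x)"
  using degsum_N_B[OF in_L, of x] exc0[of "N x"] exc0[of "B x"] by (simp add: N_def B_def)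

lemma degsum_N16: "x \<in> V \<Longrightarrow> degsum E (N x) \<le> 16"
  using degsum_N_eq degsum_B_le[OF in_L] by metis

text \<open>\<open>cn_gt\<close> gives one common neighbour \<open>w\<close>. Were it the only one,
  the critical contraction of \<open>uv\<close> would push the degree sum of \<open>N w\<close> to
  18, above the 16 allowed.\<close>

lemma cn2: "E u v \<Longrightarrow> 2 \<le> card (cn u v)"
proof (rule ccontr)
  assume uv: "E u v" and n: "\<not> 2 \<le> card (cn u v)"
  have "0 < card (cn u v)" using cn_gt[OF uv] reg by simp
  then obtain w where w: "w \<in> cn u v" by (auto simp: card_gt_0_iff)
  then have wV: "w \<in> V" by (simp add: cn_def)
  have "18 \<le> degsum E (N w)" using critical_contr(2)[OF uv _ w in_L[OF wV]] n by simp
  then show False using degsum_N16[OF wV] by simp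
qed

text \<open>Two contractions that cost at most three edges each take the degree sum from 72 to at
  least 60, which on ten vertices is one edge below Mader's value 62. Excluding the square ensures
  that the first contraction gives \<open>x\<close> and \<open>y\<close> no new common
  neighbour.\<close>

lemma two_contractions:
  assumes F: "F u v" "F x y" and ne: "x \<notin> {u, v}" "y \<notin> {u, v}" and np: "\<not> induced_square E u v x y"
  defines "E1 \<equiv> contr E u v"
  shows "sgraph (V - {v}) E1" "E1 x y" "sgraph (V - {v} - {y}) (contr E1 x y)"
    "\<not> clique_minor (V - {v} - {y}) (contr E1 x y) 6" "card (V - {v} - {y}) = 10"
    "60 \<le> degsum (contr E1 x y) (V - {v} - {y})"
proof -
  have uv: "E u v" "u \<in> V" "v \<in> V" "x \<noteq> y" "E x y" "x \<in> V" "y \<in> V" using FE F inV irr by metis+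
  show G1: "sgraph (V - {v}) E1" unfolding E1_def by (rule sgraph_contr[OF G uv(1)])
  show xy: "E1 x y" using uv ne by (auto simp: E1_def contr_def)
  show "sgraph (V - {v} - {y}) (contr E1 x y)" by (rule sgraph_contr[OF G1 xy])
  show "\<not> clique_minor (V - {v} - {y}) (contr E1 x y) 6"
    using clique_minor_contr[OF G1 xy] clique_minor_contr[OF G uv(1)] free unfolding E1_def by blast
  show "card (V - {v} - {y}) = 10" using uv ne fin nV by simp
  have d1: "degsum E1 (V - {v}) + 2 + 2 * card (cn u v) = degsum E V"
    using degsum_contr[OF G fin uv(2,3,1)] by (simp add: E1_def cn_def)
  have "finite (V - {v})" "x \<in> V - {v}" "y \<in> V - {v}" using fin uv ne by auto
  from degsum_contr[OF G1 this xy]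
  have "degsum (contr E1 x y) (V - {v} - {y}) + 2 + 2 * card {z \<in> V - {v}. E1 x z \<and> E1 y z} = degsum E1 (V - {v})" .
  moreover have "card {z \<in> V - {v}. E1 x z \<and> E1 y z} \<le> 2"
    using common_contr_le[OF G uv(1) ne np] F(2) by (simp add: E1_def F_def cn_def)
  ultimately show "60 \<le> degsum (contr E1 x y) (V - {v} - {y})"
    using d1 F(1) degsum_V reg by (simp add: F_def)
qed

text \<open>One edge below Mader's bound, every edge has at least three common neighbours, yet
  \<open>pq\<close> still has at most two after the two contractions.\<close>

lemma no_three_contractions:
  assumes F: "F u v" "F x y" "F p q"
    and ne: "x \<notin> {u, v}" "y \<notin> {u, v}" "p \<notin> {u, v, x, y}" "q \<notin> {u, v, x, y}"
    and np: "\<not> induced_square E u v x y" "\<not> induced_square E u v p q" "\<not> induced_square E x y p q"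
  shows False
proof -
  define E1 where "E1 = contr E u v"
  note t = two_contractions[OF F(1,2) ne(1,2) np(1), folded E1_def]
  have pq: "p \<noteq> q" "E p q" "p \<in> V" "q \<in> V" "x \<noteq> y" "E u v" using FE F inV irr by metis+
  have "E1 a b = E a b" if "a \<in> {x, y}" "b \<in> {p, q}" for a b
    unfolding E1_def by (rule contr_other) (use that ne in auto)
  then have "induced_square E1 x y p q \<longleftrightarrow> induced_square E x y p q" unfolding induced_square_def by simp
  then have np1: "\<not> induced_square E1 x y p q" using np(3) by simp
  have "card {z \<in> V - {v} - {y}. contr E1 x y p z \<and> contr E1 x y q z} \<le> card {z \<in> V - {v}. E1 p z \<and> E1 q z}"
    by (rule common_contr_le[OF t(1,2) _ _ np1]) (use ne in auto)
  also have "\<dots> \<le> card {z \<in> V. E p z \<and> E q z}"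
    unfolding E1_def by (rule common_contr_le[OF G pq(6) _ _ np(2)]) (use ne in auto)
  also have "\<dots> = 2" using F(3) by (simp add: F_def cn_def)
  finally have c: "card {z \<in> V - {v} - {y}. contr E1 x y p z \<and> contr E1 x y q z} \<le> 2" .
  have "E1 p q" using pq ne by (auto simp: E1_def contr_def)
  then have "contr E1 x y p q" using pq ne by (auto simp: contr_def)
  from common_nbrs_gt[OF t(3,4) _ _ this] show False using t(5,6) c by simp
qed

text \<open>Both contractions leave \<open>w\<close> with degree 5 in a graph at most one edge below
  Mader's bound, so its neighbourhood has degree sum at least 16. Merging \<open>x\<close> and
  \<open>y\<close> happens outside it, and undoing the contraction of \<open>uv\<close> adds at
  least 2, too much for \<open>degsum_N16\<close>.\<close>

lemma no_two_contractions:
  assumes F: "F u v" "F x y" and ne: "x \<notin> {u, v}" "y \<notin> {u, v}" and np: "\<not> induced_square E u v x y"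
    and w: "w \<in> cn u v" "w \<notin> {x, y}" "\<not> E w x" "\<not> E w y"
  shows False
proof -
  define E1 where "E1 = contr E u v"
  note t = two_contractions[OF F(1,2) ne(1,2) np(1), folded E1_def]
  have uv: "E u v" "u \<noteq> v" using FE[OF F(1)] irr by metis+
  have wuv: "E w u" "E w v" "w \<noteq> u" "w \<noteq> v" "w \<in> V" using w(1) sym irr inV by (auto simp: incn)
  define S where "S = N w - {v}"
  have eq: "S = {z \<in> V - {v} - {y}. contr E1 x y w z}"
  proof -
    have "contr E1 x y w z \<longleftrightarrow> E w z \<and> z \<noteq> v" for z
      using w(2-4) wuv uv ne irr[of w] sym by (auto simp: E1_def contr_def)
    then show ?thesis using w(4) inV by (auto simp: S_def inN)
  qed
  have c5: "card S = 5" using wuv card_N6 finN by (simp add: S_def inN)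
  have "16 \<le> degsum (contr E1 x y) S"
    by (rule critical_deg5(2)[OF t(3,4) _ _ _ eq c5]) (use t(5,6) in simp_all)
  moreover have "degsum (contr E1 x y) S = degsum E1 S"
  proof -
    have "x \<notin> S" "y \<notin> S" using w(3,4) by (auto simp: S_def inN)
    then have "{b \<in> S. contr E1 x y a b} = {b \<in> S. E1 a b}" if "a \<in> S" for a
      using that contr_other[of a x y _ E1] sgraphD(5)[OF t(1)] by (auto simp: contr_def)
    then show ?thesis unfolding degsum_def deg_in_def by (intro sum.cong refl) simp
  qed
  moreover have "degsum E1 S + 2 + 2 * card {z \<in> N w. E u z \<and> E v z} = degsum E (N w)"
    unfolding E1_def S_def by (rule degsum_contr[OF G finN(1) _ _ uv(1)]) (use wuv in \<open>auto simp: inN\<close>)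
  ultimately show False using degsum_N16[OF wuv(5)] by simp
qed

lemma card_F_ge:
  assumes "c \<in> V"
  shows "18 \<le> card {x. F c x} + degsum E (N c)"
proof -
  have "{x \<in> N c. card (cn c x) = 2} = {x. F c x}" by (auto simp: F_def inN)
  then show ?thesis using count_two[OF in_L[OF assms] cn2] by simp
qed

lemma finite_F: "finite {x. F c x}" using finN(1)[of c] by (rule finite_subset[rotated]) (auto simp: F_def inN)

lemma F_nonnbrs:
  assumes "F u v"
  shows "card {z \<in> V. \<not> E u z \<and> \<not> E v z} = 2"
proof -
  have uv: "u \<in> V" "v \<in> V" using FE[OF assms] inV by auto
  have "card (N u \<union> N v) + card (N u \<inter> N v) = 12" using card_Un_Int[OF finN(1,1), of u v] card_N6 uv by simp
  moreover have "N u \<inter> N v = cn u v" by (auto simp: inN incn)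
  ultimately have "card (N u \<union> N v) = 10" using assms by (simp add: F_def)
  moreover have "{z \<in> V. \<not> E u z \<and> \<not> E v z} = V - (N u \<union> N v)" by (auto simp: inN)
  moreover have "N u \<union> N v \<subseteq> V" by (auto simp: N_def)
  ultimately show ?thesis using finN nV by (simp add: card_Diff_subset)
qed

text \<open>With \<open>c1\<close>, \<open>c2\<close> the common non-neighbours of
  \<open>uv\<close>, the vertices of \<open>B c1\<close> other than \<open>c2\<close> form a set
  \<open>S\<close> of four. By \<open>H\<close> it contains a non-edge, which makes
  \<open>N c1\<close> so sparse that the set \<open>X\<close> of vertices joined to
  \<open>c1\<close> by \<open>F\<close> becomes too large.\<close>

lemma F_nonnbrs_nonadjacent_case:
  assumes H: "\<And>u v a b. F u v \<Longrightarrow> \<not> E u a \<Longrightarrow> \<not> E v a \<Longrightarrow> \<not> E u b \<Longrightarrow> \<not> E v b \<Longrightarrow> \<not> E a b"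
    and F: "F u v"
  shows False
proof -
  have uv: "E u v" "u \<in> V" "v \<in> V" "u \<noteq> v" using FE[OF F] inV irr by metis+
  obtain c1 c2 where c: "{z \<in> V. \<not> E u z \<and> \<not> E v z} = {c1, c2}" "c1 \<noteq> c2"
    using F_nonnbrs[OF F] unfolding card_2_iff by blast
  then have cV: "c1 \<in> V" "c2 \<in> V" "\<not> E u c1" "\<not> E v c1" "\<not> E u c2" "\<not> E v c2" by auto
  then have cV': "\<not> E c1 u" "\<not> E c1 v" "\<not> E c2 u" "\<not> E c2 v" using sym by blast+
  have ncc: "\<not> E c1 c2" "\<not> E c2 c1" using H[OF F] cV by blast+
  have cuv: "c1 \<noteq> u" "c1 \<noteq> v" "c2 \<noteq> u" "c2 \<noteq> v" using cV uv sym by auto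
  define X where "X = {x. F c1 x}"
  define Y where "Y = {y. F c2 y}"
  have fX: "finite X" "finite Y" using finite_F by (simp_all add: X_def Y_def)
  have X18: "18 \<le> card X + degsum E (N c1)" "18 \<le> card Y + degsum E (N c2)"
    using card_F_ge[OF cV(1)] card_F_ge[OF cV(2)] by (simp_all add: X_def Y_def)
  have X2: "2 \<le> card X" "2 \<le> card Y" using X18 degsum_N16[OF cV(1)] degsum_N16[OF cV(2)] by linarith+
  have XN: "X \<subseteq> N c1" by (auto simp: X_def F_def inN)
  \<comment> \<open>The edges \<open>uv\<close>, \<open>c1 x\<close> and \<open>c2 y\<close> cannot
    all be contracted, and only the last two can form a square. As \<open>c1 c2\<close> is a
    non-edge, \<open>x c2\<close> is a side of it. Two choices for \<open>y\<close> allow one other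
    than \<open>x\<close>.\<close>
  have Xc2: "E c2 x" if x: "x \<in> X" for x
  proof -
    have "\<not> Y \<subseteq> {x}" using card_mono[of "{x}" Y] X2(2) by auto
    then obtain y where y: "y \<in> Y" "y \<noteq> x" by blast
    have F1: "F c1 x" and F2: "F c2 y" using x y by (simp_all add: X_def Y_def)
    have ne: "x \<notin> {u, v}" "y \<notin> {u, v}" "x \<noteq> c2" "y \<noteq> c1" using FE[OF F1] FE[OF F2] cV' ncc by auto
    have "induced_square E c1 x c2 y"
    proof (rule ccontr)
      assume "\<not> induced_square E c1 x c2 y"
      then show False
        by (rule no_three_contractions[OF F F1 F2, rotated -1]) (use ne cuv c(2) y(2) cV in \<open>auto simp: induced_square_def\<close>)
    qed
    then show ?thesis using ncc sym unfolding induced_square_def by blast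
  qed
  define M where "M = B c1 - {u, v, c2}"
  have Bc: "u \<in> B c1" "v \<in> B c1" "c2 \<in> B c1" using uv cV cV' cuv ncc c(2) by (auto simp: inB)
  have M: "card M = 2" "finite M" using cardB[OF in_L[OF cV(1)]] Bc finN uv(4) cuv by (auto simp: M_def card_Diff_subset)
  define S where "S = insert u (insert v M)"
  have S: "card S = 4" "finite S" "c2 \<notin> S" "B c1 = insert c2 S" using M uv(4) cuv Bc by (auto simp: S_def M_def)
  have Vs: "V = insert c1 (N c1 \<union> insert c2 S)" using V_split(1)[OF cV(1)] S(4) by simp
  have dB: "degsum E (N c1) = degsum E S + 2 * deg_in E S c2"
    using degsum_N_eq[OF cV(1)] degsum_insert[OF G S(2,3)] S(4) by simp
  have g: "deg_in E S c2 \<le> 2"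
  proof -
    have "{z \<in> S. E c2 z} \<subseteq> M" using cV' by (auto simp: S_def)
    then show ?thesis using card_mono[OF M(2)] M(1) by (simp add: deg_in_def)
  qed
  \<comment> \<open>The two common non-neighbours of \<open>c1\<close> and \<open>x\<close> lie in
    \<open>S\<close>, because \<open>x\<close> is adjacent to \<open>c2\<close>; by \<open>H\<close>
    they form a non-edge.\<close>
  have pair: "\<exists>s t. s \<in> S \<and> t \<in> S \<and> s \<noteq> t \<and> \<not> E s t \<and> (\<forall>a\<in>S. a \<noteq> s \<longrightarrow> a \<noteq> t \<longrightarrow> E x a)" if x: "x \<in> X" for x
  proof -
    have F1: "F c1 x" using x by (simp add: X_def)
    have x1: "x \<in> V" "E x c1" "E x c2" "\<not> x = c1" using FE[OF F1] inV sym Xc2[OF x] irr by metis+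
    have "{z \<in> V. \<not> E c1 z \<and> \<not> E x z} = {z \<in> S. \<not> E x z}"
    proof -
      have "z \<in> S" if "z \<in> V" "\<not> E c1 z" "\<not> E x z" for z using that Vs x1 by (auto simp: inN)
      moreover have "z \<in> V \<and> \<not> E c1 z" if "z \<in> S" for z using that S(4) inB[of z c1] by blast
      ultimately show ?thesis by blast
    qed
    then have "card {z \<in> S. \<not> E x z} = 2" using F_nonnbrs[OF F1] by simp
    then obtain s t where st: "{z \<in> S. \<not> E x z} = {s, t}" "s \<noteq> t" unfolding card_2_iff by blast
    have "s \<in> S" "t \<in> S" "\<not> E x s" "\<not> E x t" using st by auto
    moreover have "\<not> E c1 s" "\<not> E c1 t" using calculation S(4) inB[of _ c1] by blast+
    ultimately have "\<not> E s t" using H[OF F1] by blast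
    moreover have "\<forall>a\<in>S. a \<noteq> s \<longrightarrow> a \<noteq> t \<longrightarrow> E x a" using st by blast
    ultimately show ?thesis using \<open>s \<in> S\<close> \<open>t \<in> S\<close> st(2) by blast
  qed
  obtain x0 where "x0 \<in> X" using X2(1) by fastforce
  then obtain s t where st: "s \<in> S" "t \<in> S" "s \<noteq> t" "\<not> E s t" using pair by blast
  have dS: "degsum E S \<le> 10"
  proof (rule ccontr)
    assume n: "\<not> degsum E S \<le> 10"
    have "even (degsum E S)" by (rule even_degsum[OF G S(2)])
    then have n12: "12 \<le> degsum E S" using n by (auto elim!: evenE)
    obtain a where a: "a \<in> S" "a \<noteq> s" "a \<noteq> t"
    proof -
      have "\<not> S \<subseteq> {s, t}" using card_mono[of "{s, t}" S] S(1) st(3) by auto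
      then show ?thesis using that by blast
    qed
    have "deg_in E S s \<le> 2"
    proof -
      have "{z \<in> S. E s z} \<subseteq> S - {s, t}" using st(4) irr by auto
      then show ?thesis using card_mono[of "S - {s, t}" "{z \<in> S. E s z}"] S(1,2) st by (simp add: deg_in_def card_Diff_subset)
    qed
    moreover have "deg_in E S z \<le> 3" if "z \<in> S" for z using deg_in_compl[OF G S(2) that] S(1) by linarith
    then have "(\<Sum>z\<in>S - {s}. deg_in E S z) \<le> (\<Sum>z\<in>S - {s}. 3)" by (intro sum_mono) auto
    then have "(\<Sum>z\<in>S - {s}. deg_in E S z) \<le> 9" using S(1,2) st(1) by simp
    ultimately have "degsum E S \<le> 11" using sum.remove[OF S(2) st(1), of "deg_in E S"] by (simp add: degsum_def)
    then show False using n12 by simp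
  qed
  have X4: "4 \<le> card X" using X18(1) dB dS g by linarith
  show False
  proof (cases "degsum E S = 10")
    \<comment> \<open>A vertex \<open>a\<close> off the only non-edge of \<open>S\<close> sees the
      other three vertices of \<open>S\<close> and the at least four of \<open>X\<close>.\<close>
    case True
    obtain a where a: "a \<in> S" "a \<noteq> s" "a \<noteq> t"
    proof -
      have "\<not> S \<subseteq> {s, t}" using card_mono[of "{s, t}" S] S(1) st(3) by auto
      then show ?thesis using that by blast
    qed
    have only: "E b d" if "b \<in> S" "d \<in> S" "b \<noteq> d" "{b, d} \<noteq> {s, t}" for b d
      by (rule almost_complete[OF G S(2) _ st that]) (use S(1) True in simp)
    have "X \<subseteq> N a"
    proof
      fix x assume "x \<in> X"
      then obtain s' t' where st': "s' \<in> S" "t' \<in> S" "s' \<noteq> t'" "\<not> E s' t'" "\<forall>a\<in>S. a \<noteq> s' \<longrightarrow> a \<noteq> t' \<longrightarrow> E x a"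
        using pair by blast
      then have "{s', t'} = {s, t}" using only by blast
      then have "E x a" using st'(5) a by (auto simp: doubleton_eq_iff)
      then show "x \<in> N a" using sym by (simp add: inN)
    qed
    moreover have "S - {a} \<subseteq> N a"
    proof
      fix d assume d: "d \<in> S - {a}"
      have "E a d" by (rule only[OF a(1)]) (use a d in \<open>auto simp: doubleton_eq_iff\<close>)
      then show "d \<in> N a" by (simp add: inN)
    qed
    ultimately have "card (X \<union> (S - {a})) \<le> card (N a)" using finN by (intro card_mono) auto
    moreover have "X \<inter> (S - {a}) = {}" using XN S(4) V_split(4)[of c1] by blast
    then have "card (X \<union> (S - {a})) = card X + 3" using fX S(1,2) a(1) by (simp add: card_Un_disjoint)
    moreover have "a \<in> V" using a(1) Vs by blast
    ultimately show False using card_N6[of a] X4 by simp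
  next
    case False
    have "even (degsum E S)" by (rule even_degsum[OF G S(2)])
    then have dS8: "degsum E S \<le> 8" using dS False by (auto elim!: evenE)
    \<comment> \<open>Now \<open>X = N c1\<close>, so \<open>c1\<close> and \<open>c2\<close> have
      the same neighbours and \<open>c2\<close> has none in \<open>S\<close>; this improves the
      lower bound on \<open>card X\<close> to 18 - 8 = 10.\<close>
    then have "6 \<le> card X" using X18(1) dB g by linarith
    then have "X = N c1" using card_subset_eq[OF finN(1) XN] card_mono[OF finN(1) XN] card_N6[OF cV(1)] by simp
    then have "N c1 \<subseteq> N c2" using Xc2 by (auto simp: inN)
    then have "N c1 = N c2" using card_subset_eq[OF finN(1)] card_N6 cV by simp
    moreover have "\<not> E c1 z" if "z \<in> S" for z using that S(4) inB[of z c1] by blast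
    ultimately have "{z \<in> S. E c2 z} = {}" using inN by blast
    then have "deg_in E S c2 = 0" unfolding deg_in_def by (simp only: card.empty)
    then have "10 \<le> card X" using X18(1) dB dS8 by linarith
    then show False using card_mono[OF finN(1) XN] card_N6[OF cV(1)] by simp
  qed
qed

end

lemma deg_in_le_card: "finite S \<Longrightarrow> deg_in E S x \<le> card S"
  unfolding deg_in_def by (intro card_mono) auto

lemma deg_in_le_others:
  assumes "finite S" "x \<in> S" "\<not> E x x"
  shows "deg_in E S x \<le> card S - 1"
proof -
  have "{y \<in> S. E x y} \<subseteq> S - {x}" using assms by auto
  then show ?thesis using card_mono[of "S - {x}" "{y \<in> S. E x y}"] assms(1,2) by (simp add: deg_in_def)
qed

lemma deg_in_pos: "finite S \<Longrightarrow> y \<in> S \<Longrightarrow> E x y \<Longrightarrow> 1 \<le> deg_in E S x"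
  unfolding deg_in_def by (simp add: Suc_le_eq card_gt_0_iff) blast

lemma deg_in_eq_0: "finite S \<Longrightarrow> deg_in E S x = 0 \<longleftrightarrow> (\<forall>y\<in>S. \<not> E x y)"
  unfolding deg_in_def by auto

lemma deg_in_full: "finite S \<Longrightarrow> \<forall>y\<in>S. E x y \<Longrightarrow> deg_in E S x = card S"
  unfolding deg_in_def by (intro arg_cong[where f = card]) auto

section \<open>The regular case in which the common non-neighbours of an edge are adjacent\<close>

locale adjacent_nonnbrs = regular_counterexample +
  fixes u v c d
  assumes uv: "F u v" and non: "\<not> E u c" "\<not> E v c" "\<not> E u d" "\<not> E v d" and cd: "E c d"
begin

text \<open>Common neighbours of \<open>c\<close> and \<open>d\<close>, and the private ones of
  each. Once \<open>card Y = 2\<close> is known, they and the pairs \<open>{u, v}\<close> and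
  \<open>{c, d}\<close> partition \<open>V\<close> as 2 + 3 + 3 + 2 + 2.\<close>

definition Y where "Y = cn c d"
definition P where "P = N c - Y - {d}"
definition Q where "Q = N d - Y - {c}"

lemma non': "\<not> E c u" "\<not> E c v" "\<not> E d u" "\<not> E d v" using non sym by blast+

lemma Euv: "E u v" "E v u" using FE[OF uv] sym by blast+

lemma verts: "u \<in> V" "v \<in> V" "c \<in> V" "d \<in> V" using Euv cd inV by blast+

lemma dc: "E d c" using cd sym by blast

lemma distinct_verts: "distinct [u, v, c, d]"
  using Euv cd non irr by auto

lemma cover: "z \<in> V \<Longrightarrow> z \<noteq> c \<Longrightarrow> z \<noteq> d \<Longrightarrow> E z u \<or> E z v"
proof (rule ccontr)
  assume z: "z \<in> V" "z \<noteq> c" "z \<noteq> d" "\<not> (E z u \<or> E z v)"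
  have "{c, d, z} \<subseteq> {z \<in> V. \<not> E u z \<and> \<not> E v z}" using z verts non sym by blast
  then have "card {c, d, z} \<le> 2" using F_nonnbrs[OF uv] fin card_mono[of "{z \<in> V. \<not> E u z \<and> \<not> E v z}"] by simp
  then show False using z distinct_verts by auto
qed

lemma finYPQ: "finite Y" "finite P" "finite Q" using finN by (simp_all add: Y_def P_def Q_def)

lemma inY: "y \<in> Y \<longleftrightarrow> E c y \<and> E d y" by (simp add: Y_def incn)
lemma inP: "p \<in> P \<longleftrightarrow> E c p \<and> \<not> E d p \<and> p \<noteq> d" by (auto simp: P_def inY inN)
lemma inQ: "q \<in> Q \<longleftrightarrow> E d q \<and> \<not> E c q \<and> q \<noteq> c" by (auto simp: Q_def inY inN)

lemma Nc: "N c = insert d (Y \<union> P)" "d \<notin> Y \<union> P" "Y \<inter> P = {}"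
  using cd irr by (auto simp: inY inP inN)

lemma card_P: "card P + card Y = 5"
  using card_N6[OF verts(3)] Nc finYPQ by (simp add: card_Un_disjoint)

text \<open>Were there only two, \<open>cy\<close> could be contracted together with
  \<open>uv\<close>; but \<open>d\<close> is a common neighbour of \<open>c\<close> and
  \<open>y\<close> adjacent to neither \<open>u\<close> nor \<open>v\<close>, which
  \<open>no_two_contractions\<close> forbids.\<close>

lemma cn_Y: "y \<in> Y \<Longrightarrow> 3 \<le> card (cn c y)"
proof (rule ccontr)
  assume y: "y \<in> Y" and n: "\<not> 3 \<le> card (cn c y)"
  have cy: "E c y" "E d y" using y by (auto simp: inY)
  then have F: "F c y" using cn2[OF cy(1)] n by (simp add: F_def)
  have "E y d" using cy sym by blast
  then have w: "d \<in> cn c y" using cd by (simp add: incn)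
  show False
    by (rule no_two_contractions[OF F uv _ _ _ w])
      (use cy non non' distinct_verts in \<open>auto simp: induced_square_def\<close>)
qed

lemma degsum_Nc: "degsum E (N c) = card Y + (\<Sum>y\<in>Y. card (cn c y)) + (\<Sum>p\<in>P. card (cn c p))"
proof -
  have "degsum E (N c) = (\<Sum>x\<in>insert d (Y \<union> P). card (cn c x))" using degsum_N[of c] Nc(1) by simp
  also have "\<dots> = card (cn c d) + ((\<Sum>y\<in>Y. card (cn c y)) + (\<Sum>p\<in>P. card (cn c p)))"
    using Nc(2,3) finYPQ by (simp add: sum.union_disjoint)
  finally show ?thesis by (simp add: Y_def)
qed

lemma P_ge: "p \<in> P \<Longrightarrow> 2 \<le> card (cn c p)" using cn2 by (simp add: inP)

text \<open>\<open>d\<close> contributes \<open>card Y\<close>, every vertex of \<open>Y\<close> at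
  least 3 and each of the \<open>5 - card Y\<close> vertices of \<open>P\<close> at least 2. The
  upper bound 16 then leaves at most three vertices in \<open>Y\<close>.\<close>

lemma degsum_ge_Y: "10 + 2 * card Y \<le> degsum E (N c)"
proof -
  have "3 * card Y \<le> (\<Sum>y\<in>Y. card (cn c y))"
    using sum_mono[of Y "\<lambda>_. 3" "\<lambda>y. card (cn c y)"] cn_Y by (simp add: mult.commute)
  moreover have "2 * card P \<le> (\<Sum>p\<in>P. card (cn c p))"
    using sum_mono[of P "\<lambda>_. 2" "\<lambda>y. card (cn c y)"] P_ge by (simp add: mult.commute)
  ultimately show ?thesis using degsum_Nc card_P by linarith
qed

lemma card_Y: "2 \<le> card Y" "card Y \<le> 3"
  using cn2[OF cd] degsum_ge_Y degsum_N16[OF verts(3)] by (simp_all add: Y_def)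

lemma P_F:
  assumes "card Y = 3" "p \<in> P"
  shows "F c p" "degsum E (N c) = 16"
proof -
  show 16: "degsum E (N c) = 16" using degsum_ge_Y degsum_N16[OF verts(3)] assms(1) by simp
  have "3 * card Y \<le> (\<Sum>y\<in>Y. card (cn c y))"
    using sum_mono[of Y "\<lambda>_. 3" "\<lambda>y. card (cn c y)"] cn_Y by (simp add: mult.commute)
  then have "(\<Sum>p\<in>P. card (cn c p)) \<le> 4" using degsum_Nc 16 assms(1) by simp
  moreover have "(\<Sum>p\<in>P. card (cn c p)) = card (cn c p) + (\<Sum>p\<in>P - {p}. card (cn c p))"
    by (rule sum.remove[OF finYPQ(2) assms(2)])
  moreover have "2 * card (P - {p}) \<le> (\<Sum>p\<in>P - {p}. card (cn c p))"
    using sum_mono[of "P - {p}" "\<lambda>_. 2" "\<lambda>y. card (cn c y)"] P_ge by (simp add: mult.commute)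
  moreover have "card (P - {p}) = 1" using assms card_P finYPQ by simp
  ultimately have "card (cn c p) \<le> 2" by linarith
  then show "F c p" using P_ge[OF assms(2)] assms(2) by (simp add: F_def inP)
qed

text \<open>Among the disjoint edges \<open>uv\<close>, \<open>cp\<close> and \<open>dq\<close> only
  the last two can form a square; as \<open>cd\<close> is an edge, its fourth side is
  \<open>pq\<close>.\<close>

lemma F_PQ:
  assumes "p \<in> P" "q \<in> Q" "F c p" "F d q"
  shows "E p q"
proof (rule ccontr)
  assume n: "\<not> E p q"
  have ne: "p \<noteq> q" using assms(1,2) by (auto simp: inP inQ)
  have pq: "E c p" "\<not> E d p" "p \<noteq> d" "E d q" "\<not> E c q" "q \<noteq> c" using assms(1,2) by (auto simp: inP inQ)
  show False
    by (rule no_three_contractions[OF uv assms(3,4)])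
      (use n ne pq non non' distinct_verts in \<open>auto simp: induced_square_def\<close>)
qed

lemma deg_in_Nc: "p \<in> P \<Longrightarrow> card (cn c p) = deg_in E Y p + deg_in E P p"
proof -
  assume p: "p \<in> P"
  have "\<not> E p d" using p sym by (auto simp: inP)
  then have "deg_in E {d} p = 0" by (simp add: deg_in_eq_0)
  moreover have "deg_in E (N c) p = deg_in E ({d} \<union> (Y \<union> P)) p" using Nc(1) by simp
  moreover have "\<dots> = deg_in E {d} p + deg_in E (Y \<union> P) p" using Nc(2) finYPQ by (intro deg_in_Un) auto
  moreover have "deg_in E (Y \<union> P) p = deg_in E Y p + deg_in E P p" using Nc(3) finYPQ by (intro deg_in_Un) auto
  ultimately show ?thesis by (simp add: deg_in_N)
qed

end

lemma (in adjacent_nonnbrs) swapped: "adjacent_nonnbrs V E u v d c"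
  by unfold_locales (use uv non dc in auto)

context adjacent_nonnbrs
begin

interpretation sw: adjacent_nonnbrs V E u v d c by (rule swapped)

lemma sw_eq: "sw.Y = Y" "sw.P = Q" "sw.Q = P"
  by (auto simp: sw.inY inY sw.inP inP sw.inQ inQ)

text \<open>By \<open>F_PQ\<close> every \<open>q\<close> in \<open>Q\<close> sees all of
  \<open>P\<close>, which fixes its six neighbours up to few choices. Inside \<open>B c\<close>,
  made of \<open>u\<close>, \<open>v\<close>, the two vertices of \<open>Q\<close> and one more
  vertex \<open>r\<close>, the degrees then sum to at most 4 + 4 + 2 + 2 + 2, less than the required
  16.\<close>

lemma card_Y_not_3: "card Y \<noteq> 3"
proof
  assume Y3: "card Y = 3"
  have P2: "card P = 2" and Q2: "card Q = 2" using card_P sw.card_P Y3 by (simp_all add: sw_eq)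
  have Epq: "E q p" if "p \<in> P" "q \<in> Q" for p q
    using F_PQ[OF that] P_F[OF Y3 that(1)] sw.P_F[of q] that Y3 sym by (simp add: sw_eq)
  have 16: "degsum E (B c) = 16"
  proof -
    obtain p where "p \<in> P" using P2 by fastforce
    then show ?thesis using P_F(2)[OF Y3] degsum_N_eq[OF verts(3)] by simp
  qed
  have sub: "{u, v} \<union> Q \<subseteq> B c" using verts non' distinct_verts inV(2)[of d] by (auto simp: inB inQ)
  have dj: "{u, v} \<inter> Q = {}" using non' by (auto simp: inQ)
  have cuq: "card ({u, v} \<union> Q) = 4" using distinct_verts Q2 dj finYPQ by (simp add: card_Un_disjoint)
  have B5: "card (B c) = 5" by (rule cardB[OF in_L[OF verts(3)]])
  have Bd: "x \<notin> N c" if "x \<in> B c" for x using that V_split(4)[of c] by blast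
  have q_facts: "deg_in E (B c) q \<le> 2" "N q \<subseteq> N c \<union> N d \<union> {u, v}" if q: "q \<in> Q" for q
  proof -
    have qE: "E d q" "\<not> E c q" "E q d" using q sym by (auto simp: inQ)
    have qV: "q \<in> V" using qE inV by blast
    have "F d q" using sw.P_F(1)[of q] q Y3 by (simp add: sw_eq)
    then have c2: "card (cn d q) = 2" by (simp add: F_def)
    have cns: "cn d q \<subseteq> N q" "cn d q \<subseteq> N d" by (auto simp: incn inN)
    have PN: "P \<subseteq> N q" using Epq q by (auto simp: inN)
    have dis: "P \<inter> cn d q = {}" by (auto simp: inP incn)
    have dn: "d \<notin> P \<union> cn d q" using irr by (auto simp: inP incn)
    obtain s where s: "s \<in> {u, v}" "E q s" using cover[OF qV] q irr by (auto simp: inQ)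
    have sn: "s \<notin> insert d (P \<union> cn d q)" using s(1) non non' distinct_verts by (auto simp: inP incn)
    have "card (insert s (insert d (P \<union> cn d q))) = 6"
      using sn dn dis P2 c2 finYPQ finN by (simp add: card_Un_disjoint)
    moreover have "insert s (insert d (P \<union> cn d q)) \<subseteq> N q" using s qE PN cns by (auto simp: inN)
    ultimately have eq: "N q = insert s (insert d (P \<union> cn d q))"
      using card_subset_eq[OF finN(1)] card_N6[OF qV] by metis
    then show "N q \<subseteq> N c \<union> N d \<union> {u, v}" using s(1) cns cd by (auto simp: inP inN)
    have "\<exists>y\<in>cn d q. y \<in> Y"
    proof (rule ccontr)
      assume n: "\<not> ?thesis"
      have "cn d q \<subseteq> Q - {q}" using n qE irr sym by (auto simp: incn inQ inY)
      then have "card (cn d q) \<le> card (Q - {q})" using finYPQ by (intro card_mono) auto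
      then show False using c2 q Q2 finYPQ by simp
    qed
    then obtain y where y: "y \<in> cn d q" "y \<in> Y" by blast
    have "{z \<in> B c. E q z} \<subseteq> insert s (cn d q - {y})"
    proof
      fix z assume z: "z \<in> {z \<in> B c. E q z}"
      then have "z \<in> N q" "z \<notin> N c" using Bd by (auto simp: inN)
      then show "z \<in> insert s (cn d q - {y})" using eq y cd by (auto simp: inN inP inY)
    qed
    then have "card {z \<in> B c. E q z} \<le> card (insert s (cn d q - {y}))" using finN by (intro card_mono) auto
    also have "\<dots> \<le> 2" using c2 y finN by (simp add: card_insert_if)
    finally show "deg_in E (B c) q \<le> 2" by (simp add: deg_in_def)
  qed
  have "card (B c - ({u, v} \<union> Q)) = 1" using card_Diff_subset[OF _ sub] cuq B5 finYPQ by simp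
  then obtain r where r: "B c - ({u, v} \<union> Q) = {r}" using card_1_singletonE by blast
  then have rB: "r \<in> B c" "r \<notin> Q" "r \<noteq> c" "\<not> E c r" using inB[of r c] by blast+
  have rq: "\<not> E r q" if "q \<in> Q" for q
  proof
    assume "E r q"
    then have "r \<in> N q" using sym by (simp add: inN)
    moreover have "r \<notin> N c" using Bd[OF rB(1)] .
    moreover have "r \<notin> {u, v}" using r by blast
    ultimately have "E d r" using q_facts(2)[OF that] inN by blast
    then show False using rB inQ by blast
  qed
  have "deg_in E (B c) r \<le> 2"
  proof -
    have "{z \<in> B c. E r z} \<subseteq> {u, v}"
    proof
      fix z assume z: "z \<in> {z \<in> B c. E r z}"
      then have "z \<notin> Q" "z \<noteq> r" using rq irr by blast+
      then show "z \<in> {u, v}" using z r by blast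
    qed
    then have "card {z \<in> B c. E r z} \<le> card {u, v}" by (intro card_mono) auto
    then show ?thesis using distinct_verts by (simp add: deg_in_def)
  qed
  moreover have "(\<Sum>q\<in>Q. deg_in E (B c) q) \<le> 4"
    using sum_mono[of Q "deg_in E (B c)" "\<lambda>_. 2"] q_facts(1) Q2 by simp
  moreover have "deg_in E (B c) x \<le> 4" if "x \<in> B c" for x
    using deg_in_le_others[OF finN(2) that] irr B5 by simp
  then have "deg_in E (B c) u \<le> 4" "deg_in E (B c) v \<le> 4" using sub by auto
  moreover have "degsum E (B c) = deg_in E (B c) r + (deg_in E (B c) u + (deg_in E (B c) v + (\<Sum>q\<in>Q. deg_in E (B c) q)))"
  proof -
    have B: "B c = insert r (insert u (insert v Q))" using r sub by blast
    have "u \<notin> Q" "v \<notin> Q" "u \<noteq> v" "r \<notin> insert u (insert v Q)" using dj distinct_verts r by auto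
    then have "(\<Sum>x\<in>insert r (insert u (insert v Q)). f x) = f r + (f u + (f v + (\<Sum>q\<in>Q. f q)))" for f :: "'a \<Rightarrow> nat"
      using finYPQ by simp
    then show ?thesis using B by (simp add: degsum_def)
  qed
  ultimately show False using 16 by linarith
qed

lemma Y2: "card Y = 2" using card_Y card_Y_not_3 by linarith

lemma P3: "card P = 3" "card Q = 3" using card_P sw.card_P Y2 by (simp_all add: sw_eq)

lemma deg_split: "deg_in E V x = deg_in E {u, v} x + deg_in E {c, d} x + deg_in E Y x + deg_in E P x + deg_in E Q x"
proof -
  have "card ({u, v} \<union> ({c, d} \<union> (Y \<union> (P \<union> Q)))) = 12"
  proof -
    have "P \<inter> Q = {}" "Y \<inter> (P \<union> Q) = {}" "{c, d} \<inter> (Y \<union> (P \<union> Q)) = {}" "{u, v} \<inter> ({c, d} \<union> (Y \<union> (P \<union> Q))) = {}"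
      using irr non' distinct_verts by (auto simp: inP inQ inY)
    then show ?thesis using P3 Y2 distinct_verts finYPQ by (simp add: card_Un_disjoint del: Un_insert_left)
  qed
  moreover have "{u, v} \<union> ({c, d} \<union> (Y \<union> (P \<union> Q))) \<subseteq> V" using verts inV by (auto simp: inP inQ inY)
  ultimately have V: "V = {u, v} \<union> ({c, d} \<union> (Y \<union> (P \<union> Q)))" using card_subset_eq[OF fin] nV by metis
  have dj: "P \<inter> Q = {}" "Y \<inter> (P \<union> Q) = {}" "{c, d} \<inter> (Y \<union> (P \<union> Q)) = {}" "{u, v} \<inter> ({c, d} \<union> (Y \<union> (P \<union> Q))) = {}"
    using irr non' distinct_verts by (auto simp: inP inQ inY)
  have f: "finite {u, v}" "finite {c, d}" "finite (P \<union> Q)" "finite (Y \<union> (P \<union> Q))" "finite ({c, d} \<union> (Y \<union> (P \<union> Q)))"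
    using finYPQ by auto
  have "deg_in E V x = deg_in E ({u, v} \<union> ({c, d} \<union> (Y \<union> (P \<union> Q)))) x"
    by (rule arg_cong[OF V])
  also have "\<dots> = deg_in E {u, v} x + (deg_in E {c, d} x + (deg_in E Y x + (deg_in E P x + deg_in E Q x)))"
    by (simp only: deg_in_Un[OF f(1,5) dj(4)] deg_in_Un[OF f(2,4) dj(3)] deg_in_Un[OF finYPQ(1) f(3) dj(2)]
      deg_in_Un[OF finYPQ(2,3) dj(1)])
  finally show ?thesis by (simp only: add.assoc)
qed

lemma deg6': "x \<in> V \<Longrightarrow> deg_in E V x = 6" using card_N6[of x] cardN[of x] by (simp only:)

lemma uv_pos: "x \<in> V \<Longrightarrow> x \<noteq> c \<Longrightarrow> x \<noteq> d \<Longrightarrow> 1 \<le> deg_in E {u, v} x"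
  using cover[of x] deg_in_pos[of "{u, v}" _ E x] by auto

text \<open>\<open>y\<close> has two neighbours in \<open>{c, d}\<close> and at least one in
  \<open>{u, v}\<close>, which leaves three for \<open>Y\<close>, \<open>P\<close> and
  \<open>Q\<close>. By \<open>cn_Y\<close> it has at least two in \<open>Y\<close> and
  \<open>P\<close> together, likewise in \<open>Y\<close> and \<open>Q\<close>, and at most one lies
  in \<open>Y\<close>; so each gets exactly one.\<close>

lemma Y_deg: "y \<in> Y \<Longrightarrow> deg_in E P y = 1 \<and> deg_in E Q y = 1"
proof -
  assume y: "y \<in> Y"
  have yE0: "E c y" "E d y" using y inY by blast+
  have yE: "E c y" "E d y" "E y c" "E y d" "y \<in> V" "y \<noteq> c" "y \<noteq> d"
    using yE0 sym[OF yE0(1)] sym[OF yE0(2)] inV(2)[OF yE0(1)] irr[of c] irr[of d] by auto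
  have cd2: "deg_in E {c, d} y = 2" using deg_in_full[of "{c, d}" E y] yE distinct_verts by simp
  have split: "card (cn c y) = 1 + deg_in E Y y + deg_in E P y"
  proof -
    have "deg_in E {d} y = 1" using deg_in_full[of "{d}" E y] yE by simp
    moreover have "deg_in E (N c) y = deg_in E ({d} \<union> (Y \<union> P)) y" using Nc(1) by simp
    moreover have "\<dots> = deg_in E {d} y + deg_in E (Y \<union> P) y" using Nc(2) finYPQ by (intro deg_in_Un) auto
    moreover have "deg_in E (Y \<union> P) y = deg_in E Y y + deg_in E P y" using Nc(3) finYPQ by (intro deg_in_Un) auto
    ultimately show ?thesis by (simp add: deg_in_N)
  qed
  have splitQ: "card (cn d y) = 1 + deg_in E Y y + deg_in E Q y"
  proof -
    have "deg_in E {c} y = 1" using deg_in_full[of "{c}" E y] yE by simp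
    moreover have "deg_in E (N d) y = deg_in E ({c} \<union> (Y \<union> Q)) y" using sw.Nc(1) by (simp add: sw_eq)
    moreover have "\<dots> = deg_in E {c} y + deg_in E (Y \<union> Q) y" using sw.Nc(2) finYPQ by (intro deg_in_Un) (auto simp: sw_eq)
    moreover have "deg_in E (Y \<union> Q) y = deg_in E Y y + deg_in E Q y" using sw.Nc(3) finYPQ by (intro deg_in_Un) (auto simp: sw_eq)
    ultimately show ?thesis by (simp add: deg_in_N)
  qed
  have "deg_in E Y y \<le> 1" using deg_in_le_others[OF finYPQ(1) y] irr Y2 by simp
  then show ?thesis
    using split splitQ cn_Y[OF y] sw.cn_Y[of y] y deg_split[of y] deg6'[OF yE(5)] uv_pos[OF yE(5-7)] cd2
    by (simp add: sw_eq)
qed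

lemma sum_PY: "(\<Sum>p\<in>P. deg_in E Y p) = 2" "(\<Sum>q\<in>Q. deg_in E Y q) = 2"
  using sum_deg_swap[OF G finYPQ(2,1)] sum_deg_swap[OF G finYPQ(3,1)] Y_deg Y2 by simp_all

lemma deg_in_Nd: "q \<in> Q \<Longrightarrow> card (cn d q) = deg_in E Y q + deg_in E Q q"
  using sw.deg_in_Nc[of q] by (simp add: sw_eq)

text \<open>A missing pair makes the count in \<open>P\<close> tight, so all edges from
  \<open>c\<close> to \<open>P\<close> lie in \<open>F\<close>. In \<open>Q\<close> the inner
  degrees are at most 2 and only two edges go to \<open>Y\<close>, so some edge \<open>dq\<close>
  lies in \<open>F\<close> too; by \<open>F_PQ\<close> this \<open>q\<close> sees all of
  \<open>P\<close> and has degree at least 7.\<close>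

lemma P_complete: "p \<in> P \<Longrightarrow> p' \<in> P \<Longrightarrow> p \<noteq> p' \<Longrightarrow> E p p'"
proof (rule ccontr)
  assume p: "p \<in> P" "p' \<in> P" "p \<noteq> p'" and n: "\<not> E p p'"
  have "card (P - {p, p'}) = 1" using p P3 finYPQ by (simp add: card_Diff_subset)
  then obtain p'' where p'': "P - {p, p'} = {p''}" using card_1_singletonE by blast
  have P: "P = {p, p', p''}" "p'' \<noteq> p" "p'' \<noteq> p'" using p p'' by auto
  have s: "deg_in E Y p + (deg_in E Y p' + deg_in E Y p'') = 2" using sum_PY(1) P p(3) by simp
  have le: "deg_in E P p \<le> 1" "deg_in E P p' \<le> 1" "deg_in E P p'' \<le> 2"
  proof -
    have "{y \<in> P. E p y} \<subseteq> {p''}" "{y \<in> P. E p' y} \<subseteq> {p''}" "{y \<in> P. E p'' y} \<subseteq> {p, p'}"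
      using P n irr sym by auto
    then show "deg_in E P p \<le> 1" "deg_in E P p' \<le> 1" "deg_in E P p'' \<le> 2"
      using card_mono[of "{p''}"] card_mono[of "{p, p'}" "{y \<in> P. E p'' y}"] p(3) unfolding deg_in_def by fastforce+
  qed
  have ge: "2 \<le> deg_in E Y z + deg_in E P z" if "z \<in> P" for z using P_ge[OF that] deg_in_Nc[OF that] by simp
  have "deg_in E Y z + deg_in E P z = 2" if "z \<in> P" for z
    using that ge[OF p(1)] ge[OF p(2)] ge[of p''] le s P by auto
  then have Fp: "F c z" if "z \<in> P" for z using that deg_in_Nc[OF that] by (simp add: F_def inP)
  have "\<exists>q\<in>Q. card (cn d q) \<le> 2"
  proof (rule ccontr)
    assume "\<not> ?thesis"
    then have "3 \<le> deg_in E Y q + deg_in E Q q" if "q \<in> Q" for q using that deg_in_Nd[OF that] by fastforce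
    then have "(\<Sum>q\<in>Q. 3) \<le> (\<Sum>q\<in>Q. deg_in E Y q + deg_in E Q q)" by (intro sum_mono) auto
    moreover have "(\<Sum>q\<in>Q. deg_in E Q q) \<le> (\<Sum>q\<in>Q. 2)"
      using deg_in_le_others[OF finYPQ(3)] irr P3 by (intro sum_mono) fastforce
    ultimately show False using sum_PY(2) P3 by (simp add: sum.distrib)
  qed
  then obtain q where q: "q \<in> Q" "card (cn d q) \<le> 2" by blast
  have qE0: "E d q" "\<not> E c q" "q \<noteq> c" using q(1) inQ by blast+
  have qE: "E d q" "E q d" "q \<in> V" "q \<noteq> c" "q \<noteq> d"
    using qE0 sym[OF qE0(1)] inV(2)[OF qE0(1)] irr[of d] by auto
  have c2: "card (cn d q) = 2" using cn2[OF qE(1)] q(2) by simp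
  then have "F d q" using qE by (simp add: F_def)
  then have "\<forall>z\<in>P. E q z" using F_PQ[OF _ q(1) Fp] sym by blast
  then have "deg_in E P q = 3" using deg_in_full[OF finYPQ(2)] P3 by simp
  moreover have "1 \<le> deg_in E {c, d} q" using deg_in_pos[of "{c, d}" d E q] qE by simp
  ultimately show False using deg_split[of q] deg6'[OF qE(3)] uv_pos[OF qE(3-5)] deg_in_Nd[OF q(1)] c2 by simp
qed

end

context adjacent_nonnbrs
begin

interpretation sw: adjacent_nonnbrs V E u v d c by (rule swapped)

text \<open>\<open>P\<close> and \<open>Q\<close> are triangles. The branch sets are
  \<open>{u, v}\<close>, \<open>{c, d, y}\<close>, the single vertices of \<open>P\<close>, and
  \<open>Q\<close> with \<open>y'\<close>; only the contact of \<open>P\<close> with the last one is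
  in doubt.\<close>

lemma contradiction: False
proof -
  have sw_eq: "sw.P = Q" by (auto simp: sw.inP inQ)
  have PP: "deg_in E P p = 2" if "p \<in> P" for p
  proof -
    have "{y \<in> P. E p y} = P - {p}" using P_complete that irr by auto
    then show ?thesis using that P3 finYPQ by (simp add: deg_in_def)
  qed
  have QQ: "deg_in E Q q = 2" if "q \<in> Q" for q
  proof -
    have "{y \<in> Q. E q y} = Q - {q}" using sw.P_complete[unfolded sw_eq] that irr by auto
    then show ?thesis using that P3 finYPQ by (simp add: deg_in_def)
  qed
  have Pb: "p \<in> V" "p \<noteq> c" "p \<noteq> d" "deg_in E {c, d} p = 1" "E p c" if "p \<in> P" for p
  proof -
    have 0: "E c p" "\<not> E d p" "p \<noteq> d" using that inP by blast+
    have 1: "\<not> E p d" using 0(2) sym by blast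
    show "p \<in> V" "p \<noteq> c" "p \<noteq> d" "E p c" using 0 inV(2)[OF 0(1)] irr[of c] sym[OF 0(1)] by auto
    have "{y \<in> {c, d}. E p y} = {c}" using 1 sym[OF 0(1)] by auto
    then show "deg_in E {c, d} p = 1" by (simp add: deg_in_def)
  qed
  have Qb: "q \<in> V" "q \<noteq> c" "q \<noteq> d" "deg_in E {c, d} q = 1" "E d q" if "q \<in> Q" for q
  proof -
    have 0: "E d q" "\<not> E c q" "q \<noteq> c" using that inQ by blast+
    have 1: "\<not> E q c" using 0(2) sym by blast
    show "q \<in> V" "q \<noteq> c" "q \<noteq> d" "E d q" using 0 inV(2)[OF 0(1)] irr[of d] by auto
    have "{y \<in> {c, d}. E q y} = {d}" using 1 sym[OF 0(1)] by auto
    then show "deg_in E {c, d} q = 1" by (simp add: deg_in_def)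
  qed
  have Pd: "deg_in E {u, v} p + deg_in E Y p + deg_in E Q p = 3" if "p \<in> P" for p
    using deg_split[of p] deg6'[OF Pb(1)[OF that]] PP[OF that] Pb(4)[OF that] by simp
  have Qd: "deg_in E {u, v} q + deg_in E Y q + deg_in E P q = 3" if "q \<in> Q" for q
    using deg_split[of q] deg6'[OF Qb(1)[OF that]] QQ[OF that] Qb(4)[OF that] by simp
  have uv2: "deg_in E {u, v} x \<le> 2" for x using deg_in_le_card[of "{u, v}" E x] distinct_verts by simp
  obtain y1 y2 where Y: "Y = {y1, y2}" "y1 \<noteq> y2" using Y2 unfolding card_2_iff by blast
  \<comment> \<open>If both choices fail, there are \<open>p\<close>, \<open>p'\<close> without
    neighbours in \<open>Q\<close> that each miss a vertex of \<open>Y\<close>; degree 6 makes them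
    the two common neighbours of \<open>u\<close> and \<open>v\<close>. Every vertex of
    \<open>Q\<close> then has at most one neighbour in \<open>{u, v}\<close> and at most one in
    \<open>P\<close>, hence one in \<open>Y\<close>; but \<open>sum_PY\<close> allows only two edges
    from \<open>Q\<close> to \<open>Y\<close>.\<close>
  have "\<exists>y y'. Y = {y, y'} \<and> y \<noteq> y' \<and> (\<forall>p\<in>P. \<exists>q\<in>insert y' Q. E p q)"
  proof (rule ccontr)
    assume n: "\<not> ?thesis"
    have "\<exists>p\<in>P. \<forall>q\<in>insert y1 Q. \<not> E p q" "\<exists>p\<in>P. \<forall>q\<in>insert y2 Q. \<not> E p q"
      using n Y by (metis insert_commute)+
    then obtain p p' where p: "p \<in> P" "\<not> E p y1" "\<forall>q\<in>Q. \<not> E p q" "p' \<in> P" "\<not> E p' y2" "\<forall>q\<in>Q. \<not> E p' q" by auto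
    have Y1: "deg_in E Y p \<le> 1" "deg_in E Y p' \<le> 1"
    proof -
      have "{y \<in> Y. E p y} \<subseteq> {y2}" "{y \<in> Y. E p' y} \<subseteq> {y1}" using p Y by auto
      then show "deg_in E Y p \<le> 1" "deg_in E Y p' \<le> 1"
        unfolding deg_in_def using card_mono[of "{y2}" "{y \<in> Y. E p y}"] card_mono[of "{y1}" "{y \<in> Y. E p' y}"] by simp_all
    qed
    have Q0: "deg_in E Q p = 0" "deg_in E Q p' = 0" using p finYPQ by (simp_all add: deg_in_eq_0)
    have uvp: "deg_in E {u, v} p = 2" "deg_in E {u, v} p' = 2" "deg_in E Y p = 1" "deg_in E Y p' = 1"
      using Pd[OF p(1)] Pd[OF p(4)] Y1 Q0 uv2[of p] uv2[of p'] by linarith+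
    have "p \<noteq> p'"
    proof
      assume "p = p'"
      then have "deg_in E Y p = 0" using p Y finYPQ by (simp add: deg_in_eq_0)
      then show False using uvp by simp
    qed
    have W: "E x u \<and> E x v" if "deg_in E {u, v} x = 2" for x
    proof -
      have "{y \<in> {u, v}. E x y} = {u, v}"
        using that distinct_verts by (intro card_subset_eq) (auto simp: deg_in_def)
      then show ?thesis by blast
    qed
    have inW: "x \<in> cn u v" if "deg_in E {u, v} x = 2" for x using W[OF that] sym by (auto simp: incn)
    have "cn u v = {p, p'}"
    proof (rule card_subset_eq[symmetric, OF finN(3)])
      show "{p, p'} \<subseteq> cn u v" using inW uvp by auto
      show "card {p, p'} = card (cn u v)" using uv \<open>p \<noteq> p'\<close> by (simp add: F_def)
    qed
    then have Quv: "deg_in E {u, v} q \<le> 1" if "q \<in> Q" for q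
      using inW[of q] uv2[of q] that p(1,4) by (fastforce simp: inP inQ)
    have "card (P - {p, p'}) = 1" using p(1,4) \<open>p \<noteq> p'\<close> P3 finYPQ by (simp add: card_Diff_subset)
    then obtain p'' where p'': "P - {p, p'} = {p''}" using card_1_singletonE by blast
    have QP: "deg_in E P q \<le> 1" if "q \<in> Q" for q
    proof -
      have "{y \<in> P. E q y} \<subseteq> {p''}"
      proof
        fix y assume y: "y \<in> {y \<in> P. E q y}"
        then have "y \<noteq> p" "y \<noteq> p'" using p(3,6) that sym by blast+
        then show "y \<in> {p''}" using y p'' by blast
      qed
      then show ?thesis unfolding deg_in_def using card_mono[of "{p''}" "{y \<in> P. E q y}"] by simp
    qed
    have "1 \<le> deg_in E Y q" if "q \<in> Q" for q using Qd[OF that] Quv[OF that] QP[OF that] by linarith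
    then have "(\<Sum>q\<in>Q. 1) \<le> (\<Sum>q\<in>Q. deg_in E Y q)" by (intro sum_mono) auto
    then show False using sum_PY(2) P3 by simp
  qed
  then obtain y y' where yy: "Y = {y, y'}" "y \<noteq> y'" "\<forall>p\<in>P. \<exists>q\<in>insert y' Q. E p q" by (elim exE conjE)
  have yE: "E c y" "E d y" "E y c" "E y d" "y \<in> V" "y' \<in> V" "y \<noteq> c" "y \<noteq> d" "y' \<noteq> c" "y' \<noteq> d" "E d y'"
    "y \<notin> P" "y \<notin> Q" "y' \<notin> P" "y' \<notin> Q"
  proof -
    have "y \<in> Y" "y' \<in> Y" using yy(1) by simp_all
    then have 0: "E c y" "E d y" "E c y'" "E d y'" using inY by blast+
    show "E c y" "E d y" "E y c" "E y d" "y \<in> V" "y' \<in> V" "y \<noteq> c" "y \<noteq> d" "y' \<noteq> c" "y' \<noteq> d" "E d y'"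
      "y \<notin> P" "y \<notin> Q" "y' \<notin> P" "y' \<notin> Q"
      using 0 sym[OF 0(1)] sym[OF 0(2)] inV(2)[OF 0(1)] inV(2)[OF 0(3)] irr[of c] irr[of d] inP inQ by auto
  qed
  obtain p1 p2 p3 where P: "P = {p1, p2, p3}" "p1 \<noteq> p2" "p1 \<noteq> p3" "p2 \<noteq> p3" using P3(1) by (metis card_3_iff)
  have Pm: "p1 \<in> P" "p2 \<in> P" "p3 \<in> P" using P by auto
  have uvR: "E u x \<or> E v x" if "x \<in> V" "x \<noteq> c" "x \<noteq> d" for x using cover[OF that] sym by blast
  obtain q where q: "q \<in> Q" using P3(2) by fastforce
  have connQ: "conn E Q"
  proof -
    have "E q z \<and> E z q" if "z \<in> Q - {q}" for z using sw.P_complete[unfolded sw_eq, OF q, of z] that sym by auto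
    then have "conn E (insert q (Q - {q}))" by (rule conn_star)
    then show ?thesis using q by (simp add: insert_absorb)
  qed
  have "deg_in E Q y' = 1" using Y_deg yy by auto
  then obtain q' where q': "q' \<in> Q" "E y' q'" using deg_in_eq_0[OF finYPQ(3), of E y'] by auto
  have connQ': "conn E (insert y' Q)" by (rule conn_insert[OF connQ q']) (use q' sym in blast)
  have conn3: "conn E {c, d, y}"
  proof -
    have "conn E {d, y}" by (rule conn_pair[OF G yE(2)])
    then show ?thesis by (rule conn_insert[of E _ d]) (use cd dc in auto)
  qed
  have t: "touch E {u, v} {x}" if "x \<in> P" for x using uvR[OF Pb(1-3)[OF that]] by (auto simp: touch_def)
  have t1: "touch E {c, d, y} {x}" if "x \<in> P" for x using Pb(5)[OF that] sym by (auto simp: touch_def)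
  have t2: "touch E {x} (insert y' Q)" if "x \<in> P" for x using yy(3) that by (auto simp: touch_def)
  have t3: "touch E {u, v} {c, d, y}" using uvR[OF yE(5,7,8)] by (auto simp: touch_def)
  have t4: "touch E {u, v} (insert y' Q)" using uvR[OF yE(6,9,10)] by (auto simp: touch_def)
  have t5: "touch E {c, d, y} (insert y' Q)" using yE by (auto simp: touch_def)
  have PE: "E p1 p2" "E p1 p3" "E p2 p3" using P_complete Pm P by auto
  have uvn: "u \<notin> P" "v \<notin> P" "u \<notin> Q" "v \<notin> Q" "u \<noteq> y" "v \<noteq> y" "u \<noteq> y'" "v \<noteq> y'"
    using non' yE(1,2,11) by (auto simp: inP inQ)
  have cdn: "c \<notin> P" "d \<notin> P" "c \<notin> Q" "d \<notin> Q" using irr by (auto simp: inP inQ)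
  have PQ: "P \<inter> Q = {}" by (auto simp: inP inQ)
  have "clique_minor V E 6"
  proof (rule clique_minorI[where Bs = "[{u, v}, {c, d, y}, {p1}, {p2}, {p3}, insert y' Q]"])
    have "insert y' Q \<subseteq> V" using yE(6) Qb(1) by auto
    then show "\<forall>S\<in>set [{u, v}, {c, d, y}, {p1}, {p2}, {p3}, insert y' Q]. S \<subseteq> V \<and> conn E S"
      using verts yE(5) Pb(1) Pm conn3 connQ' conn_singleton[of E] conn_pair[OF G Euv(1)] by simp
    have pn: "\<And>p. p \<in> P \<Longrightarrow> p \<noteq> u \<and> p \<noteq> v \<and> p \<noteq> c \<and> p \<noteq> d \<and> p \<noteq> y \<and> p \<noteq> y' \<and> p \<notin> Q"
      using uvn cdn yE PQ by blast
    have "{u, v} \<inter> {c, d, y} = {}" "{c, d, y} \<inter> insert y' Q = {}" "{u, v} \<inter> insert y' Q = {}"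
      using distinct_verts uvn cdn yE yy(2) by auto
    moreover have "{u, v} \<inter> {p} = {} \<and> {c, d, y} \<inter> {p} = {} \<and> {p} \<inter> insert y' Q = {}" if "p \<in> P" for p
      using pn[OF that] by auto
    ultimately show "sorted_wrt (\<lambda>S T. S \<inter> T = {} \<and> touch E S T) [{u, v}, {c, d, y}, {p1}, {p2}, {p3}, insert y' Q]"
      using t[OF Pm(1)] t[OF Pm(2)] t[OF Pm(3)] t1[OF Pm(1)] t1[OF Pm(2)] t1[OF Pm(3)]
        t2[OF Pm(1)] t2[OF Pm(2)] t2[OF Pm(3)] t3 t4 t5 PE P(2-4) Pm
      by (simp only: sorted_wrt.simps list.set ball_simps) (auto simp: touch_def)
  qed simp
  then show False using free by simp
qed

end

context regular_counterexample
begin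

lemma regular_contradiction: False
proof -
  have H: "\<not> E a b" if "F u v" "\<not> E u a" "\<not> E v a" "\<not> E u b" "\<not> E v b" for u v a b
  proof
    assume "E a b"
    then interpret adjacent_nonnbrs V E u v a b by unfold_locales (use that in auto)
    show False by (rule contradiction)
  qed
  obtain c where c: "c \<in> V" using nV by fastforce
  have "0 < card {x. F c x}" using card_F_ge[OF c] degsum_N16[OF c] by linarith
  then obtain x where x: "F c x" by (auto simp: card_gt_0_iff)
  show False
  proof (rule F_nonnbrs_nonadjacent_case[OF _ x])
    show "\<not> E a b" if "F u v" "\<not> E u a" "\<not> E v a" "\<not> E u b" "\<not> E v b" for u v a b by (rule H[OF that])
  qed
qed

end

section \<open>Degree excess 4\<close>

context counterexample
begin

lemma inZ: "z \<in> Z \<longleftrightarrow> z \<in> V \<and> 7 \<le> deg_in E V z"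
  using deg6 by (auto simp: Z_def L_def) (metis Suc_leI le_neq_implies_less numeral_eq_Suc pred_numeral_simps(3))

lemma Z_indep: "z \<in> Z \<Longrightarrow> z' \<in> Z \<Longrightarrow> \<not> E z z'"
  using minimal by (fastforce simp: inZ)

lemma LZ: "L \<subseteq> V" "Z \<subseteq> V" "L \<inter> Z = {}" "L \<union> Z = V" "finite L" "finite Z"
  using fin by (auto simp: Z_def L_def)

lemma exc_ge: "z \<in> S \<Longrightarrow> finite S \<Longrightarrow> deg_in E V z - 6 \<le> exc S"
  unfolding exc_def by (rule member_le_sum) auto

lemma exc_Z: "S \<subseteq> V \<Longrightarrow> exc S = exc (S \<inter> Z)"
proof -
  assume S: "S \<subseteq> V"
  have f: "finite S" using S fin finite_subset by blast
  have "exc S = (\<Sum>x\<in>S \<inter> Z. deg_in E V x - 6)"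
    unfolding exc_def by (rule sum.mono_neutral_right[OF f]) (use S in \<open>auto simp: Z_def L_def\<close>)
  then show ?thesis by (simp add: exc_def)
qed

lemma subV: "N v \<subseteq> V" "B v \<subseteq> V" by (auto simp: N_def B_def)

lemma deg_in_V_L: "z \<in> Z \<Longrightarrow> deg_in E L z = deg_in E V z"
proof -
  assume z: "z \<in> Z"
  have "{y \<in> L. E z y} = {y \<in> V. E z y}" using Z_indep[OF z] LZ by blast
  then show ?thesis by (simp add: deg_in_def)
qed

text \<open>Every edge has at least three common neighbours, so \<open>degsum E (N v)\<close> is at
  least 18, which puts at least 3 of the excess 4 into \<open>N v\<close>. This excludes degrees
  above 7, and four independent vertices of degree 7 send 28 edges to eight vertices that can take
  at most three each.\<close>

lemma exc4_contradiction:
  assumes e4: "exc V = 4"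
  shows False
proof -
  have cn3: "3 \<le> card (cn x y)" if "E x y" for x y using cn_gt[OF that] e4 by simp
  have excN: "3 \<le> exc (N v)" "exc (B v) \<le> 1" if v: "v \<in> L" for v
  proof -
    have "3 * card (N v) \<le> (\<Sum>x\<in>N v. card (cn v x))"
      using sum_mono[of "N v" "\<lambda>_. 3" "\<lambda>x. card (cn v x)"] cn3 by (simp add: inN mult.commute)
    then have "18 \<le> degsum E (N v)" using v by (simp add: L_card degsum_N)
    then show "3 \<le> exc (N v)" "exc (B v) \<le> 1" using degsum_N_le[OF v] exc_split[OF v] e4 by linarith+
  qed
  have d7: "deg_in E V z = 7" if z: "z \<in> Z" for z
  proof (rule ccontr)
    assume n: "deg_in E V z \<noteq> 7"
    then have d8: "8 \<le> deg_in E V z" using z by (simp add: inZ)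
    \<comment> \<open>In \<open>B v\<close> the vertex \<open>z\<close> would bring excess 2. So
      \<open>z\<close> is adjacent to all of \<open>L\<close>, and the total excess is at least
      \<open>(card L - 6) + (card Z - 1)\<close>, which is 5.\<close>
    have "E z v" if v: "v \<in> L" for v
    proof (rule ccontr)
      assume "\<not> E z v"
      then have "z \<in> B v" using v z sym LZ(3) by (auto simp: inB inZ)
      then have "deg_in E V z - 6 \<le> exc (B v)" by (rule exc_ge) (rule finN)
      then show False using excN(2)[OF v] d8 by linarith
    qed
    then have "{y \<in> L. E z y} = L" by blast
    then have cL: "card L = deg_in E V z" using deg_in_V_L[OF z] by (simp add: deg_in_def)
    have "card L + card Z = 12" using card_Un_disjoint[OF LZ(5,6,3)] LZ(4) nV by simp
    moreover have "exc V = (deg_in E V z - 6) + exc (Z - {z})"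
      using exc_Z[of V] LZ(2,6) z by (simp add: Int_absorb1 exc_def sum.remove)
    moreover have "card (Z - {z}) \<le> exc (Z - {z})"
    proof -
      have "(\<Sum>x\<in>Z - {z}. 1) \<le> (\<Sum>x\<in>Z - {z}. deg_in E V x - 6)" by (intro sum_mono) (auto simp: inZ)
      then show ?thesis by (simp add: exc_def)
    qed
    moreover have "card (Z - {z}) = card Z - 1" using z LZ(6) by simp
    moreover have "card L \<le> 11"
    proof -
      have "0 < card Z" using z LZ(6) by (auto simp: card_gt_0_iff)
      then show ?thesis using calculation(1) by linarith
    qed
    ultimately show False using cL d8 e4 by linarith
  qed
  have cZ: "card (S \<inter> Z) = exc S" if "S \<subseteq> V" for S
  proof -
    have "exc (S \<inter> Z) = (\<Sum>x\<in>S \<inter> Z. 1)" unfolding exc_def by (rule sum.cong) (auto simp: d7)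
    then show ?thesis using exc_Z[OF that] by simp
  qed
  have Z4: "card Z = 4" using cZ[of V] e4 LZ(2) by (simp add: Int_absorb1)
  then have L8: "card L = 8" using card_Un_disjoint[OF LZ(5,6,3)] LZ(4) nV by simp
  \<comment> \<open>For an edge \<open>vz\<close> into \<open>Z\<close>, the at least three common
    neighbours lie in \<open>L\<close> because \<open>Z\<close> is independent; that leaves three of
    the six neighbours of \<open>v\<close> for \<open>Z\<close>.\<close>
  have "deg_in E Z v \<le> 3" if v: "v \<in> L" for v
  proof -
    have "N v \<inter> Z \<noteq> {}" using cZ[OF subV(1), of v] excN(1)[OF v] by auto
    then obtain z where z: "z \<in> Z" "E v z" by (auto simp: inN)
    have "cn v z \<subseteq> N v \<inter> L"
    proof
      fix x assume "x \<in> cn v z"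
      then have x: "E v x" "E z x" by (simp_all add: incn)
      have "x \<in> V" using inV(2)[OF x(1)] .
      moreover have "x \<notin> Z" using Z_indep[OF z(1), of x] x(2) by blast
      ultimately show "x \<in> N v \<inter> L" using x(1) LZ(4) by (auto simp: inN)
    qed
    then have "card (cn v z) \<le> card (N v \<inter> L)" using finN by (intro card_mono) auto
    moreover have "card (N v \<inter> L) + card (N v \<inter> Z) = card (N v)"
    proof -
      have "N v = (N v \<inter> L) \<union> (N v \<inter> Z)" using subV(1)[of v] LZ(4) by blast
      moreover have "card ((N v \<inter> L) \<union> (N v \<inter> Z)) = card (N v \<inter> L) + card (N v \<inter> Z)"
        using finN LZ(3) by (intro card_Un_disjoint) auto
      ultimately show ?thesis by simp
    qed
    ultimately have "card (N v \<inter> Z) \<le> 3" using cn3[OF z(2)] v by (simp add: L_card)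
    moreover have "{y \<in> Z. E v y} = N v \<inter> Z" by (auto simp: inN)
    ultimately show ?thesis by (simp add: deg_in_def)
  qed
  then have "(\<Sum>v\<in>L. deg_in E Z v) \<le> (\<Sum>v\<in>L. 3)" by (intro sum_mono)
  moreover have "(\<Sum>z\<in>Z. deg_in E L z) = (\<Sum>z\<in>Z. 7)" by (intro sum.cong refl) (simp add: deg_in_V_L d7)
  ultimately show False using sum_deg_swap[OF G LZ(5,6)] Z4 L8 by simp
qed

end

section \<open>Degree excess 2\<close>

locale excess2 = counterexample +
  assumes e2: "exc V = 2"
begin

text \<open>By \<open>T_Z\<close> and \<open>Z_T\<close>, the vertices of degree 6 that are adjacent
  to every vertex of larger degree.\<close>

definition T where "T = {w \<in> L. exc (N w) = 2}"

lemma cn2: "E x y \<Longrightarrow> 2 \<le> card (cn x y)" using cn_gt[of x y] e2 by simp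

lemma T_Z: "w \<in> T \<Longrightarrow> z \<in> Z \<Longrightarrow> E w z"
proof (rule ccontr)
  assume w: "w \<in> T" and z: "z \<in> Z" and n: "\<not> E w z"
  have "exc (B w) = 0" using exc_split[of w] w e2 by (simp add: T_def)
  moreover have "z \<in> B w" using w z n LZ(3) by (auto simp: inB T_def inZ)
  then have "deg_in E V z - 6 \<le> exc (B w)" by (rule exc_ge) (rule finN)
  ultimately show False using z by (simp add: inZ)
qed

lemma Z_T: "v \<in> L \<Longrightarrow> (\<And>z. z \<in> Z \<Longrightarrow> E v z) \<Longrightarrow> v \<in> T"
proof -
  assume v: "v \<in> L" and a: "\<And>z. z \<in> Z \<Longrightarrow> E v z"
  have "N v \<inter> Z = V \<inter> Z" using a LZ(2) subV(1) by (auto simp: inN)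
  then show ?thesis using v exc_Z[OF subV(1)] exc_Z[of V] e2 by (simp add: T_def)
qed

text \<open>Contracting \<open>vx\<close> is critical, so \<open>degsum E (N w)\<close> is at least
  18, while \<open>degsum_N_le\<close> allows at most \<open>16 + exc (N w) - exc (B w)\<close>.
  Equality puts the whole excess into \<open>N w\<close> and leaves no room for a common neighbour
  of \<open>v\<close> and \<open>x\<close> there.\<close>

lemma two_common:
  assumes "E v x" "card (cn v x) = 2" "w \<in> cn v x" "w \<in> L"
  shows "w \<in> T" "N w \<inter> cn v x = {}"
proof -
  have c: "2 * card (cn v x) \<le> exc V + 2" using assms(2) e2 by simp
  note * = critical_contr(2)[OF assms(1) c assms(3,4)]
  have "N w \<inter> cn v x = {y \<in> N w. y \<in> cn v x}" by auto
  moreover have "card {y \<in> N w. y \<in> cn v x} = 0" "exc (N w) = 2"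
    using * degsum_N_le[OF assms(4)] exc_split[OF assms(4)] e2 by linarith+
  ultimately show "w \<in> T" "N w \<inter> cn v x = {}" using finN assms(4) by (auto simp: T_def)
qed

text \<open>A common neighbour outside \<open>T\<close> lies in \<open>Z\<close>. If the other one
  has degree 6, it is in \<open>T\<close> and adjacent to the first, against
  \<open>two_common\<close>; if it is in \<open>Z\<close> too, both bring excess 2 into
  \<open>N v\<close> and \<open>v\<close> is in \<open>T\<close>.\<close>

lemma two_common_sub_T:
  assumes v: "v \<in> L" "v \<notin> T" and x: "E v x" "card (cn v x) = 2"
  shows "cn v x \<subseteq> T"
proof
  fix z assume z: "z \<in> cn v x"
  show "z \<in> T"
  proof (rule ccontr)
    assume nT: "z \<notin> T"
    have "z \<in> V" using z by (simp add: cn_def)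
    then have zZ: "z \<in> Z" using two_common(1)[OF x z] nT LZ(4) by blast
    have "card (cn v x - {z}) = 1" using x(2) z finN by simp
    then obtain w where w: "cn v x - {z} = {w}" using card_1_singletonE by blast
    then have wc: "w \<in> cn v x" "w \<noteq> z" by auto
    then have wV: "w \<in> V" by (simp add: cn_def)
    show False
    proof (cases "w \<in> L")
      case True
      from two_common[OF x wc(1) True] have "E w z" "z \<notin> N w" using T_Z zZ z by auto
      then show False by (simp add: inN)
    next
      case False
      then have wZ: "w \<in> Z" using wV LZ(4) by blast
      have "{z, w} \<subseteq> N v" using z wc by (auto simp: incn inN)
      then have "exc {z, w} \<le> exc (N v)" unfolding exc_def by (intro sum_mono2[OF finN(1)]) auto
      moreover have "exc {z, w} = (deg_in E V z - 6) + (deg_in E V w - 6)" using wc(2) by (auto simp: exc_def)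
      then have "2 \<le> exc {z, w}" using zZ wZ inZ[of z] inZ[of w] by linarith
      ultimately have "exc (N v) = 2" using exc_split[OF v(1)] e2 by linarith
      then show False using v by (simp add: T_def)
    qed
  qed
qed

definition tw where "tw v = {x \<in> N v. card (cn v x) = 2}"

lemma card_tw:
  assumes "v \<in> L"
  shows "18 \<le> card (tw v) + degsum E (N v)" "degsum E (N v) + exc (B v) \<le> 16 + exc (N v)"
    "exc (N v) + exc (B v) = 2"
  using count_two[OF assms cn2] degsum_N_le[OF assms] exc_split[OF assms] e2 by (simp_all add: tw_def)

lemma tw_finite: "finite (tw v)" "tw v \<subseteq> N v" using finN by (auto simp: tw_def)

lemma card_non_tw: "v \<in> L \<Longrightarrow> card (N v - tw v) = 6 - card (tw v)"
  using tw_finite by (simp add: card_Diff_subset L_card)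

text \<open>For \<open>h\<close> in \<open>tw v\<close> all common neighbours of \<open>v\<close>
  and \<open>h\<close> are in \<open>T\<close>, and \<open>g\<close> would be one of them.\<close>

lemma cn_non_tw:
  assumes v: "v \<in> L" "v \<notin> T" and g: "E v g" "g \<notin> T"
  shows "cn v g \<subseteq> N v - tw v"
proof
  fix h assume h: "h \<in> cn v g"
  have "h \<notin> tw v"
  proof
    assume "h \<in> tw v"
    then have "E v h" "card (cn v h) = 2" by (auto simp: tw_def inN)
    from two_common_sub_T[OF v this] have sub: "cn v h \<subseteq> T" .
    have "E g h" using h by (simp add: incn)
    then have "g \<in> cn v h" using g(1) sym[OF \<open>E g h\<close>] by (simp add: incn)
    then show False using sub g(2) by blast
  qed
  then show "h \<in> N v - tw v" using h by (auto simp: incn inN)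
qed

lemma Z_cases: "(\<exists>z. Z = {z} \<and> deg_in E V z = 8) \<or> (\<exists>z z'. Z = {z, z'} \<and> z \<noteq> z' \<and> deg_in E V z = 7 \<and> deg_in E V z' = 7)"
proof -
  have s: "(\<Sum>z\<in>Z. deg_in E V z - 6) = 2" using exc_Z[of V] LZ(2) e2 by (simp add: Int_absorb1 exc_def)
  have ge: "1 \<le> deg_in E V z - 6" if "z \<in> Z" for z using that inZ[of z] by linarith
  have "(\<Sum>z\<in>Z. 1) \<le> (\<Sum>z\<in>Z. deg_in E V z - 6)" by (intro sum_mono ge)
  then have "card Z \<le> 2" using s by simp
  moreover have "card Z \<noteq> 0" using s LZ(6) by auto
  ultimately have "card Z = 1 \<or> card Z = 2" by linarith
  then show ?thesis
  proof
    assume "card Z = 1"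
    then obtain z where "Z = {z}" using card_1_singletonE by blast
    then show ?thesis using s by auto
  next
    assume "card Z = 2"
    then obtain z z' where z: "Z = {z, z'}" "z \<noteq> z'" unfolding card_2_iff by blast
    then have "deg_in E V z - 6 + (deg_in E V z' - 6) = 2" using s by simp
    then show ?thesis using z ge[of z] ge[of z'] by (intro disjI2 exI[of _ z] exI[of _ z']) auto
  qed
qed

lemma exc_N_0: "v \<in> V \<Longrightarrow> N v \<inter> Z = {} \<longleftrightarrow> exc (N v) = 0"
proof -
  have "exc (N v) = (\<Sum>z\<in>N v \<inter> Z. deg_in E V z - 6)" using exc_Z[OF subV(1)] by (simp add: exc_def)
  moreover have "deg_in E V z - 6 \<noteq> 0" if "z \<in> N v \<inter> Z" for z using that inZ[of z] by auto
  moreover have "finite (N v \<inter> Z)" using finN by simp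
  ultimately show ?thesis by (auto simp: sum_eq_0_iff)
qed

lemma T_L: "T \<subseteq> L" by (auto simp: T_def)

lemma not_T_exc: "v \<in> L \<Longrightarrow> v \<notin> T \<Longrightarrow> exc (N v) \<le> 1"
  using exc_split[of v] e2 by (auto simp: T_def)

text \<open>Without excess in \<open>N v\<close> the degree sum there is at most 14, so at least
  four edges at \<open>v\<close> have just two common neighbours. The common neighbours of
  \<open>v\<close> and \<open>u\<close> are among the at most two remaining vertices, so they are
  exactly these and all counts are tight.\<close>

lemma nonadjacent_Z_common:
  assumes v: "v \<in> L" "v \<notin> T" "exc (N v) = 0" and u: "E v u" "u \<notin> T"
  shows "card (cn v u) = 2" "\<And>g. g \<in> cn v u \<Longrightarrow> card (cn v g) = 3"
proof -
  have f: "finite (N v - tw v)" "finite (cn v u)" using finN by auto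
  have sub: "cn v u \<subseteq> N v - tw v" by (rule cn_non_tw[OF v(1,2) u])
  then have "card (cn v u) \<le> card (N v - tw v)" by (rule card_mono[OF f(1)])
  then have c: "card (cn v u) \<le> 6 - card (tw v)" by (simp add: card_non_tw[OF v(1)])
  have k: "18 \<le> card (tw v) + degsum E (N v)" "degsum E (N v) \<le> 14"
    using card_tw[OF v(1)] v(3) by linarith+
  then show 2: "card (cn v u) = 2" using c cn2[OF u(1)] by linarith
  then have tw4: "card (tw v) = 4" and d14: "degsum E (N v) = 14" using c k by linarith+
  have eq: "cn v u = N v - tw v"
    by (rule card_subset_eq[OF f(1) sub]) (simp add: 2 card_non_tw[OF v(1)] tw4)
  have "degsum E (N v) = (\<Sum>x\<in>N v - tw v. card (cn v x)) + (\<Sum>x\<in>tw v. card (cn v x))"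
    unfolding degsum_N by (rule sum.subset_diff[OF tw_finite(2) finN(1)])
  moreover have "(\<Sum>x\<in>tw v. card (cn v x)) = 8" using tw4 by (simp add: tw_def)
  ultimately have s: "(\<Sum>x\<in>cn v u. card (cn v x)) = 6" using d14 by (simp add: eq)
  have ge: "3 \<le> card (cn v g)" if "g \<in> cn v u" for g
  proof -
    have "g \<in> N v" "g \<notin> tw v" using that sub by blast+
    then show ?thesis using cn2[of v g] by (auto simp: tw_def inN)
  qed
  show "card (cn v g) = 3" if g: "g \<in> cn v u" for g
  proof -
    have "card (cn v u - {g}) = 1" using g 2 f by simp
    then obtain h where h: "cn v u - {g} = {h}" using card_1_singletonE by blast
    have "(\<Sum>x\<in>cn v u. card (cn v x)) = card (cn v g) + card (cn v h)"
      using sum.remove[OF f(2) g, of "\<lambda>x. card (cn v x)"] by (simp add: h)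
    moreover have "h \<in> cn v u" using h by blast
    ultimately show ?thesis using s ge[OF g] ge[of h] by linarith
  qed
qed

text \<open>A common neighbour \<open>g\<close> of an edge \<open>ab\<close> is in \<open>T\<close>,
  so \<open>a\<close>, \<open>b\<close> and \<open>z\<close> take three of its six neighbours. By
  tightness \<open>a\<close> and \<open>g\<close> have two common neighbours besides
  \<open>b\<close>, and \<open>b\<close> and \<open>g\<close> two besides \<open>a\<close>; these
  four are distinct, but three places remain.\<close>

lemma nonadjacent_Z_independent:
  assumes a: "a \<in> L" "a \<notin> T" "exc (N a) = 0" and b: "b \<in> L" "b \<notin> T" "exc (N b) = 0"
    and z: "z \<in> Z"
  shows "\<not> E a b"
proof
  assume ab: "E a b"
  have ba: "E b a" by (rule sym[OF ab])
  note A = nonadjacent_Z_common[OF a ab b(2)]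
  note B = nonadjacent_Z_common[OF b ba a(2)]
  obtain g where g: "g \<in> cn a b" using A(1) by fastforce
  then have gb: "g \<in> cn b a" by (simp add: cn_commute)
  have gT: "g \<in> T" using two_common_sub_T[OF a(1,2) ab A(1)] g by blast
  then have gL: "g \<in> L" using T_L by blast
  have dis: "N g \<inter> cn a b = {}" by (rule two_common(2)[OF ab A(1) g gL])
  have Eg: "E g a" "E g b" "E a g" "E b g" "E g z"
    using g sym[of a g] sym[of b g] T_Z[OF gT z] by (auto simp: incn)
  have "N a \<inter> Z = {}" "N b \<inter> Z = {}" using exc_N_0[of a] exc_N_0[of b] a b LZ(1) by blast+
  then have az: "\<not> E a z" "\<not> E b z" using z inN[of z a] inN[of z b] by blast+
  have ne: "a \<noteq> b" "a \<noteq> z" "b \<noteq> z" using ab irr a b z LZ(3) by auto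
  define X where "X = N g - {a, b, z}"
  have "card X = card (N g) - card {a, b, z}" unfolding X_def
    by (rule card_Diff_subset) (use Eg in \<open>auto simp: inN\<close>)
  then have X3: "card X = 3" using gL ne by (simp add: L_card)
  have "card (cn a g - {b}) = 2" "card (cn b g - {a}) = 2"
    using A(2)[OF g] B(2)[OF gb] ab ba Eg finN by (simp_all add: incn)
  moreover have "(cn a g - {b}) \<inter> (cn b g - {a}) = {}" using dis by (auto simp: incn inN)
  ultimately have "card ((cn a g - {b}) \<union> (cn b g - {a})) = 4"
    using finN by (simp add: card_Un_disjoint)
  moreover have "card ((cn a g - {b}) \<union> (cn b g - {a})) \<le> card X"
    using finN az irr by (intro card_mono) (auto simp: X_def incn inN)
  ultimately show False using X3 by simp
qed

text \<open>Here \<open>T\<close> is the neighbourhood of \<open>z\<close>, and the three vertices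
  of \<open>S\<close> are independent with all neighbours in \<open>T\<close>; \<open>M n\<close>
  holds the two vertices of \<open>T\<close> that \<open>n\<close> misses. A tight count makes these
  sets disjoint, so only two vertices of \<open>T\<close> see all of \<open>S\<close>, and such a
  vertex cannot reach degree 6.\<close>

lemma one_excess_vertex_contradiction:
  assumes Z: "Z = {z}" and d8: "deg_in E V z = 8"
  shows False
proof -
  have zV: "z \<in> V" "z \<notin> L" using LZ Z by auto
  have Vz: "V = insert z L" using LZ(4) Z by simp
  have TN: "T = N z"
  proof
    show "T \<subseteq> N z" using T_Z[of _ z] sym Z by (auto simp: inN)
    show "N z \<subseteq> T"
    proof
      fix w assume "w \<in> N z"
      then have w: "E z w" by (simp add: inN)
      then have "w \<in> L" using inV(2)[OF w] irr[of z] Vz by auto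
      then show "w \<in> T" using Z_T[of w] sym[OF w] Z by auto
    qed
  qed
  have T8: "card T = 8" using TN cardN d8 by simp
  have fT: "finite T" using TN finN by simp
  have L11: "card L = 11" using arg_cong[OF Vz, of card] card_insert_disjoint[OF LZ(5) zV(2)] nV by linarith
  define S where "S = L - T"
  have S3: "card S = 3" unfolding S_def using T_L T8 L11 fT by (simp add: card_Diff_subset)
  have fS: "finite S" using LZ(5) by (simp add: S_def)
  have VS: "x \<in> V \<longleftrightarrow> x = z \<or> x \<in> S \<or> x \<in> T" for x using Vz T_L by (auto simp: S_def)
  have zST: "z \<notin> S" "z \<notin> T" "S \<inter> T = {}" using zV(2) T_L by (auto simp: S_def)
  have nz: "\<not> E n z" "\<not> E z n" if n: "n \<in> S" for n
  proof -
    show "\<not> E z n" using n TN inN by (auto simp: S_def)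
    then show "\<not> E n z" using sym by blast
  qed
  have Sprops: "n \<in> L" "n \<notin> T" "exc (N n) = 0" if n: "n \<in> S" for n
  proof -
    show nL: "n \<in> L" "n \<notin> T" using n by (auto simp: S_def)
    have "N n \<inter> Z = {}" using nz(1)[OF n] Z by (auto simp: inN)
    then show "exc (N n) = 0" using exc_N_0[of n] nL(1) LZ(1) by blast
  qed
  have indep: "\<not> E a b" if "a \<in> S" "b \<in> S" for a b
    using nonadjacent_Z_independent[OF Sprops[OF that(1)] Sprops[OF that(2)], of z] Z by simp
  have NT: "N n \<subseteq> T" if n: "n \<in> S" for n
  proof
    fix x assume "x \<in> N n"
    then have x: "E n x" by (simp add: inN)
    then show "x \<in> T" using VS[of x] inV(2)[OF x] nz(1)[OF n] indep[OF n, of x] by auto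
  qed
  define M where "M = (\<lambda>n. T - N n)"
  have M2: "card (M n) = 2" if n: "n \<in> S" for n
    unfolding M_def using NT[OF n] Sprops(1)[OF n] T8 finN by (simp add: card_Diff_subset L_card)
  have fM: "finite (M n)" for n using fT by (simp add: M_def)
  \<comment> \<open>\<open>B n\<close> consists of \<open>z\<close>, two vertices of
    \<open>S\<close> and \<open>M n\<close>, with degree sum at most 2 + 4 + 8. That of
    \<open>N n\<close> is at least 12 and smaller by 2, so equality holds throughout.\<close>
  have key: "(\<forall>x. E n x \<longrightarrow> card (cn n x) = 2) \<and> (\<forall>a\<in>S - {n}. M n \<subseteq> N a)" if n: "n \<in> S" for n
  proof -
    have Bn: "B n = insert z ((S - {n}) \<union> M n)"
      using VS nz(1)[OF n] indep[OF n] zST n by (auto simp: inB M_def inN)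
    have dsum: "degsum E (B n) = degsum E (N n) + 2"
      using degsum_N_B[OF Sprops(1)[OF n]] card_tw(3)[OF Sprops(1)[OF n]] Sprops(3)[OF n] by linarith
    have B5: "card (B n) = 5" by (rule cardB[OF Sprops(1)[OF n]])
    have dz: "deg_in E (B n) z \<le> 2"
    proof -
      have "{y \<in> B n. E z y} \<subseteq> M n" using nz(2) irr by (auto simp: Bn)
      then show ?thesis using card_mono[OF fM, of _ n] M2[OF n] by (auto simp: deg_in_def)
    qed
    have subM: "{y \<in> B n. E a y} \<subseteq> M n" if a: "a \<in> S - {n}" for a
      using nz(1)[of a] indep[of a] a by (auto simp: Bn)
    have da: "deg_in E (B n) a \<le> 2" if a: "a \<in> S - {n}" for a
      using card_mono[OF fM subM[OF a]] M2[OF n] by (simp add: deg_in_def)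
    have dm: "deg_in E (B n) m \<le> 4" if m: "m \<in> M n" for m
    proof -
      have "{y \<in> B n. E m y} \<subseteq> B n - {m}" using irr by auto
      then have "deg_in E (B n) m \<le> card (B n - {m})"
        unfolding deg_in_def using finN by (intro card_mono) auto
      then show ?thesis using B5 m finN by (simp add: Bn)
    qed
    have c2: "card (S - {n}) = 2" using S3 n fS by simp
    have zn: "z \<notin> (S - {n}) \<union> M n" "(S - {n}) \<inter> M n = {}" using zST by (auto simp: M_def)
    have f2: "finite (S - {n})" "finite ((S - {n}) \<union> M n)" using fS fM by auto
    have dB: "degsum E (B n) = deg_in E (B n) z + ((\<Sum>a\<in>S - {n}. deg_in E (B n) a) + (\<Sum>m\<in>M n. deg_in E (B n) m))"
    proof -
      have "degsum E (B n) = (\<Sum>x\<in>insert z ((S - {n}) \<union> M n). deg_in E (B n) x)"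
        unfolding degsum_def by (rule sum.cong[OF Bn refl])
      also have "\<dots> = deg_in E (B n) z + (\<Sum>x\<in>(S - {n}) \<union> M n. deg_in E (B n) x)"
        by (rule sum.insert[OF f2(2) zn(1)])
      finally show ?thesis using sum.union_disjoint[OF f2(1) fM zn(2), of "deg_in E (B n)"] by simp
    qed
    have sm: "(\<Sum>m\<in>M n. deg_in E (B n) m) \<le> 8"
      using sum_mono[of "M n" "deg_in E (B n)" "\<lambda>_. 4"] dm M2[OF n] by simp
    have sa: "(\<Sum>a\<in>S - {n}. deg_in E (B n) a) \<le> 4"
      using sum_mono[of "S - {n}" "deg_in E (B n)" "\<lambda>_. 2"] da c2 by simp
    have N6: "card (N n) = 6" using Sprops(1)[OF n] by (simp add: L_card)
    have t2: "2 \<le> card (cn n x)" if "x \<in> N n" for x using cn2[of n x] that by (simp add: inN)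
    have sN: "12 \<le> degsum E (N n)"
      unfolding degsum_N using sum_mono[of "N n" "\<lambda>_. 2" "\<lambda>x. card (cn n x)"] t2 N6 by simp
    have eqs: "degsum E (N n) = 12" "(\<Sum>a\<in>S - {n}. deg_in E (B n) a) = 4"
      using dsum dB sm sa sN dz by linarith+
    have "card (cn n x) = 2" if x: "E n x" for x
    proof -
      have xN: "x \<in> N n" using x by (simp add: inN)
      have "degsum E (N n) = card (cn n x) + (\<Sum>y\<in>N n - {x}. card (cn n y))"
        unfolding degsum_N by (rule sum.remove[OF finN(1) xN])
      moreover have "10 \<le> (\<Sum>y\<in>N n - {x}. card (cn n y))"
        using sum_mono[of "N n - {x}" "\<lambda>_. 2" "\<lambda>x. card (cn n x)"] t2 N6 xN finN by simp
      ultimately show ?thesis using eqs(1) t2[OF xN] by linarith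
    qed
    moreover have "M n \<subseteq> N a" if a: "a \<in> S - {n}" for a
    proof -
      have "card (S - {n} - {a}) = 1" using c2 a f2(1) by simp
      moreover have "(\<Sum>b\<in>S - {n} - {a}. deg_in E (B n) b) \<le> (\<Sum>b\<in>S - {n} - {a}. 2)"
        using da by (intro sum_mono) blast
      ultimately have "(\<Sum>b\<in>S - {n} - {a}. deg_in E (B n) b) \<le> 2" by simp
      then have "2 \<le> deg_in E (B n) a" using eqs(2) sum.remove[OF f2(1) a, of "deg_in E (B n)"] by linarith
      then have "card {y \<in> B n. E a y} = card (M n)" using da[OF a] M2[OF n] by (simp add: deg_in_def)
      then have "{y \<in> B n. E a y} = M n" by (rule card_subset_eq[OF fM subM[OF a]])
      then show ?thesis by (auto simp: inN)
    qed
    ultimately show ?thesis by blast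
  qed
  obtain a b c where abc: "S = {a, b, c}" "a \<noteq> b" "b \<noteq> c" "a \<noteq> c"
    using S3 by (auto simp: card_Suc_eq numeral_3_eq_3)
  have S': "a \<in> S" "b \<in> S" "c \<in> S" using abc(1) by auto
  have Mdis: "M a \<inter> M b = {}" "(M a \<union> M b) \<inter> M c = {}"
    using key[OF S'(1)] key[OF S'(2)] key[OF S'(3)] abc by (auto simp: M_def)
  define T0 where "T0 = T - (M a \<union> M b \<union> M c)"
  have "card (M a \<union> M b \<union> M c) = 6"
    using card_Un_disjoint[OF fM fM Mdis(1)] card_Un_disjoint[OF _ fM Mdis(2)] fM
      M2[OF S'(1)] M2[OF S'(2)] M2[OF S'(3)] by simp
  then have T02: "card T0 = 2"
    unfolding T0_def using T8 fM by (subst card_Diff_subset) (auto simp: M_def)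
  have T0E: "x \<in> T0 \<longleftrightarrow> x \<in> T \<and> (\<forall>n\<in>S. E n x)" for x
    using abc(1) by (auto simp: T0_def M_def inN)
  obtain s where s: "s \<in> T0" using T02 by fastforce
  have sT: "s \<in> T" "\<And>n. n \<in> S \<Longrightarrow> E n s" using s T0E by auto
  have sL: "s \<in> L" using sT(1) T_L by blast
  \<comment> \<open>The two neighbours of \<open>s\<close> outside \<open>insert z S\<close> are its
    common neighbours with every \<open>n\<close> in \<open>S\<close>. So they see all of
    \<open>S\<close> and lie in \<open>T0\<close>, which has only one vertex besides
    \<open>s\<close>.\<close>
  define R where "R = N s - insert z S"
  have "insert z S \<subseteq> N s" using sT(2) sym T_Z[OF sT(1), of z] Z by (auto simp: inN)
  then have R2: "card R = 2" unfolding R_def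
    using fS zST(1) S3 sL by (subst card_Diff_subset) (auto simp: L_card)
  have "R \<subseteq> T0 - {s}"
  proof
    fix x assume x: "x \<in> R"
    then have xs: "E s x" "x \<noteq> z" "x \<notin> S" by (auto simp: R_def inN)
    have "E n x" if n: "n \<in> S" for n
    proof -
      have "cn n s \<subseteq> R" using nz(1)[OF n] indep[OF n] by (auto simp: R_def incn inN)
      moreover have "card (cn n s) = card R" using key[OF n] sT(2)[OF n] R2 by simp
      ultimately have "cn n s = R" using finN by (intro card_subset_eq) (auto simp: R_def)
      then show ?thesis using x by (auto simp: incn)
    qed
    moreover have "x \<in> T" using VS[of x] inV(2)[OF xs(1)] xs by blast
    ultimately show "x \<in> T0 - {s}" using T0E[of x] xs(1) irr[of s] by auto
  qed
  moreover have "finite T0" using fT by (simp add: T0_def)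
  ultimately have "card R \<le> card (T0 - {s})" by (intro card_mono) auto
  then show False using R2 T02 s \<open>finite T0\<close> by simp
qed

text \<open>After the critical contraction \<open>z\<close> has at least three neighbours in
  \<open>N w - {x}\<close>. The other vertex of \<open>Z\<close> is not among them, so all three
  remaining candidates are: \<open>v\<close>, which now stands for the merged edge, and the two
  further neighbours of \<open>w\<close>.\<close>

lemma two_excess_common:
  assumes cZ: "card Z = 2" and v: "v \<in> L" "v \<notin> T" and x: "E v x" "x \<notin> Z" "card (cn v x) = 2"
    and w: "w \<in> cn v x" and z: "z \<in> Z"
  shows "E z v \<or> E z x" "y \<in> N w \<Longrightarrow> y \<noteq> v \<Longrightarrow> y \<noteq> x \<Longrightarrow> y \<notin> Z \<Longrightarrow> E z y"
proof -
  have wT: "w \<in> T" using two_common_sub_T[OF v x(1,3)] w by blast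
  then have wL: "w \<in> L" using T_L by blast
  have wvx: "E w v" "E w x" using w sym[of v w] sym[of x w] by (auto simp: incn)
  have ZN: "Z \<subseteq> N w" using T_Z[OF wT] by (auto simp: inN)
  have c: "2 * card (cn v x) \<le> exc V + 2" using x(3) e2 by simp
  define Y where "Y = {y \<in> N w - {x}. contr E v x z y}"
  have vx: "v \<noteq> x" "v \<notin> Z" using x(1) irr v(1) LZ(3) by auto
  have "3 \<le> card Y"
    using critical_contr(1)[OF x(1) c w wL, of z] z ZN x(2) by (auto simp: Y_def deg_in_def)
  moreover have "card (N w - insert x Z) = 3"
    using ZN wvx wL cZ x(2) LZ(6) by (subst card_Diff_subset) (auto simp: L_card inN)
  moreover have sub: "Y \<subseteq> N w - insert x Z"
    using Z_indep[OF z] z vx by (auto simp: Y_def contr_def)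
  moreover have "card Y \<le> card (N w - insert x Z)" using sub finN by (intro card_mono) auto
  ultimately have Y: "Y = N w - insert x Z" using finN by (intro card_subset_eq) auto
  have "v \<in> Y" unfolding Y using wvx vx by (auto simp: inN)
  then show "E z v \<or> E z x" by (auto simp: Y_def contr_def sym_iff)
  show "E z y" if "y \<in> N w" "y \<noteq> v" "y \<noteq> x" "y \<notin> Z"
  proof -
    have "y \<in> Y" unfolding Y using that by auto
    then show ?thesis using that z vx by (auto simp: Y_def contr_def)
  qed
qed

text \<open>As \<open>v\<close> has no neighbour in \<open>Z\<close>,
  \<open>two_excess_common\<close> makes every vertex of \<open>tw v\<close> adjacent to all of
  \<open>Z\<close>, and there are at least four of these. A neighbour outside \<open>T\<close> would
  find its common neighbours with \<open>v\<close> in a set of at most one vertex.\<close>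

lemma two_excess_nonadjacent:
  assumes cZ: "card Z = 2" and v: "v \<in> L" "exc (N v) = 0"
  shows "N v \<subseteq> T"
proof
  have vT: "v \<notin> T" using v(2) by (simp add: T_def)
  have vZ: "\<not> E v z" if "z \<in> Z" for z using exc_N_0[of v] v LZ(1) that inN[of z v] by blast
  have "tw v \<subseteq> T"
  proof
    fix x assume "x \<in> tw v"
    then have x: "E v x" "card (cn v x) = 2" by (auto simp: tw_def inN)
    have xZ: "x \<notin> Z" using vZ x(1) by blast
    obtain w where w: "w \<in> cn v x" using x(2) by fastforce
    have "E x z" if z: "z \<in> Z" for z
      using two_excess_common(1)[OF cZ v(1) vT x(1) xZ x(2) w z] vZ[OF z] sym by blast
    moreover have "x \<in> L" using xZ inV(2)[OF x(1)] LZ(4) by blast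
    ultimately show "x \<in> T" using Z_T by blast
  qed
  fix g assume "g \<in> N v"
  then have g: "E v g" by (simp add: inN)
  show "g \<in> T"
  proof (rule ccontr)
    assume gT: "g \<notin> T"
    have gn: "g \<in> N v - tw v" using g gT \<open>tw v \<subseteq> T\<close> by (auto simp: inN)
    have "cn v g \<subseteq> N v - tw v - {g}" using cn_non_tw[OF v(1) vT g gT] irr by (auto simp: incn)
    then have "card (cn v g) \<le> card (N v - tw v - {g})" using finN by (intro card_mono) auto
    also have "\<dots> = 6 - card (tw v) - 1" using gn finN card_non_tw[OF v(1)] by simp
    finally show False using cn2[OF g] card_tw[OF v(1)] v(2) by linarith
  qed
qed

text \<open>Counting gives \<open>card T = card S + 4\<close>, where \<open>S\<close> holds the
  vertices of \<open>L\<close> adjacent to neither \<open>z\<close> nor \<open>z'\<close>. Once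
  \<open>S\<close> is shown to be empty, each of the three vertices of \<open>Q\<close> claims two
  vertices of \<open>T\<close> for itself, six out of four.\<close>

lemma two_excess_vertices_contradiction:
  assumes Z: "Z = {z, z'}" "z \<noteq> z'" and d7: "deg_in E V z = 7" "deg_in E V z' = 7"
  shows False
proof -
  have cZ: "card Z = 2" using Z by simp
  have zz: "z \<in> Z" "z' \<in> Z" using Z(1) by auto
  have NL: "N z \<subseteq> L" "N z' \<subseteq> L"
  proof -
    have "N y \<subseteq> L" if "y \<in> Z" for y
    proof
      fix x assume "x \<in> N y"
      then have x: "E y x" by (simp add: inN)
      then show "x \<in> L" using inV(2)[OF x] Z_indep[OF that, of x] LZ(4) by blast
    qed
    then show "N z \<subseteq> L" "N z' \<subseteq> L" using zz by auto
  qed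
  have T: "T = N z \<inter> N z'"
  proof
    show "T \<subseteq> N z \<inter> N z'" using T_Z[OF _ zz(1)] T_Z[OF _ zz(2)] sym by (auto simp: inN)
    show "N z \<inter> N z' \<subseteq> T"
    proof
      fix x assume "x \<in> N z \<inter> N z'"
      then have "x \<in> L" "E x z" "E x z'" using NL sym[of z x] sym[of z' x] by (auto simp: inN)
      then show "x \<in> T" using Z_T[of x] Z(1) by auto
    qed
  qed
  define S where "S = L - (N z \<union> N z')"
  have fT: "finite T" "finite S" using finN LZ(5) by (auto simp: T S_def)
  have N7: "card (N z) = 7" "card (N z') = 7" using d7 by (simp_all add: cardN)
  have L10: "card L = 10" using card_Un_disjoint[OF LZ(5,6,3)] LZ(4) nV cZ by simp
  have U: "card (N z \<union> N z') + card T = 14" using card_Un_Int[OF finN(1) finN(1), of z z'] N7 T by simp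
  have "card S = card L - card (N z \<union> N z')"
    unfolding S_def using finN NL by (intro card_Diff_subset) auto
  moreover have "card (N z \<union> N z') \<le> card L" using NL LZ(5) by (intro card_mono) auto
  ultimately have ST: "card S + card (N z \<union> N z') = 10" using L10 by linarith
  have SE: "v \<in> S \<longleftrightarrow> v \<in> L \<and> exc (N v) = 0" for v
  proof -
    have "v \<in> S \<longleftrightarrow> v \<in> L \<and> N v \<inter> Z = {}" using Z(1) sym_iff[of v] by (auto simp: S_def inN)
    then show ?thesis using exc_N_0[of v] LZ(1) by blast
  qed
  have NT: "N v \<subseteq> T" if "v \<in> S" for v using two_excess_nonadjacent[OF cZ] SE that by blast
  have T4: "card T = 4" and "S = {}"
  proof -
    show "S = {}"
    proof (rule ccontr)
      assume ne: "S \<noteq> {}"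
      have N6: "card (N v) = 6" if "v \<in> S" for v using that SE by (simp add: L_card)
      obtain v where v: "v \<in> S" using ne by blast
      have "6 \<le> card T" using card_mono[OF fT(1) NT[OF v]] N6[OF v] by simp
      moreover have "card T \<le> 7" using card_mono[of "N z" T] N7 finN T by simp
      ultimately have cT: "card T = 6 \<and> card S = 2 \<or> card T = 7 \<and> card S = 3" using U ST by linarith
      \<comment> \<open>At most 2 * 0 or 3 * 1 vertices of \<open>T\<close> are missed by some
        vertex of \<open>S\<close>, fewer than \<open>card T\<close>.\<close>
      have "card (\<Union>v\<in>S. T - N v) \<le> (\<Sum>v\<in>S. card (T - N v))" by (rule card_UN_le[OF fT(2)])
      also have "\<dots> = (\<Sum>v\<in>S. card T - 6)"
        using NT N6 finN by (intro sum.cong refl) (simp add: card_Diff_subset)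
      also have "\<dots> < card T" using cT by auto
      finally have "(\<Union>v\<in>S. T - N v) \<noteq> T" by auto
      then obtain t where "t \<in> T" "t \<notin> (\<Union>v\<in>S. T - N v)" by blast
      then have t: "t \<in> T" "\<And>v. v \<in> S \<Longrightarrow> E v t" by (auto simp: inN)
      \<comment> \<open>\<open>t\<close> sees \<open>Z\<close>, \<open>S\<close> and at least two
        common neighbours with \<open>v\<close> in \<open>T\<close>; degree 6 allows only
        \<open>card S = 2\<close> and no further neighbour.\<close>
      have nbrs: "card S = 2 \<and> N t \<subseteq> Z \<union> S \<union> T" if t: "t \<in> T" "\<And>v. v \<in> S \<Longrightarrow> E v t" for t
      proof -
        have sub: "Z \<union> S \<union> cn v t \<subseteq> N t"
          using T_Z[OF t(1)] t(2) sym by (auto simp: inN incn)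
        have c2: "2 \<le> card (cn v t)" "cn v t \<subseteq> T" using cn2[OF t(2)[OF v]] NT[OF v] by (auto simp: incn inN)
        have "card (Z \<union> S \<union> cn v t) = card Z + card S + card (cn v t)"
        proof -
          have "Z \<inter> S = {}" "(Z \<union> S) \<inter> cn v t = {}" using LZ(3) c2(2) T_L T by (auto simp: S_def)
          then show ?thesis using fT LZ(6) finN by (simp add: card_Un_disjoint)
        qed
        moreover have "card (Z \<union> S \<union> cn v t) \<le> card (N t)" by (rule card_mono[OF finN(1) sub])
        moreover have "card (N t) = 6" using t(1) T_L by (auto simp: L_card)
        ultimately have eq: "card S = 2" "card (Z \<union> S \<union> cn v t) = card (N t)" using cZ c2(1) cT by linarith+
        have "Z \<union> S \<union> cn v t = N t" by (rule card_subset_eq[OF finN(1) sub eq(2)])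
        then show ?thesis using eq(1) c2(2) by blast
      qed
      have S2: "card S = 2" using nbrs[OF t] by blast
      then have T6: "card T = 6" using cT by auto
      have NS: "N v = T" if "v \<in> S" for v using NT[OF that] N6[OF that] T6 fT by (intro card_subset_eq) auto
      define P where "P = L - T - S"
      have "T \<inter> S = {}" using T by (auto simp: S_def)
      then have "card (L - T - S) = 2"
        using T_L fT L10 S2 T6 by (subst card_Diff_subset) (auto simp: S_def card_Diff_subset)
      then have P2: "card P = 2" by (simp add: P_def)
      then obtain p where p: "p \<in> P" by fastforce
      have "N p \<subseteq> Z \<union> P"
      proof
        fix x assume "x \<in> N p"
        then have x: "E p x" "E x p" using sym[of p x] by (auto simp: inN)
        have pn: "p \<in> L" "p \<notin> T" "p \<notin> S" "p \<notin> Z" using p LZ(3) by (auto simp: P_def)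
        have "x \<notin> S" using NS[of x] pn(2) x(2) inN[of p x] by blast
        moreover have "x \<notin> T"
        proof
          assume xT: "x \<in> T"
          have "E v x" if "v \<in> S" for v using NS[OF that] xT inN[of x v] by blast
          then have "N x \<subseteq> Z \<union> S \<union> T" using nbrs[OF xT] by blast
          then show False using x(2) pn by (auto simp: inN)
        qed
        ultimately show "x \<in> Z \<union> P" using inV(2)[OF x(1)] LZ(4) by (auto simp: P_def)
      qed
      then have "card (N p) \<le> card (Z \<union> P)" using LZ by (intro card_mono) (auto simp: P_def)
      also have "\<dots> \<le> 4" using card_Un_le[of Z P] cZ P2 by simp
      finally show False using p by (auto simp: P_def L_card)
    qed
    then show "card T = 4" using U ST by simp
  qed
  define Q where "Q = N z - T"
  have Q3: "card Q = 3" unfolding Q_def using T T4 N7 fT by (subst card_Diff_subset) auto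
  \<comment> \<open>\<open>W\<close> consists of the common neighbours of \<open>v\<close> and some
    \<open>x\<close> in \<open>tw v\<close> other than \<open>z\<close>. Another vertex of
    \<open>Q\<close> adjacent to one of them would be adjacent to \<open>z'\<close> by
    \<open>two_excess_common\<close>, hence in \<open>T\<close>.\<close>
  have "\<exists>W. W \<subseteq> T \<and> card W = 2 \<and> (\<forall>w\<in>W. E v w \<and> N w \<inter> Q \<subseteq> {v})" if v: "v \<in> Q" for v
  proof -
    have vL: "v \<in> L" "v \<notin> T" "E z v" "\<not> E v z'" using v NL T sym[of v z'] by (auto simp: Q_def inN)
    have "2 \<le> card (tw v)" using card_tw[OF vL(1)] not_T_exc[OF vL(1,2)] by linarith
    then have "\<not> tw v \<subseteq> {z}" using card_mono[of "{z}" "tw v"] by auto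
    then obtain x where x: "x \<in> tw v" "x \<noteq> z" by blast
    then have vx: "E v x" "card (cn v x) = 2" by (auto simp: tw_def inN)
    have xZ: "x \<notin> Z" using x(2) vx(1) vL(4) Z(1) by auto
    have sub: "cn v x \<subseteq> T" by (rule two_common_sub_T[OF vL(1,2) vx])
    have xz: "\<not> E z x"
    proof
      assume "E z x"
      then have "z \<in> cn v x" using vL(3) sym[of z v] sym[of z x] by (simp add: incn)
      then have "z \<in> L" using sub T_L by blast
      then show False using zz LZ(3) by blast
    qed
    have "E v w \<and> N w \<inter> Q \<subseteq> {v}" if w: "w \<in> cn v x" for w
    proof -
      have "y = v" if y: "y \<in> N w" "y \<in> Q" for y
      proof (rule ccontr)
        assume yv: "y \<noteq> v"
        have yz: "E z y" "y \<in> L" "y \<notin> T" using y(2) NL by (auto simp: Q_def inN)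
        have yx: "y \<noteq> x" "y \<notin> Z" using yz xz LZ(3) by auto
        have "E z' y"
          by (rule two_excess_common(2)[OF cZ vL(1,2) vx(1) xZ vx(2) w zz(2) y(1) yv yx])
        then show False using yz T by (auto simp: inN)
      qed
      then show ?thesis using w by (auto simp: incn)
    qed
    then show ?thesis using sub vx(2) by blast
  qed
  then obtain W where W: "\<And>v. v \<in> Q \<Longrightarrow> W v \<subseteq> T \<and> card (W v) = 2 \<and> (\<forall>w\<in>W v. E v w \<and> N w \<inter> Q \<subseteq> {v})"
    by metis
  have "W v \<inter> W v' = {}" if vv: "v \<in> Q" "v' \<in> Q" "v \<noteq> v'" for v v'
  proof (rule ccontr)
    assume "W v \<inter> W v' \<noteq> {}"
    then obtain w where w: "w \<in> W v" "w \<in> W v'" by blast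
    have "N w \<inter> Q \<subseteq> {v}" using W[OF vv(1)] w(1) by blast
    moreover have "E v' w" using W[OF vv(2)] w(2) by blast
    then have "v' \<in> N w" using sym[of v' w] by (simp add: inN)
    ultimately show False using vv by blast
  qed
  moreover have "finite Q" using finN by (simp add: Q_def)
  moreover have "finite (W v)" if "v \<in> Q" for v using W[OF that] fT finite_subset by blast
  ultimately have "card (\<Union>v\<in>Q. W v) = (\<Sum>v\<in>Q. card (W v))" by (intro card_UN_disjoint) auto
  also have "\<dots> = (\<Sum>v\<in>Q. 2)" using W by (intro sum.cong) auto
  finally have "card (\<Union>v\<in>Q. W v) = 6" using Q3 by simp
  moreover have "card (\<Union>v\<in>Q. W v) \<le> card T" using W fT by (intro card_mono) auto
  ultimately show False using T4 by simp
qed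

lemma excess2_contradiction: False
  using Z_cases
proof (elim disjE exE conjE)
  fix z assume "Z = {z}" "deg_in E V z = 8"
  then show False by (rule one_excess_vertex_contradiction)
next
  fix z z' assume "Z = {z, z'}" "z \<noteq> z'" "deg_in E V z = 7" "deg_in E V z' = 7"
  then show False by (rule two_excess_vertices_contradiction)
qed

end

section \<open>The theorem\<close>

lemma clique_minor_6:
  assumes G: "sgraph V E" and c: "card V = 12" and d: "\<And>x. x \<in> V \<Longrightarrow> 6 \<le> deg_in E V x"
  shows "clique_minor V E 6"
proof (rule ccontr)
  assume n: "\<not> clique_minor V E 6"
  have "\<exists>F. sgraph V F \<and> (\<forall>x y. F x y \<longrightarrow> E x y) \<and> (\<forall>x\<in>V. 6 \<le> deg_in F V x) \<and>
    (\<forall>x y. F x y \<longrightarrow> deg_in F V x = 6 \<or> deg_in F V y = 6)"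
    by (rule exists_minimal_subgraph[OF G d])
  then obtain F where F: "sgraph V F" "\<forall>x y. F x y \<longrightarrow> E x y" "\<forall>x\<in>V. 6 \<le> deg_in F V x"
    "\<forall>x y. F x y \<longrightarrow> deg_in F V x = 6 \<or> deg_in F V y = 6"
    by (elim exE conjE)
  have "\<not> clique_minor V F 6" using clique_minor_mono[of V F 6 V E] F(2) n by blast
  then interpret counterexample V F using F c by unfold_locales auto
  show False using exc_cases
  proof (elim disjE)
    assume "exc V = 0"
    then interpret regular_counterexample V F by unfold_locales
    show False by (rule regular_contradiction)
  next
    assume "exc V = 2"
    then interpret excess2 V F by unfold_locales
    show False by (rule excess2_contradiction)
  next
    assume "exc V = 4"
    then show False by (rule exc4_contradiction)
  qed
qed

lemma min_degree_le_deg_in: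
  assumes G: "pair_graph G" and x: "x \<in> pverts G"
  shows "min_degree G \<le> deg_in (arc_rel G) (pverts G) x"
proof -
  interpret pair_graph G by (rule G)
  have "out_arcs (with_proj G) x = Pair x ` {y \<in> pverts G. arc_rel G x y}"
    using sgraphD(3)[OF sgraph_arc_rel[OF G], of x] by (auto simp: out_arcs_def arc_rel_def)
  then have "out_degree (with_proj G) x = deg_in (arc_rel G) (pverts G) x"
    by (simp add: out_degree_def deg_in_def card_image inj_on_def)
  moreover have "min_degree G \<le> out_degree (with_proj G) x"
    unfolding min_degree_def using x by (intro Min_le) auto
  ultimately show ?thesis by simp
qed

theorem theorem4:
  fixes G :: "'a pair_pre_digraph"
  assumes "pair_graph G"
    and "card (pverts G) = 12"
    and "min_degree G \<ge> 6"
  shows "has_complete_minor G 6"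
proof (rule has_complete_minorI[OF assms(1)])
  show "clique_minor (pverts G) (arc_rel G) 6"
    using clique_minor_6[OF sgraph_arc_rel[OF assms(1)] assms(2)]
      min_degree_le_deg_in[OF assms(1)] assms(3) le_trans by blast
qed

end
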